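(* Let $b>0$, $p\ge 2$, $\beta_1>0$ and $\varepsilon>0$. Consider the problem $$u_t=|\Delta_p u+\varepsilon\Delta u|^{\beta_1-1}(\Delta_p u+\varepsilon\Delta u) \text{ in } (-b,b)\times(0,\infty),$$ $$\lim_{x\to\pm b}u(x,t)=\infty \text{ for any } t>0,\qquad u(\cdot,0)=u_0 \text{ in } (-b,b), \quad (P)$$ where $\Delta_p u+\varepsilon\Delta u=\{(p-1)|u_x|^{p-2}+\varepsilon\}u_{xx}$. (1) If $\beta_1\ge\frac{1}{p-1}$ and $u_0\in C((-b,b))$ satisfies $\inf_{x\in(-b,b)}u_0(x)>-\infty$, then there is no viscosity solution of $(P)$. (2) Suppose $0<\beta_1<\frac{1}{p-1}$ and that either $u_0\in C([-b,b])$, or $u_0\in C((-b,b))$ satisfies $$\lim_{x\to\pm b}u_0(x)=\infty,\quad \limsup_{x\to b}u_0(x)(b-x)^{\gamma}<\infty,\quad \limsup_{x\to -b}u_0(x)(b+x)^{\gamma}<\infty$$ for some $\gamma>0$. Then a viscosity solution of $(P)$ exists globally in time, i.e. there is a viscosity solution $u:(-b,b)\times[0,\infty)\to\mathbb{R}$ of $(P)$.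
   Context: Put $f(s)=|s|^{\beta_1-1}s$ and $g(s)=(p-1)|s|^{p-2}+\varepsilon$, so the equation is $u_t-f(g(u_x)u_{xx})=0$. Let $Q=(-b,b)\times(0,\infty)$, $Q_0=(-b,b)\times[0,\infty)$ and $F(q,z)=-f(g(q)z)$ for $q,z\in\mathbb{R}$. For a function $u$ on $Q_0$, its upper and lower semicontinuous envelopes are $u^*(x,t)=\lim_{r\to+0}\sup\{u(y,s):(y,s)\in Q_0\cap B_r((x,t))\}$ and $u_*(x,t)=\lim_{r\to+0}\inf\{u(y,s):(y,s)\in Q_0\cap B_r((x,t))\}$, for $(x,t)\in\overline{Q}$. An upper semicontinuous function $u$ in $Q_0$ is a sub-solution (of the equation with the singular boundary condition) if whenever $(x_0,t_0)\in Q$ and $\phi\in C^2(Q)$ are such that $u-\phi$ attains a local maximum at $(x_0,t_0)$, one has $\phi_t(x_0,t_0)+F(\phi_x(x_0,t_0),\phi_{xx}(x_0,t_0))\le 0$. A lower semicontinuous function $u$ in $Q_0$ is a super-solution if (i) whenever $(x_0,t_0)\in Q$ and $\phi\in C^2(Q)$ are such that $u-\phi$ attains a local minimum at $(x_0,t_0)$, one has $\phi_t(x_0,t_0)+F(\phi_x(x_0,t_0),\phi_{xx}(x_0,t_0))\ge 0$; and (ii) $\lim_{x\to\pm b}u(x,t)=\infty$ for any $t>0$. A function $u:Q_0\to\mathbb{R}$ is a viscosity solution of $(P)$ if $u^*$ is a sub-solution, $u_*$ is a super-solution, and $u^*(\cdot,0)=u_*(\cdot,0)=u_0$ in $(-b,b)$.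 *)

theory Defs
  imports "HOL-Analysis.Analysis"
begin

text \<open>Points of space-time are pairs \<open>(x, t)\<close>. Functions on \<open>cyl0 b\<close> are rendered as total functions
  on \<open>real \<times> real\<close>; no definition below depends on their values outside \<open>cyl0 b\<close>.\<close>

definition cyl :: "real \<Rightarrow> (real \<times> real) set" where
  "cyl b = {-b<..<b} \<times> {0<..}"

definition cyl0 :: "real \<Rightarrow> (real \<times> real) set" where
  "cyl0 b = {-b<..<b} \<times> {0..}"

section \<open>The equation\<close>

text \<open>For \<open>\<beta> \<le> 1\<close> the value at \<open>s = 0\<close> is the intended \<open>0\<close>, since \<open>0 powr a = 0\<close> for all \<open>a\<close>.\<close>

definition f_pow :: "real \<Rightarrow> real \<Rightarrow> real" where
  "f_pow \<beta> s = \<bar>s\<bar> powr (\<beta> - 1) * s"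

text \<open>The case \<open>p = 2\<close> is separated because \<open>0 powr 0 = 0\<close>, whereas \<open>\<bar>s\<bar>\<close> to the power \<open>p - 2\<close> must
  be \<open>1\<close> for every \<open>s\<close>, including \<open>s = 0\<close>.\<close>

definition g_diff :: "real \<Rightarrow> real \<Rightarrow> real \<Rightarrow> real" where
  "g_diff p \<epsilon> s = (p - 1) * (if p = 2 then 1 else \<bar>s\<bar> powr (p - 2)) + \<epsilon>"

definition F_op :: "real \<Rightarrow> real \<Rightarrow> real \<Rightarrow> real \<Rightarrow> real \<Rightarrow> real" where
  "F_op p \<beta> \<epsilon> q z = - f_pow \<beta> (g_diff p \<epsilon> q * z)"

section \<open>Test functions\<close>

definition dx :: "(real \<times> real \<Rightarrow> real) \<Rightarrow> real \<times> real \<Rightarrow> real" where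
  "dx \<phi> z = deriv (\<lambda>y. \<phi> (y, snd z)) (fst z)"

definition dt :: "(real \<times> real \<Rightarrow> real) \<Rightarrow> real \<times> real \<Rightarrow> real" where
  "dt \<phi> z = deriv (\<lambda>s. \<phi> (fst z, s)) (snd z)"

text \<open>Intended for open \<open>S\<close>.\<close>

definition C1_on :: "(real \<times> real) set \<Rightarrow> (real \<times> real \<Rightarrow> real) \<Rightarrow> bool" where
  "C1_on S \<phi> \<longleftrightarrow>
     (\<forall>(x, t)\<in>S. (\<lambda>y. \<phi> (y, t)) differentiable (at x) \<and> (\<lambda>s. \<phi> (x, s)) differentiable (at t)) \<and>
     continuous_on S (dx \<phi>) \<and> continuous_on S (dt \<phi>)"

definition C2_on :: "(real \<times> real) set \<Rightarrow> (real \<times> real \<Rightarrow> real) \<Rightarrow> bool" where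
  "C2_on S \<phi> \<longleftrightarrow> C1_on S \<phi> \<and> C1_on S (dx \<phi>) \<and> C1_on S (dt \<phi>)"

section \<open>Semicontinuity and semicontinuous envelopes\<close>

definition usc_on :: "'a::topological_space set \<Rightarrow> ('a \<Rightarrow> real) \<Rightarrow> bool" where
  "usc_on S w \<longleftrightarrow> (\<forall>z\<in>S. \<forall>a>w z. \<forall>\<^sub>F y in at z within S. w y < a)"

definition lsc_on :: "'a::topological_space set \<Rightarrow> ('a \<Rightarrow> real) \<Rightarrow> bool" where
  "lsc_on S w \<longleftrightarrow> (\<forall>z\<in>S. \<forall>a<w z. \<forall>\<^sub>F y in at z within S. a < w y)"

definition upper_env :: "real \<Rightarrow> (real \<times> real \<Rightarrow> real) \<Rightarrow> real \<times> real \<Rightarrow> ereal" where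
  "upper_env b u z = Lim (at_right 0) (\<lambda>r::real. SUP w\<in>cyl0 b \<inter> ball z r. ereal (u w))"

definition lower_env :: "real \<Rightarrow> (real \<times> real \<Rightarrow> real) \<Rightarrow> real \<times> real \<Rightarrow> ereal" where
  "lower_env b u z = Lim (at_right 0) (\<lambda>r::real. INF w\<in>cyl0 b \<inter> ball z r. ereal (u w))"

text \<open>The limits in the two definitions exist.\<close>

lemma upper_env_tendsto:
  "((\<lambda>r::real. SUP w\<in>cyl0 b \<inter> ball z r. ereal (u w)) \<longlongrightarrow> upper_env b u z) (at_right 0)"
  and upper_env_eq_INF:
  "upper_env b u z = (INF r\<in>{0<..}. SUP w\<in>cyl0 b \<inter> ball z r. ereal (u w))"
proof -
  let ?h = "\<lambda>r::real. SUP w\<in>cyl0 b \<inter> ball z r. ereal (u w)"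
  have mono: "?h r \<le> ?h s" if "r \<le> s" for r s
    using that by (intro SUP_subset_mono) auto
  have *: "(?h \<longlongrightarrow> (INF r\<in>{0<..}. ?h r)) (at_right 0)"
  proof (rule order_tendstoI)
    fix a assume "a < (INF r\<in>{0<..}. ?h r)"
    then have "a < ?h r" if "r > 0" for r
      using that by (meson INF_lower greaterThan_iff less_le_trans)
    then show "\<forall>\<^sub>F r in at_right 0. a < ?h r"
      by (auto simp: eventually_at_right_field intro: exI[of _ 1])
  next
    fix a assume "(INF r\<in>{0<..}. ?h r) < a"
    then obtain s where "s > 0" "?h s < a"
      by (auto simp: INF_less_iff)
    then show "\<forall>\<^sub>F r in at_right 0. ?h r < a"
      using mono by (auto simp: eventually_at_right_field intro!: exI[of _ s] intro: le_less_trans less_imp_le)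
  qed
  then show **: "upper_env b u z = (INF r\<in>{0<..}. ?h r)"
    unfolding upper_env_def by (intro tendsto_Lim) auto
  show "(?h \<longlongrightarrow> upper_env b u z) (at_right 0)"
    using * ** by simp
qed

lemma lower_env_tendsto:
  "((\<lambda>r::real. INF w\<in>cyl0 b \<inter> ball z r. ereal (u w)) \<longlongrightarrow> lower_env b u z) (at_right 0)"
  and lower_env_eq_SUP:
  "lower_env b u z = (SUP r\<in>{0<..}. INF w\<in>cyl0 b \<inter> ball z r. ereal (u w))"
proof -
  let ?h = "\<lambda>r::real. INF w\<in>cyl0 b \<inter> ball z r. ereal (u w)"
  have mono: "?h s \<le> ?h r" if "r \<le> s" for r s
    using that by (intro INF_superset_mono) auto
  have *: "(?h \<longlongrightarrow> (SUP r\<in>{0<..}. ?h r)) (at_right 0)"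
  proof (rule order_tendstoI)
    fix a assume "(SUP r\<in>{0<..}. ?h r) < a"
    then have "?h r < a" if "r > 0" for r
      using that by (meson SUP_upper greaterThan_iff le_less_trans)
    then show "\<forall>\<^sub>F r in at_right 0. ?h r < a"
      by (auto simp: eventually_at_right_field intro: exI[of _ 1])
  next
    fix a assume "a < (SUP r\<in>{0<..}. ?h r)"
    then obtain s where "s > 0" "a < ?h s"
      by (auto simp: less_SUP_iff)
    then show "\<forall>\<^sub>F r in at_right 0. a < ?h r"
      using mono by (auto simp: eventually_at_right_field intro!: exI[of _ s] intro: less_le_trans less_imp_le)
  qed
  then show **: "lower_env b u z = (SUP r\<in>{0<..}. ?h r)"
    unfolding lower_env_def by (intro tendsto_Lim) auto
  show "(?h \<longlongrightarrow> lower_env b u z) (at_right 0)"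
    using * ** by simp
qed

section \<open>Viscosity solutions\<close>

text \<open>As \<open>cyl b\<close> is open, a local extremum relative to \<open>cyl b\<close> is an extremum on a neighbourhood.\<close>

definition sub_solution ::
    "real \<Rightarrow> real \<Rightarrow> real \<Rightarrow> real \<Rightarrow> (real \<times> real \<Rightarrow> real) \<Rightarrow> bool" where
  "sub_solution b p \<beta> \<epsilon> u \<longleftrightarrow>
     usc_on (cyl0 b) u \<and>
     (\<forall>z\<in>cyl b. \<forall>\<phi>. C2_on (cyl b) \<phi> \<and> (\<forall>\<^sub>F w in nhds z. u w - \<phi> w \<le> u z - \<phi> z)
        \<longrightarrow> dt \<phi> z + F_op p \<beta> \<epsilon> (dx \<phi> z) (dx (dx \<phi>) z) \<le> 0)"

definition super_solution ::
    "real \<Rightarrow> real \<Rightarrow> real \<Rightarrow> real \<Rightarrow> (real \<times> real \<Rightarrow> real) \<Rightarrow> bool" where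
  "super_solution b p \<beta> \<epsilon> u \<longleftrightarrow>
     lsc_on (cyl0 b) u \<and>
     (\<forall>z\<in>cyl b. \<forall>\<phi>. C2_on (cyl b) \<phi> \<and> (\<forall>\<^sub>F w in nhds z. u w - \<phi> w \<ge> u z - \<phi> z)
        \<longrightarrow> dt \<phi> z + F_op p \<beta> \<epsilon> (dx \<phi> z) (dx (dx \<phi>) z) \<ge> 0) \<and>
     (\<forall>t>0. filterlim (\<lambda>x. u (x, t)) at_top (at_left b) \<and>
            filterlim (\<lambda>x. u (x, t)) at_top (at_right (-b)))"

text \<open>Sub- and super-solutions are real-valued, so the envelopes, which are a priori extended-real,
  have to be finite on \<open>cyl0 b\<close>. This excludes nothing: if the upper envelope were \<open>\<infinity>\<close> at
  a point of \<open>cyl b\<close>, every test function would touch it from above there, which is incompatible with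
  the sub-solution inequality (dually for the lower envelope), and for \<open>t = 0\<close> both envelopes
  equal \<open>u0\<close>.\<close>

definition viscosity_solution ::
    "real \<Rightarrow> real \<Rightarrow> real \<Rightarrow> real \<Rightarrow> (real \<Rightarrow> real) \<Rightarrow> (real \<times> real \<Rightarrow> real) \<Rightarrow> bool" where
  "viscosity_solution b p \<beta> \<epsilon> u0 u \<longleftrightarrow>
     (\<forall>z\<in>cyl0 b. \<bar>upper_env b u z\<bar> \<noteq> \<infinity> \<and> \<bar>lower_env b u z\<bar> \<noteq> \<infinity>) \<and>
     sub_solution b p \<beta> \<epsilon> (\<lambda>z. real_of_ereal (upper_env b u z)) \<and>
     super_solution b p \<beta> \<epsilon> (\<lambda>z. real_of_ereal (lower_env b u z)) \<and>
     (\<forall>x\<in>{-b<..<b}. upper_env b u (x, 0) = ereal (u0 x) \<and> lower_env b u (x, 0) = ereal (u0 x))"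

end

(* Nonexistence.  Only the lower envelope A and the end x = b matter.  Since A(x,t) tends to infinity for
   each t separately, uniformity has to be recovered first.  Lower bounds for A persist from earlier
   times, so Baire's theorem turns "for each t" into "on an open interval of times".  A second use of
   Baire's theorem, on the closed set of times near which liminf A < M, shows that this set is empty:
   across a gap of that set the bound M is propagated by linear barriers, and the corner at the
   beginning of the gap is removable.  Once A blows up uniformly, the strict subsolutions
   M (kappa t + q(x)) with q convex stay below A for all M >= 1 if beta (p - 1) >= 1, so A is infinite.

   Existence.  Perron's method needs no comparison principle here, because explicit barriers with the right
   initial values and lateral blow-up exist if beta (p - 1) < 1 and are ordered by inspection: the upper
   ones grow in time faster than the lower ones. *)

theory Submission
  imports Defs
begin

section \<open>The nonlinearity and lower semicontinuous functions\<close>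

text \<open>Both halves turn on one power count: a steep profile multiplied by \<open>a\<close>
  \<ge> 1 is moved by the equation at a speed of order a^(\<beta> (p - 1)). If this exponent is at
  least 1, a multiple \<open>M\<close> of one convex profile can grow at a speed proportional to
  \<open>M\<close>, however large \<open>M\<close> is, and one fixed interior value of
  \<open>A\<close> exceeds every bound. If it is below 1, large multiples are slow: K exp(L t) G(x)
  is a supersolution with \<open>L\<close> independent of \<open>K\<close>, and blow-up of order
  \<open>m\<close> at the ends is sustainable as soon as m (1 - \<beta> (p - 1)) \<ge> \<beta> p.
  The obstacle to nonexistence is that comparison on rectangles reaching towards x = b needs a lower
  bound near that side which is uniform over a time interval. The worst place is a corner, where
  neither the initial nor the lateral bound holds in a full neighbourhood; there a scale-invariant
  barrier must improve any finite defect by a fixed amount. In the existence proof the lateral lower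
  barrier starts from a constant like t^q, so the upper barriers must outgrow it in time; since q
  \<ge> 1, exp(L t) - 1 does so.\<close>

lemma f_pow_eq: "f_pow \<beta> s = max s 0 powr \<beta> - max (- s) 0 powr \<beta>"
proof (cases "s = 0")
  case False
  then have "\<bar>s\<bar> powr (\<beta> - 1) * \<bar>s\<bar> = \<bar>s\<bar> powr \<beta>"
    by (simp add: powr_mult_base mult.commute)
  with False show ?thesis
    by (cases "s > 0") (auto simp: f_pow_def max_def abs_if)
qed (simp add: f_pow_def)

lemma f_pow_nonneg: "s \<ge> 0 \<Longrightarrow> f_pow \<beta> s = s powr \<beta>"
  by (auto simp: f_pow_eq max_def)

lemma f_pow_minus: "f_pow \<beta> (- s) = - f_pow \<beta> s"
  by (simp add: f_pow_def)

lemma f_pow_mono: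
  assumes "\<beta> > 0" "s \<le> r"
  shows "f_pow \<beta> s \<le> f_pow \<beta> r"
proof -
  have "max s 0 powr \<beta> \<le> max r 0 powr \<beta>" "max (- r) 0 powr \<beta> \<le> max (- s) 0 powr \<beta>"
    using assms by (auto intro!: powr_mono2)
  then show ?thesis by (simp add: f_pow_eq)
qed

lemma continuous_on_f_pow:
  assumes "\<beta> > 0"
  shows "continuous_on UNIV (f_pow \<beta>)"
proof -
  have "continuous_on UNIV (\<lambda>s::real. max s 0 powr \<beta> - max (- s) 0 powr \<beta>)"
    using assms by (intro continuous_intros continuous_on_powr') auto
  then show ?thesis by (simp add: f_pow_eq[abs_def])
qed

lemma g_diff_minus: "g_diff p \<epsilon> (- q) = g_diff p \<epsilon> q"
  by (simp add: g_diff_def)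

lemma F_op_minus: "F_op p \<beta> \<epsilon> (- q) (- z) = - F_op p \<beta> \<epsilon> q z"
  by (simp add: F_op_def g_diff_minus f_pow_minus)

locale equation =
  fixes b p \<beta> \<epsilon> :: real
  assumes b_pos: "b > 0" and p_ge: "p \<ge> 2" and \<beta>_pos: "\<beta> > 0" and \<epsilon>_pos: "\<epsilon> > 0"
begin

abbreviation f where "f \<equiv> f_pow \<beta>"
abbreviation g where "g \<equiv> g_diff p \<epsilon>"
abbreviation F where "F \<equiv> F_op p \<beta> \<epsilon>"

lemma g_ge_\<epsilon>: "g q \<ge> \<epsilon>"
  using p_ge by (simp add: g_diff_def)

lemma g_pos: "g q > 0"
  using g_ge_\<epsilon>[of q] \<epsilon>_pos by linarith

lemma g_lower: "q \<noteq> 0 \<Longrightarrow> g q \<ge> (p - 1) * \<bar>q\<bar> powr (p - 2)"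
  using \<epsilon>_pos by (simp add: g_diff_def)

lemma g_mono: "\<bar>q\<bar> \<le> \<bar>r\<bar> \<Longrightarrow> g q \<le> g r"
  using p_ge by (auto simp: g_diff_def intro!: mult_left_mono powr_mono2)

lemma g_upper: "\<bar>q\<bar> \<le> r \<Longrightarrow> r \<ge> 1 \<Longrightarrow> g q \<le> (p - 1 + \<epsilon>) * r powr (p - 2)"
proof -
  assume *: "\<bar>q\<bar> \<le> r" "r \<ge> 1"
  then have "g q \<le> g r" by (intro g_mono) auto
  also have "\<dots> = (p - 1) * r powr (p - 2) + \<epsilon>"
    using * by (simp add: g_diff_def)
  also have "\<epsilon> \<le> \<epsilon> * r powr (p - 2)"
    using * p_ge \<epsilon>_pos by (simp add: ge_one_powr_ge_zero)
  finally show ?thesis by (simp add: algebra_simps)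
qed

lemma F_antimono: "z \<le> z' \<Longrightarrow> F q z' \<le> F q z"
  unfolding F_op_def using g_pos[of q] \<beta>_pos
  by (simp add: f_pow_mono mult_left_mono)

lemma continuous_on_g: "continuous_on UNIV g"
proof (cases "p = 2")
  case True
  then show ?thesis by (simp add: g_diff_def[abs_def])
next
  case False
  then have "continuous_on UNIV (\<lambda>s::real. (p - 1) * \<bar>s\<bar> powr (p - 2) + \<epsilon>)"
    using p_ge by (intro continuous_intros continuous_on_powr') auto
  then show ?thesis using False by (simp add: g_diff_def[abs_def])
qed

lemma tendsto_F:
  assumes "(q \<longlongrightarrow> q0) G" "(z \<longlongrightarrow> z0) G"
  shows "((\<lambda>i. F (q i) (z i)) \<longlongrightarrow> F q0 z0) G"
proof -
  have "isCont g q0" "isCont f (g q0 * z0)"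
    using continuous_on_g continuous_on_f_pow[OF \<beta>_pos]
    by (auto simp: continuous_on_eq_continuous_at)
  then show ?thesis
    unfolding F_op_def using assms
    by (intro tendsto_minus isCont_tendsto_compose[of _ f] isCont_tendsto_compose[of _ g] tendsto_mult)
qed

end

lemma open_cyl: "open (cyl b)"
  by (auto simp: cyl_def intro!: open_Times)

text \<open>One family for barriers and test functions: \<open>c4\<close> is 0 in the barriers and
  carries the penalty in time in the test functions.\<close>

definition quad :: "real \<Rightarrow> real \<Rightarrow> real \<Rightarrow> real \<Rightarrow> real \<Rightarrow> real \<times> real \<Rightarrow> real" where
  "quad c0 c1 c2 c3 c4 z = c0 + c1 * fst z + c2 * (fst z)\<^sup>2 + c3 * snd z + c4 * (snd z)\<^sup>2"

lemma dx_quad: "dx (quad c0 c1 c2 c3 c4) = (\<lambda>z. c1 + 2 * c2 * fst z)"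
  by (rule ext, unfold dx_def quad_def, rule DERIV_imp_deriv) (auto intro!: derivative_eq_intros)

lemma dt_quad: "dt (quad c0 c1 c2 c3 c4) = (\<lambda>z. c3 + 2 * c4 * snd z)"
  by (rule ext, unfold dt_def quad_def, rule DERIV_imp_deriv) (auto intro!: derivative_eq_intros)

lemma C2_on_quad: "C2_on S (quad c0 c1 c2 c3 c4)"
proof -
  have 1: "dx (\<lambda>z. c + k * fst z) = (\<lambda>z. k)" "dt (\<lambda>z. c + k * fst z) = (\<lambda>z. 0)"
          "dx (\<lambda>z. c + k * snd z) = (\<lambda>z. 0)" "dt (\<lambda>z. c + k * snd z) = (\<lambda>z. k)" for c k :: real
    by (rule ext; unfold dx_def dt_def; rule DERIV_imp_deriv; auto intro!: derivative_eq_intros)+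
  show ?thesis
    unfolding C2_on_def C1_on_def dx_quad dt_quad 1
    by (auto simp: quad_def intro!: continuous_intros derivative_intros)
qed

text \<open>If every \<open>w z\<close> were undercut by some \<open>w (Y z)\<close>, the relative
  neighbourhoods on which \<open>w\<close> exceeds \<open>w (Y z)\<close> would cover
  \<open>S\<close>. In a finite subcover, the \<open>Y z\<close> of least value can lie in none of
  them.\<close>

lemma lsc_attains_min:
  fixes S :: "'a::topological_space set"
  assumes "compact S" "S \<noteq> {}" "lsc_on S w"
  shows "\<exists>z\<in>S. \<forall>y\<in>S. w z \<le> w y"
proof (rule ccontr)
  assume "\<not> ?thesis"
  then have "\<forall>z\<in>S. \<exists>y\<in>S. w y < w z" by (auto simp: not_le)
  then obtain Y where Y: "\<And>z. z \<in> S \<Longrightarrow> Y z \<in> S \<and> w (Y z) < w z" by metis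
  have "\<exists>U. open U \<and> z \<in> U \<and> (\<forall>x\<in>U \<inter> S. w (Y z) < w x)" if z: "z \<in> S" for z
  proof -
    have "\<forall>\<^sub>F x in at z within S. w (Y z) < w x"
      using assms(3) Y[OF z] z by (auto simp: lsc_on_def)
    then obtain U where "open U" "z \<in> U" "\<forall>x\<in>U. x \<noteq> z \<longrightarrow> x \<in> S \<longrightarrow> w (Y z) < w x"
      unfolding eventually_at_topological by auto
    with Y[OF z] show ?thesis by (intro exI[of _ U]) auto
  qed
  then obtain U where U: "\<And>z. z \<in> S \<Longrightarrow> open (U z) \<and> z \<in> U z \<and> (\<forall>x\<in>U z \<inter> S. w (Y z) < w x)"
    by metis
  obtain T where T: "T \<subseteq> S" "finite T" "S \<subseteq> (\<Union>z\<in>T. U z)"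
    using compactE_image[OF assms(1), of S U] U by blast
  with assms(2) have "T \<noteq> {}" by auto
  obtain z where z: "z \<in> T" "\<forall>y\<in>T. w (Y z) \<le> w (Y y)"
    using ex_is_arg_min_if_finite[OF T(2) \<open>T \<noteq> {}\<close>, of "\<lambda>z. w (Y z)"]
    by (auto simp: is_arg_min_linorder)
  have "Y z \<in> S" using Y T(1) z(1) by blast
  then obtain z' where z': "z' \<in> T" "Y z \<in> U z'" using T(3) by blast
  then have "w (Y z') < w (Y z)" using U[of z'] T(1) \<open>Y z \<in> S\<close> by blast
  with z z' show False by force
qed

lemma lsc_on_subset: "lsc_on S w \<Longrightarrow> T \<subseteq> S \<Longrightarrow> lsc_on T w"
  unfolding lsc_on_def by (blast intro: filter_leD[OF at_le])

lemma lsc_on_add_continuous: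
  assumes "lsc_on S w" "continuous_on S h"
  shows "lsc_on S (\<lambda>z. w z + h z)"
  unfolding lsc_on_def
proof (intro ballI allI impI)
  fix z a assume z: "z \<in> S" and a: "a < w z + h z"
  define e where "e = (w z + h z - a) / 2"
  have e: "e > 0" using a by (simp add: e_def)
  have "\<forall>\<^sub>F y in at z within S. w z - e < w y"
    using assms(1) z e by (auto simp: lsc_on_def)
  moreover have "\<forall>\<^sub>F y in at z within S. h z - e < h y"
    using assms(2) z e by (auto simp: continuous_on_def intro: order_tendstoD)
  ultimately show "\<forall>\<^sub>F y in at z within S. a < w y + h y"
    by eventually_elim (simp add: e_def field_simps)
qed

section \<open>Uniform blow-up of supersolutions\<close>

locale supersolution = equation +
  fixes A :: "real \<times> real \<Rightarrow> real"
  assumes super: "super_solution b p \<beta> \<epsilon> A"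
begin

lemma lsc_A: "lsc_on (cyl0 b) A"
  using super by (simp add: super_solution_def)

lemma lateral:
  assumes "t > 0"
  shows "\<exists>r>0. \<forall>x\<in>{b-r<..<b}. M \<le> A (x, t)"
proof -
  have "\<forall>\<^sub>F x in at_left b. M \<le> A (x, t)"
    using super assms by (auto simp: super_solution_def filterlim_at_top)
  then obtain c where "c < b" "\<forall>x>c. x < b \<longrightarrow> M \<le> A (x, t)"
    unfolding eventually_at_left_field by auto
  then show ?thesis by (intro exI[of _ "b - c"]) auto
qed

lemma quad_test:
  assumes "(x0, t0) \<in> cyl b"
    and "\<forall>\<^sub>F z in nhds (x0, t0). A z - quad c0 c1 c2 c3 c4 z \<ge> A (x0, t0) - quad c0 c1 c2 c3 c4 (x0, t0)"
  shows "c3 + 2 * c4 * t0 \<ge> f (g (c1 + 2 * c2 * x0) * (2 * c2))"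
proof -
  have 1: "dx (\<lambda>z::real \<times> real. c1 + 2 * c2 * fst z) = (\<lambda>z. 2 * c2)"
    by (rule ext; unfold dx_def; rule DERIV_imp_deriv; auto intro!: derivative_eq_intros)
  have "dt (quad c0 c1 c2 c3 c4) (x0, t0) + F (dx (quad c0 c1 c2 c3 c4) (x0, t0))
       (dx (dx (quad c0 c1 c2 c3 c4)) (x0, t0)) \<ge> 0"
    using super assms C2_on_quad[of "cyl b"] unfolding super_solution_def by blast
  then show ?thesis unfolding dx_quad dt_quad 1 by (simp add: F_op_def)
qed

lemma rect_cyl: "-b < x1 \<Longrightarrow> x2 < b \<Longrightarrow> 0 < s \<Longrightarrow> {x1..x2} \<times> {s..t} \<subseteq> cyl0 b"
  by (auto simp: cyl0_def)

lemma rect_bounded_below: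
  assumes "-b < x1" "x2 < b" "0 < s"
  shows "\<exists>B\<ge>0. \<forall>x\<in>{x1..x2}. \<forall>t\<in>{s..t1}. - B \<le> A (x, t)"
proof (cases "x1 \<le> x2 \<and> s \<le> t1")
  case True
  then obtain z where "z \<in> {x1..x2} \<times> {s..t1}" "\<forall>y\<in>{x1..x2} \<times> {s..t1}. A z \<le> A y"
    using lsc_attains_min[of "{x1..x2} \<times> {s..t1}" A] lsc_on_subset[OF lsc_A rect_cyl[OF assms]]
    by (auto simp: compact_Times)
  then show ?thesis by (intro exI[of _ "\<bar>A z\<bar>"]) force
qed auto

text \<open>The squared positive part is not twice differentiable at 0, but it lies below each
  tangent plus a square. Hence a smooth quadratic can replace the penalty in the test
  function.\<close>

lemma pos_part_square: "(max (y + u) 0)\<^sup>2 \<le> (max y 0)\<^sup>2 + 2 * max y 0 * u + (u::real)\<^sup>2"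
proof -
  have "\<bar>max (y + u) 0\<bar> \<le> \<bar>max y 0 + u\<bar> \<or> y < 0" by (auto simp: max_def)
  then show ?thesis
  proof
    assume "\<bar>max (y + u) 0\<bar> \<le> \<bar>max y 0 + u\<bar>"
    then have "(max (y + u) 0)\<^sup>2 \<le> (max y 0 + u)\<^sup>2" by (rule iffD1[OF abs_le_square_iff])
    then show ?thesis by (simp add: power2_sum algebra_simps)
  next
    assume "y < 0"
    then have "(max (y + u) 0)\<^sup>2 \<le> u\<^sup>2" by (intro iffD1[OF abs_le_square_iff]) (auto simp: max_def)
    with \<open>y < 0\<close> show ?thesis by simp
  qed
qed

text \<open>The term \<open>N (t - t1)\<^sub>+\<^sup>2\<close> moves the minimum away from the final time without spoiling the strict
  inequality for the test function.\<close>

lemma comparison_rect: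
  fixes c0 c1 c2 c3 :: real
  defines "P \<equiv> quad c0 c1 c2 c3 0"
  assumes x: "-b < x1" "x1 < x2" "x2 < b" and t: "0 < s" "s \<le> t1"
    and strict: "\<And>x. x1 < x \<Longrightarrow> x < x2 \<Longrightarrow> c3 < f (g (c1 + 2 * c2 * x) * (2 * c2))"
    and bottom: "\<And>x. x \<in> {x1..x2} \<Longrightarrow> P (x, s) \<le> A (x, s)"
    and left: "\<And>t. t \<in> {s..t1} \<Longrightarrow> P (x1, t) \<le> A (x1, t)"
    and right: "\<And>t. t \<in> {s..t1} \<Longrightarrow> P (x2, t) \<le> A (x2, t)"
    and "x \<in> {x1..x2}" "t \<in> {s..t1}"
  shows "P (x, t) \<le> A (x, t)"
proof (rule ccontr)
  define \<mu> where "\<mu> = P (x, t) - A (x, t)"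
  assume "\<not> ?thesis"
  then have \<mu>: "\<mu> > 0" by (simp add: \<mu>_def)
  have contP: "continuous_on S P" for S
    unfolding P_def quad_def by (intro continuous_intros)
  \<comment> \<open>The lateral inequalities are assumed only up to \<open>t1\<close>. Lower
    semicontinuity carries them, with slack \<open>\<mu>\<close>, slightly beyond \<open>t1\<close>,
    so the minimum can be taken over a longer rectangle.\<close>
  have side: "\<exists>\<eta>>0. \<forall>t\<in>{t1<..t1+\<eta>}. P (y, t) - \<mu> < A (y, t)"
    if y: "y \<in> {x1..x2}" "P (y, t1) \<le> A (y, t1)" for y
  proof -
    have "lsc_on (cyl0 b) (\<lambda>z. A z + - P z)"
      by (intro lsc_on_add_continuous lsc_A continuous_intros contP)
    moreover have "(y, t1) \<in> cyl0 b" using x t y by (auto simp: cyl0_def)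
    ultimately have "\<forall>\<^sub>F z in at (y, t1) within cyl0 b. - \<mu> < A z - P z"
      using y \<mu> by (auto simp: lsc_on_def)
    then obtain d where d: "d > 0" "\<And>z. z \<in> cyl0 b \<Longrightarrow> z \<noteq> (y, t1) \<Longrightarrow> dist z (y, t1) < d \<Longrightarrow> - \<mu> < A z - P z"
      unfolding eventually_at by auto
    have "P (y, t) - \<mu> < A (y, t)" if "t \<in> {t1<..t1 + d/2}" for t
      using d(2)[of "(y, t)"] that x t y d(1) by (auto simp: dist_Pair_Pair dist_real_def cyl0_def)
    with d(1) show ?thesis by (intro exI[of _ "d/2"]) auto
  qed
  obtain \<eta>1 where e1: "\<eta>1 > 0" "\<And>t. t \<in> {t1<..t1+\<eta>1} \<Longrightarrow> P (x1, t) - \<mu> < A (x1, t)"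
    using side[of x1] left[of t1] x t by auto
  obtain \<eta>2 where e2: "\<eta>2 > 0" "\<And>t. t \<in> {t1<..t1+\<eta>2} \<Longrightarrow> P (x2, t) - \<mu> < A (x2, t)"
    using side[of x2] right[of t1] x t by auto
  define \<eta> where "\<eta> = min \<eta>1 \<eta>2"
  have \<eta>: "\<eta> > 0" using e1 e2 by (simp add: \<eta>_def)
  let ?R = "{x1..x2} \<times> {s..t1+\<eta>}"
  have R: "compact ?R" "?R \<noteq> {}" "?R \<subseteq> cyl0 b"
    using x t \<eta> by (auto simp: compact_Times cyl0_def)
  have lsc: "lsc_on ?R (\<lambda>z. A z + h z)" if "continuous_on ?R h" for h
    using that by (intro lsc_on_add_continuous lsc_on_subset[OF lsc_A R(3)])
  obtain zB where zB: "\<And>z. z \<in> ?R \<Longrightarrow> A zB + - P zB \<le> A z + - P z"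
    using lsc_attains_min[OF R(1,2) lsc[OF continuous_on_minus[OF contP]]] by blast
  \<comment> \<open>Large enough that the penalized difference is nonnegative at the final time
    \<open>t1 + \<eta>\<close>, hence not minimal there.\<close>
  define N where "N = (\<bar>A zB - P zB\<bar>) / \<eta>\<^sup>2"
  have N: "N \<ge> 0" "A zB - P zB + N * \<eta>\<^sup>2 \<ge> 0"
    using \<eta> by (auto simp: N_def)
  define w where "w z = A z + (- P z + N * (max (snd z - t1) 0)\<^sup>2)" for z
  have "lsc_on ?R w"
    unfolding w_def[abs_def] by (intro lsc continuous_intros contP)
  from lsc_attains_min[OF R(1,2) this]
  obtain xm tm where m: "(xm, tm) \<in> ?R" "\<And>z. z \<in> ?R \<Longrightarrow> w (xm, tm) \<le> w z" by auto
  have "w (xm, tm) \<le> w (x, t)" using assms(11,12) \<eta> by (intro m) auto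
  also have "w (x, t) = - \<mu>" using assms(12) by (simp add: w_def \<mu>_def)
  finally have wneg: "A (xm, tm) - P (xm, tm) + N * (max (tm - t1) 0)\<^sup>2 \<le> - \<mu>" by (simp add: w_def)
  moreover have Nn: "N * (max (tm - t1) 0)\<^sup>2 \<ge> 0" using N by simp
  ultimately have neg: "A (xm, tm) - P (xm, tm) \<le> - \<mu>" by linarith
  have "tm \<noteq> s" using neg bottom[of xm] \<mu> m(1) by auto
  moreover have "xm \<noteq> x1" using neg left[of tm] e1(2)[of tm] \<mu> m(1) by (cases "tm \<le> t1") (force simp: \<eta>_def min_def split: if_splits)+
  moreover have "xm \<noteq> x2" using neg right[of tm] e2(2)[of tm] \<mu> m(1) by (cases "tm \<le> t1") (force simp: \<eta>_def min_def split: if_splits)+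
  moreover have "tm \<noteq> t1 + \<eta>"
  proof
    assume tm: "tm = t1 + \<eta>"
    then have "(max (tm - t1) 0)\<^sup>2 = \<eta>\<^sup>2" using \<eta> by simp
    with wneg have "A (xm, tm) - P (xm, tm) + N * \<eta>\<^sup>2 \<le> - \<mu>" by simp
    with zB[OF m(1)] N(2) \<mu> show False by simp
  qed
  ultimately have int: "(xm, tm) \<in> {x1<..<x2} \<times> {s<..<t1+\<eta>}" using m(1) by auto
  let ?y = "max (tm - t1) 0"
  \<comment> \<open>The summand \<open>2 * N * tm\<close> cancels the contribution of
    \<open>- N\<close> at \<open>tm\<close>; the time derivative there is
    \<open>c3 - 2 * N * ?y\<close>, which is at most \<open>c3\<close>, so strictness
    survives.\<close>
  let ?Q = "quad c0 c1 c2 (c3 - 2 * N * ?y + 2 * N * tm) (- N)"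
  have "A z - ?Q z \<ge> A (xm, tm) - ?Q (xm, tm)" if z: "z \<in> {x1<..<x2} \<times> {s<..<t1+\<eta>}" for z
  proof -
    obtain x' t' where z': "z = (x', t')" by force
    have "w (xm, tm) \<le> w z" using z by (intro m) auto
    moreover have "N * (max (t' - t1) 0)\<^sup>2 \<le> N * (?y\<^sup>2 + 2 * ?y * (t' - tm) + (t' - tm)\<^sup>2)"
      using pos_part_square[of "tm - t1" "t' - tm"] N(1) by (intro mult_left_mono) auto
    ultimately have "A (xm, tm) - P (xm, tm) + N * ?y\<^sup>2 \<le> A z - P z + N * (?y\<^sup>2 + 2 * ?y * (t' - tm) + (t' - tm)\<^sup>2)"
      by (simp add: w_def z')
    then show ?thesis
      by (simp add: z' P_def quad_def algebra_simps power2_eq_square)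
  qed
  moreover have "\<forall>\<^sub>F z in nhds (xm, tm). z \<in> {x1<..<x2} \<times> {s<..<t1+\<eta>}"
    using int by (intro eventually_nhds_in_open open_Times) auto
  ultimately have ev: "\<forall>\<^sub>F z in nhds (xm, tm). A z - ?Q z \<ge> A (xm, tm) - ?Q (xm, tm)"
    by (auto elim: eventually_mono)
  have "(xm, tm) \<in> cyl b" using int x t by (auto simp: cyl_def)
  from quad_test[OF this ev]
  have "f (g (c1 + 2 * c2 * xm) * (2 * c2)) \<le> c3 - 2 * N * ?y" by simp
  moreover have "2 * N * ?y \<ge> 0" using N by simp
  ultimately show False using strict[of xm] int by auto
qed

text \<open>The barrier is a concave parabola with top \<open>m\<close> that has dropped by
  \<open>D\<close> at distance \<open>r\<close>. Sinking at speed \<open>L\<close>, faster than its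
  curvature demands, it is a strict subsolution, so the centre loses at most \<open>L\<close> per
  unit of time.\<close>

lemma short_time:
  assumes x: "-b < x0 - r" "x0 + r < b" "r > 0" and t: "0 < s" "s \<le> t" and D: "D > 0"
    and bottom: "\<And>x. x \<in> {x0-r..x0+r} \<Longrightarrow> m \<le> A (x, s)"
    and sides: "\<And>t'. t' \<in> {s..t} \<Longrightarrow> m - D \<le> A (x0 - r, t')" "\<And>t'. t' \<in> {s..t} \<Longrightarrow> m - D \<le> A (x0 + r, t')"
    and L: "f (g (2 * D / r) * (2 * D / r\<^sup>2)) < L"
  shows "m - L * (t - s) \<le> A (x0, t)"
proof -
  define K where "K = D / r\<^sup>2"
  have K: "K > 0" "K * r\<^sup>2 = D" using D x by (auto simp: K_def)
  let ?P = "quad (m - K * x0\<^sup>2 + L * s) (2 * K * x0) (- K) (- L) 0"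
  have P: "?P (y, u) = m - K * (y - x0)\<^sup>2 - L * (u - s)" for y u
    by (simp add: quad_def power2_eq_square algebra_simps)
  have "0 \<le> f (g (2 * D / r) * (2 * D / r\<^sup>2))"
    using D x g_pos[of "2 * D / r"] by (subst f_pow_nonneg) (auto intro!: mult_nonneg_nonneg)
  with L have Lpos: "L > 0" by linarith
  have "?P (x0, t) \<le> A (x0, t)"
  proof (rule comparison_rect[where ?x1.0 = "x0 - r" and ?x2.0 = "x0 + r" and s = s and ?t1.0 = t])
    fix y assume y: "x0 - r < y" "y < x0 + r"
    have "\<bar>2 * K * x0 + 2 * (- K) * y\<bar> = 2 * K * \<bar>y - x0\<bar>"
      using K by (simp add: abs_if algebra_simps)
    also have "\<dots> \<le> 2 * K * r" using y K by (intro mult_left_mono) auto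
    also have "\<dots> = 2 * D / r" using x by (simp add: K_def power2_eq_square)
    finally have "g (2 * K * x0 + 2 * (- K) * y) \<le> g (2 * D / r)"
      using x D by (intro g_mono) simp
    then have "g (2 * K * x0 + 2 * (- K) * y) * (2 * K) \<le> g (2 * D / r) * (2 * K)"
      using K by (intro mult_right_mono) auto
    then have "f (g (2 * K * x0 + 2 * (- K) * y) * (2 * K)) \<le> f (g (2 * D / r) * (2 * D / r\<^sup>2))"
      by (intro f_pow_mono \<beta>_pos) (simp add: K_def)
    then have "f (g (2 * K * x0 + 2 * (- K) * y) * (2 * K)) < L" using L by simp
    moreover have "g (2 * K * x0 + 2 * (- K) * y) * (2 * (- K)) = - (g (2 * K * x0 + 2 * (- K) * y) * (2 * K))" by simp
    ultimately show "- L < f (g (2 * K * x0 + 2 * (- K) * y) * (2 * (- K)))"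
      by (metis f_pow_minus neg_less_iff_less)
  next
    fix y assume "y \<in> {x0 - r..x0 + r}"
    then have "m \<le> A (y, s)" by (rule bottom)
    moreover have "0 \<le> K * (y - x0)\<^sup>2" using K by simp
    ultimately show "?P (y, s) \<le> A (y, s)" unfolding P by simp
  next
    fix u assume u: "u \<in> {s..t}"
    then have "0 \<le> L * (u - s)" using Lpos by simp
    then show "?P (x0 - r, u) \<le> A (x0 - r, u)" using sides(1)[OF u] K unfolding P by simp
  next
    fix u assume u: "u \<in> {s..t}"
    then have "0 \<le> L * (u - s)" using Lpos by simp
    then show "?P (x0 + r, u) \<le> A (x0 + r, u)" using sides(2)[OF u] K unfolding P by simp
  qed (use x t in auto)
  then show ?thesis unfolding P by simp
qed

text \<open>Lower semicontinuity bounds \<open>A (x0, t0)\<close> only from above by nearby values.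
  The lower bound comes from \<open>short_time\<close>: a floor for \<open>A\<close> on a compact
  rectangle fixes \<open>D\<close>, hence \<open>L\<close>, and the loss \<open>L * (t0 - s)\<close>
  vanishes as \<open>s\<close> tends to \<open>t0\<close>.\<close>

lemma left_persistence:
  assumes x: "-b < x0 - r" "x0 + r < b" "r > 0" and t: "0 < t0"
    and A: "\<And>\<eta>. \<eta> > 0 \<Longrightarrow> \<exists>s\<in>{t0-\<eta><..<t0}. \<forall>x\<in>{x0-r..x0+r}. m \<le> A (x, s)"
  shows "m \<le> A (x0, t0)"
proof -
  obtain B where B: "B \<ge> 0" "\<And>x t. x \<in> {x0-r..x0+r} \<Longrightarrow> t \<in> {t0/2..t0} \<Longrightarrow> - B \<le> A (x, t)"
    using rect_bounded_below[of "x0 - r" "x0 + r" "t0/2" t0] x t by auto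
  define D where "D = \<bar>m\<bar> + B + 1"
  have D: "D > 0" "m - D \<le> - B" using B by (auto simp: D_def)
  define L where "L = \<bar>f (g (2 * D / r) * (2 * D / r\<^sup>2))\<bar> + 1"
  have L: "L > 0" by (simp add: L_def)
  have "m - L * \<eta> \<le> A (x0, t0)" if \<eta>: "\<eta> > 0" for \<eta>
  proof -
    obtain s where s: "s \<in> {t0 - min \<eta> (t0/2)<..<t0}" "\<And>x. x \<in> {x0-r..x0+r} \<Longrightarrow> m \<le> A (x, s)"
      using A[of "min \<eta> (t0/2)"] \<eta> t by (metis half_gt_zero min_less_iff_conj)
    have s2: "t0/2 < s" using s(1) by auto
    have "m - D \<le> A (x0 - r, t')" "m - D \<le> A (x0 + r, t')" if "t' \<in> {s..t0}" for t'
      using B(2)[of "x0 - r" t'] B(2)[of "x0 + r" t'] that s2 s(1) x D(2) by auto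
    then have "m - L * (t0 - s) \<le> A (x0, t0)"
      using s x t D(1) by (intro short_time[of x0 r s t0 D m L]) (auto simp: L_def)
    moreover have "L * (t0 - s) \<le> L * \<eta>" using s(1) L by (intro mult_left_mono) auto
    ultimately show ?thesis by linarith
  qed
  then have "m - e \<le> A (x0, t0)" if "e > 0" for e
    using that L by (metis divide_pos_pos less_irrefl nonzero_mult_div_cancel_left times_divide_eq_right)
  then show ?thesis using field_le_epsilon[of m "A (x0, t0)"] by (simp add: algebra_simps)
qed

end

section \<open>Scaling of parabolic barriers and removal of lateral corners\<close>

context equation begin

text \<open>Slope of order 1/r and curvature of order 1/r^2 give the speed r^(-p \<beta>). The
  restriction on \<open>r\<close> makes the slope bound at least 1, so that
  \<open>\<epsilon>\<close> is absorbed into the power.\<close>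

lemma f_upper_scale:
  assumes "D1 > 0"
  shows "\<exists>C>0. \<forall>D r. 0 < D \<longrightarrow> D \<le> D1 \<longrightarrow> 0 < r \<longrightarrow> r \<le> 2 * D1
           \<longrightarrow> f (g (2 * D / r) * (2 * D / r\<^sup>2)) < C * r powr - (p * \<beta>)"
proof -
  define B where "B = (p - 1 + \<epsilon>) * (2 * D1) powr (p - 2) * (2 * D1)"
  have B: "B > 0" using assms p_ge \<epsilon>_pos by (simp add: B_def)
  have "f (g (2 * D / r) * (2 * D / r\<^sup>2)) < (B powr \<beta> + 1) * r powr - (p * \<beta>)"
    if *: "0 < D" "D \<le> D1" "0 < r" "r \<le> 2 * D1" for D r
  proof -
    have "g (2 * D / r) \<le> (p - 1 + \<epsilon>) * (2 * D1 / r) powr (p - 2)"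
      using * by (intro g_upper) (auto simp: divide_right_mono)
    moreover have "2 * D / r\<^sup>2 \<le> 2 * D1 / r\<^sup>2"
      using * by (auto simp: divide_right_mono)
    ultimately have "g (2 * D / r) * (2 * D / r\<^sup>2) \<le> (p - 1 + \<epsilon>) * (2 * D1 / r) powr (p - 2) * (2 * D1 / r\<^sup>2)"
      using * p_ge \<epsilon>_pos by (intro mult_mono) auto
    also have "\<dots> = B * (r powr - (p - 2) * r powr - 2)"
    proof -
      have "r powr - (p - 2) = 1 / r powr (p - 2)" "r powr - 2 = 1 / r\<^sup>2"
        using * by (simp_all only: powr_minus_divide powr_numeral)
      moreover have "(2 * D1 / r) powr (p - 2) = (2 * D1) powr (p - 2) / r powr (p - 2)"
        by (rule powr_divide)
      ultimately show ?thesis by (simp only: B_def divide_divide_eq_left) simp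
    qed
    also have "r powr - (p - 2) * r powr - 2 = r powr - p"
      by (simp flip: powr_add)
    finally have "f (g (2 * D / r) * (2 * D / r\<^sup>2)) \<le> f (B * r powr - p)"
      by (intro f_pow_mono \<beta>_pos)
    also have "\<dots> = B powr \<beta> * r powr - (p * \<beta>)"
      using B by (simp add: f_pow_nonneg powr_mult powr_powr)
    also have "\<dots> < (B powr \<beta> + 1) * r powr - (p * \<beta>)"
      using * by simp
    finally show ?thesis .
  qed
  moreover have "B powr \<beta> + 1 > 0" by (simp add: add_nonneg_pos)
  ultimately show ?thesis by blast
qed

text \<open>The matching lower rate, from the p-Laplacian part of \<open>g\<close>. The slope must
  be bounded below: for p > 2 the term \<open>\<epsilon>\<close> alone would yield only R^(-2
  \<beta>).\<close>

lemma f_lower_scale: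
  assumes "D0 > 0"
  shows "\<exists>C>0. \<forall>R q Y. 0 < R \<longrightarrow> D0 / (4 * R) \<le> \<bar>q\<bar> \<longrightarrow> D0 / (2 * R\<^sup>2) \<le> Y
           \<longrightarrow> C * R powr - (p * \<beta>) < f (g q * Y)"
proof -
  define B where "B = (p - 1) * (D0 / 4) powr (p - 2) * (D0 / 2)"
  have B: "B > 0" using assms p_ge by (simp add: B_def)
  have "B powr \<beta> / 2 * R powr - (p * \<beta>) < f (g q * Y)"
    if *: "0 < R" "D0 / (4 * R) \<le> \<bar>q\<bar>" "D0 / (2 * R\<^sup>2) \<le> Y" for R q Y
  proof -
    have D0R: "D0 / (4 * R) > 0" "D0 / (2 * R\<^sup>2) > 0" using assms * by auto
    have "B powr \<beta> / 2 * R powr - (p * \<beta>) < B powr \<beta> * R powr - (p * \<beta>)"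
      using B * by simp
    also have "\<dots> = f (B * R powr - p)"
      using B by (simp add: f_pow_nonneg powr_mult powr_powr)
    also have "B * R powr - p = B * (R powr - (p - 2) * R powr - 2)"
      by (simp flip: powr_add)
    also have "\<dots> = (p - 1) * (D0 / (4 * R)) powr (p - 2) * (D0 / (2 * R\<^sup>2))"
    proof -
      have "R powr - (p - 2) = 1 / R powr (p - 2)" "R powr - 2 = 1 / R\<^sup>2"
        using * by (simp_all only: powr_minus_divide powr_numeral)
      moreover have "(D0 / 4 / R) powr (p - 2) = (D0 / 4) powr (p - 2) / R powr (p - 2)"
        by (rule powr_divide)
      ultimately show ?thesis by (simp only: B_def divide_divide_eq_left) simp
    qed
    also have "f \<dots> \<le> f (g q * Y)"
    proof (intro f_pow_mono \<beta>_pos mult_mono)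
      have "(p - 1) * (D0 / (4 * R)) powr (p - 2) \<le> (p - 1) * \<bar>q\<bar> powr (p - 2)"
        using * D0R p_ge by (intro mult_left_mono powr_mono2) auto
      also have "\<dots> \<le> g q" using * D0R by (intro g_lower) auto
      finally show "(p - 1) * (D0 / (4 * R)) powr (p - 2) \<le> g q" .
    qed (use * D0R less_imp_le[OF g_pos] in auto)
    finally show ?thesis .
  qed
  moreover have "B powr \<beta> / 2 > 0" using B by simp
  ultimately show ?thesis by blast
qed

end

context supersolution begin

text \<open>The joint lower limit of \<open>A\<close> at the boundary point (b, t) is at least
  \<open>M\<close>; condition (ii) of a supersolution gives this only along each fixed time.\<close>

definition lat :: "real \<Rightarrow> real \<Rightarrow> bool" where
  "lat M t \<longleftrightarrow> (\<forall>e>0. \<exists>\<delta>>0. \<forall>x\<in>{b-\<delta><..<b}. \<forall>s\<in>{t-\<delta><..<t+\<delta>}. M - e \<le> A (x, s))"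

text \<open>One-sided in time: it looks only forward from \<open>\<alpha>\<close>, the beginning of
  a gap.\<close>

definition corner_ge :: "real \<Rightarrow> real \<Rightarrow> bool" where
  "corner_ge \<alpha> m \<longleftrightarrow> (\<exists>\<delta>>0. \<forall>x\<in>{b-\<delta><..<b}. \<forall>t\<in>{\<alpha>..\<alpha>+\<delta>}. m \<le> A (x, t))"

lemma corner_ge_mono: "corner_ge \<alpha> m \<Longrightarrow> m' \<le> m \<Longrightarrow> corner_ge \<alpha> m'"
  unfolding corner_ge_def by (meson order_trans)

lemma lat_compact:
  assumes "\<And>t. t \<in> {s..t1} \<Longrightarrow> lat M t" "e > 0"
  shows "\<exists>\<delta>>0. \<forall>x\<in>{b-\<delta><..<b}. \<forall>t\<in>{s..t1}. M - e \<le> A (x, t)"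
proof (cases "s \<le> t1")
  case True
  have "\<exists>\<delta>>0. \<forall>x\<in>{b-\<delta><..<b}. \<forall>u\<in>{t-\<delta><..<t+\<delta>}. M - e \<le> A (x, u)" if "t \<in> {s..t1}" for t
    using assms(1)[OF that] assms(2) unfolding lat_def by simp
  then obtain d where "\<And>t. t \<in> {s..t1} \<Longrightarrow>
      d t > 0 \<and> (\<forall>x\<in>{b - d t<..<b}. \<forall>u\<in>{t - d t<..<t + d t}. M - e \<le> A (x, u))"
    by metis
  then have d: "\<And>t. t \<in> {s..t1} \<Longrightarrow> d t > 0"
    "\<And>t x u. t \<in> {s..t1} \<Longrightarrow> x \<in> {b - d t<..<b} \<Longrightarrow> u \<in> {t - d t<..<t + d t} \<Longrightarrow> M - e \<le> A (x, u)"
    by blast+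
  obtain T where T: "T \<subseteq> {s..t1}" "finite T" "{s..t1} \<subseteq> (\<Union>t\<in>T. {t - d t<..<t + d t})"
  proof (rule compactE_image[of "{s..t1}" "{s..t1}" "\<lambda>t. {t - d t<..<t + d t}"])
    show "{s..t1} \<subseteq> (\<Union>t\<in>{s..t1}. {t - d t<..<t + d t})"
      using d(1) by force
  qed auto
  have "T \<noteq> {}" using T(3) True by auto
  define \<delta> where "\<delta> = Min (d ` T)"
  have "\<delta> > 0" using T d(1) \<open>T \<noteq> {}\<close> by (auto simp: \<delta>_def)
  moreover have "M - e \<le> A (x, t)" if xt: "x \<in> {b-\<delta><..<b}" "t \<in> {s..t1}" for x t
  proof -
    obtain u where u: "u \<in> T" "t \<in> {u - d u<..<u + d u}" using T(3) xt by blast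
    then have "\<delta> \<le> d u" using T by (auto simp: \<delta>_def)
    then show ?thesis using d(2)[of u x t] u T(1) xt by auto
  qed
  ultimately show ?thesis by blast
qed (auto intro: exI[of _ 1])

text \<open>Near the corner, depth \<open>R\<close> and time \<open>c R\<^bsup>p \<beta>\<^esup>\<close> are comparable: at depth \<open>\<ge> R\<close> the data
  at time \<open>\<alpha>\<close> persist, and for depth \<open>\<le> R\<close> the defect is a concave parabola that decreases in time.
  Starting the parabola at a small fraction \<open>\<zeta>\<close> of the scale costs only \<open>\<zeta> D\<close>, less than the gain.\<close>

lemma corner_step:
  assumes \<alpha>: "\<alpha> > 0" and r0: "r0 > 0" and hot: "\<And>x. x \<in> {b-r0<..<b} \<Longrightarrow> M \<le> A (x, \<alpha>)"
    and \<theta>: "\<theta> > 0" "\<And>t. t \<in> {\<alpha><..<\<alpha>+\<theta>} \<Longrightarrow> lat M t"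
    and Dm: "Dm > 0"
  shows "\<exists>k>0. \<forall>D\<in>{Dm..2*Dm}. corner_ge \<alpha> (M - D) \<longrightarrow> corner_ge \<alpha> (M - (D - k))"
proof -
  define s where "s = p * \<beta>"
  have s: "s > 0" using p_ge \<beta>_pos by (simp add: s_def)
  obtain C1 where C1: "C1 > 0" "\<And>D r. 0 < D \<Longrightarrow> D \<le> 2*Dm \<Longrightarrow> 0 < r \<Longrightarrow> r \<le> 2*(2*Dm)
           \<Longrightarrow> f (g (2 * D / r) * (2 * D / r\<^sup>2)) < C1 * r powr - s"
    using f_upper_scale[of "2*Dm"] Dm unfolding s_def by auto
  obtain C2 where C2: "C2 > 0" "\<And>R q Y. 0 < R \<Longrightarrow> Dm / (4 * R) \<le> \<bar>q\<bar> \<Longrightarrow> Dm / (2 * R\<^sup>2) \<le> Y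
           \<Longrightarrow> C2 * R powr - s < f (g q * Y)"
    using f_lower_scale[of Dm] Dm unfolding s_def by auto
  \<comment> \<open>Two bounds by a quarter of \<open>Dm\<close>: for the loss at depth d during the
    time c d^s, and for the total rise \<open>C2 * c\<close> of the inner barrier.\<close>
  define c where "c = min (Dm / 4 / (C1 * 2 powr s)) (Dm / 4 / C2)"
  have c: "c > 0" "C1 * 2 powr s * c \<le> Dm / 4" "C2 * c \<le> Dm / 4"
  proof -
    show "c > 0" using Dm C1 C2 by (simp add: c_def)
    have "C1 * 2 powr s * c \<le> C1 * 2 powr s * (Dm / 4 / (C1 * 2 powr s))"
      using C1 by (intro mult_left_mono) (auto simp: c_def)
    then show "C1 * 2 powr s * c \<le> Dm / 4" using C1 by simp
    have "C2 * c \<le> C2 * (Dm / 4 / C2)"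
      using C2 by (intro mult_left_mono) (auto simp: c_def)
    then show "C2 * c \<le> Dm / 4" using C2 by simp
  qed
  define k1 where "k1 = C2 * c"
  have k1: "k1 > 0" "k1 \<le> Dm / 4" using c C2 by (auto simp: k1_def)
  \<comment> \<open>Three demands: \<zeta> \<le> 1 for the polynomial inequality at the bottom,
    \<zeta> D \<le> k1/4 whenever D \<le> 2 Dm, and \<zeta>^s \<le> 1/2 so that at least half of the
    time remains after the delayed start.\<close>
  define \<zeta> where "\<zeta> = min (min 1 (k1 / (8 * Dm))) ((1/2) powr (1/s))"
  have \<zeta>: "\<zeta> > 0" "\<zeta> \<le> 1" "\<zeta> \<le> k1 / (8 * Dm)" "\<zeta> \<le> (1/2) powr (1/s)"
    using k1 Dm unfolding \<zeta>_def by (auto simp only: min_less_iff_conj) auto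
  have \<zeta>s: "\<zeta> powr s \<le> 1/2"
  proof -
    have "\<zeta> powr s \<le> ((1/2) powr (1/s)) powr s" using \<zeta> s by (intro powr_mono2) auto
    then show ?thesis using s by (simp add: powr_powr)
  qed
  have "corner_ge \<alpha> (M - (D - k1/4))" if D: "D \<in> {Dm..2*Dm}" and cg: "corner_ge \<alpha> (M - D)" for D
  proof -
    have Dpos: "D > 0" using D Dm by auto
    obtain \<delta> where \<delta>: "\<delta> > 0" "\<And>x t. x \<in> {b-\<delta><..<b} \<Longrightarrow> t \<in> {\<alpha>..\<alpha>+\<delta>} \<Longrightarrow> M - D \<le> A (x, t)"
      using cg unfolding corner_ge_def by blast
    define d0 where "d0 = min (min \<delta> r0) (min Dm b) / 2"
    have d0: "d0 > 0" "2 * d0 \<le> \<delta>" "2 * d0 \<le> r0" "2 * d0 \<le> Dm" "2 * d0 \<le> b"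
      using \<delta> r0 Dm b_pos by (auto simp: d0_def)
    \<comment> \<open>At depth \<open>d\<close> the barrier of \<open>short_time\<close> with radius
      d/2 stays inside the region where \<open>M\<close> is known initially and \<open>M - D\<close>
      later. The loss rate C1 (d/2)^(-s) times c d^s is scale-free.\<close>
    have outer: "M - Dm/4 \<le> A (b - d, \<alpha> + \<tau>)"
      if d: "0 < d" "d \<le> d0" and \<tau>: "0 \<le> \<tau>" "\<tau> \<le> \<delta>" "\<tau> \<le> c * d powr s" for d \<tau>
    proof -
      have "M - (C1 * (d/2) powr - s) * (\<alpha> + \<tau> - \<alpha>) \<le> A (b - d, \<alpha> + \<tau>)"
      proof (rule short_time[where r = "d/2" and D = D])
        show "f (g (2 * D / (d / 2)) * (2 * D / (d / 2)\<^sup>2)) < C1 * (d / 2) powr - s"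
          using D Dpos d d0 by (intro C1) auto
      qed (use d d0 b_pos \<alpha> \<tau> Dpos in \<open>auto intro!: hot \<delta>(2)\<close>)
      moreover have "(C1 * (d/2) powr - s) * \<tau> \<le> (C1 * (d/2) powr - s) * (c * d powr s)"
        using C1 \<tau> by (intro mult_left_mono) auto
      moreover have "(C1 * (d/2) powr - s) * (c * d powr s) = C1 * 2 powr s * c"
        using d by (simp add: powr_divide powr_minus field_simps)
      ultimately show ?thesis using c(2) by simp
    qed
    define \<delta>' where "\<delta>' = min (min d0 \<delta>) (min (\<theta>/2) (c * d0 powr s))"
    have \<delta>': "\<delta>' > 0" "\<delta>' \<le> d0" "\<delta>' \<le> \<delta>" "\<delta>' < \<theta>" "\<delta>' \<le> c * d0 powr s"
      using d0 \<delta> \<theta> c by (auto simp: \<delta>'_def min_def)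
    have "M - (D - k1/4) \<le> A (x, t)" if x: "x \<in> {b-\<delta>'<..<b}" and t: "t \<in> {\<alpha>..\<alpha>+\<delta>'}" for x t
    proof -
      define d \<tau> where "d = b - x" and "\<tau> = t - \<alpha>"
      have d\<tau>: "x = b - d" "t = \<alpha> + \<tau>" "0 < d" "d < \<delta>'" "0 \<le> \<tau>" "\<tau> \<le> \<delta>'"
        using x t by (auto simp: d_def \<tau>_def)
      have Dk: "M - (D - k1/4) \<le> M - Dm/4" using D k1 Dm by auto
      show ?thesis
      proof (cases "\<tau> \<le> c * d powr s")
        case True
        then show ?thesis using outer[of d \<tau>] d\<tau> \<delta>' Dk by auto
      next
        case False
        then have \<tau>pos: "\<tau> > 0" using c d\<tau> by (smt (verit) mult_nonneg_nonneg powr_ge_zero)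
        \<comment> \<open>The depth whose natural time is exactly \<open>\<tau>\<close>; thus
          \<open>outer\<close> holds at depth \<open>R\<close> during the whole time up to
          \<open>\<tau>\<close>.\<close>
        define R where "R = (\<tau> / c) powr (1/s)"
        have R: "R > 0" "c * R powr s = \<tau>"
          using \<tau>pos c s by (auto simp: R_def powr_powr)
        have "c * R powr s \<le> c * d0 powr s" using R(2) \<delta>' d\<tau> by simp
        then have "R powr s \<le> d0 powr s" using c(1) by simp
        then have Rd0: "R \<le> d0" using s R d0 by (smt (verit) powr_less_mono2)
        have dR: "d < R"
        proof (rule ccontr)
          assume "\<not> d < R"
          then have "R powr s \<le> d powr s" using s R by (intro powr_mono2) auto
          then have "\<tau> \<le> c * d powr s" using c by (simp flip: R(2))
          with False show False by simp
        qed
        \<comment> \<open>The barrier starts after \<open>\<alpha>\<close> because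
          \<open>lat\<close> is uniform only on compact time intervals away from
          \<open>\<alpha>\<close>. At this time \<open>outer\<close> already covers all depths from
          \<zeta> R on, so \<open>M - D\<close> is used only below that.\<close>
        define \<tau>1 where "\<tau>1 = c * (\<zeta> * R) powr s"
        have \<tau>1: "\<tau>1 > 0" "\<tau>1 = \<zeta> powr s * \<tau>"
          using \<zeta> R c by (auto simp: \<tau>1_def powr_mult simp flip: R(2))
        have "\<zeta> powr s * \<tau> \<le> 1/2 * \<tau>" using \<zeta>s \<tau>pos by (intro mult_right_mono) auto
        then have \<tau>12: "\<tau>1 \<le> \<tau> / 2" using \<tau>1 by simp
        define \<kappa> where "\<kappa> = C2 * R powr - s"
        have \<kappa>: "\<kappa> > 0" "\<kappa> * \<tau> = k1"
          using C2 R by (auto simp: \<kappa>_def k1_def powr_minus simp flip: R(2))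
        \<comment> \<open>Slightly deeper than \<open>D\<close>: by (1 + \<zeta>) (1 - \<zeta>/4 -
          \<zeta>^2/4) \<ge> 1 the barrier still starts below M - D at depths up to \<zeta>
          R.\<close>
        define E where "E = (1 + \<zeta>) * D"
        have E: "E \<ge> D" "E \<le> D + k1/4" "E > 0"
        proof -
          show "E \<ge> D" using \<zeta> Dpos by (simp add: E_def)
          then show "E > 0" using Dpos by simp
          have "\<zeta> * D \<le> k1 / (8 * Dm) * (2 * Dm)" using \<zeta> D Dpos k1 by (intro mult_mono) auto
          then show "E \<le> D + k1/4" using Dm by (simp add: E_def algebra_simps)
        qed
        \<comment> \<open>With h = depth / R this is M - E (1 - h/4 - h^2/4) + \<kappa> (u -
          \<tau>1). The term linear in h keeps the slope away from 0 up to the boundary, as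
          \<open>f_lower_scale\<close> demands.\<close>
        let ?P = "quad (M - E + E * b / (4*R) + E * b\<^sup>2 / (4*R\<^sup>2) - \<kappa> * (\<alpha> + \<tau>1))
                   (- E / (4*R) - 2 * b * E / (4*R\<^sup>2)) (E / (4*R\<^sup>2)) \<kappa> 0"
        have P: "?P (b - y, \<alpha> + u) = M - E * (1 - y/R/4 - (y/R)\<^sup>2/4) + \<kappa> * (u - \<tau>1)" for y u
          using R(1) by (simp add: quad_def field_simps power2_eq_square)
        have P_half: "?P (b - y, \<alpha> + u) \<le> M - E/2 + \<kappa> * (u - \<tau>1)" if "0 \<le> y" "y \<le> R" for y u
        proof -
          have yR: "0 \<le> y/R" "y/R \<le> 1" using that R by auto
          then have "(y/R)\<^sup>2 \<le> 1" by (simp add: power_le_one)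
          then have "E * (1/2) \<le> E * (1 - y/R/4 - (y/R)\<^sup>2/4)"
            using yR E by (intro mult_left_mono) auto
          then show ?thesis unfolding P by simp
        qed
        have P_le: "?P (b - y, \<alpha> + u) \<le> M - D/4" if "0 \<le> y" "y \<le> R" "u \<le> \<tau>" for y u
        proof -
          have "\<kappa> * (u - \<tau>1) \<le> \<kappa> * \<tau>" using \<kappa> \<tau>1 that by (intro mult_left_mono) auto
          then show ?thesis using P_half[of y u] that \<kappa> k1 E D by auto
        qed
        obtain \<delta>2 where \<delta>2: "\<delta>2 > 0" "\<And>x t. x \<in> {b-\<delta>2<..<b} \<Longrightarrow> t \<in> {\<alpha>+\<tau>1..\<alpha>+\<tau>} \<Longrightarrow> M - D/4 \<le> A (x, t)"
          using lat_compact[of "\<alpha>+\<tau>1" "\<alpha>+\<tau>" M "D/4"] \<theta>(2) \<tau>1(1) d\<tau> \<delta>' Dpos by auto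
        define x2 where "x2 = b - min \<delta>2 d / 2"
        have x2: "x2 < b" "b - \<delta>2 < x2" "b - d < x2" using \<delta>2 d\<tau> by (auto simp: x2_def min_def)
        have "?P (x, t) \<le> A (x, t)"
        proof (rule comparison_rect[where ?x1.0 = "b - R" and ?x2.0 = x2 and s = "\<alpha> + \<tau>1" and ?t1.0 = "\<alpha> + \<tau>"])
          fix y assume y: "b - R < y" "y < x2"
          have "- E / (4*R) - 2 * b * E / (4*R\<^sup>2) + 2 * (E / (4*R\<^sup>2)) * y = - (E / (4*R) + E / (2*R\<^sup>2) * (b - y))"
            using R(1) by (simp add: field_simps power2_eq_square)
          moreover have "E / (2*R\<^sup>2) * (b - y) \<ge> 0" using E y x2 by (intro mult_nonneg_nonneg) auto
          moreover have "E / (4*R) \<ge> Dm / (4*R)" using E D R by (intro divide_right_mono) auto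
          moreover have "Dm / (4*R) > 0" using Dm R by simp
          ultimately have "Dm / (4*R) \<le> \<bar>- E / (4*R) - 2 * b * E / (4*R\<^sup>2) + 2 * (E / (4*R\<^sup>2)) * y\<bar>"
            by linarith
          moreover have "Dm / (2*R\<^sup>2) \<le> 2 * (E / (4*R\<^sup>2))"
            using E D R by (simp add: divide_right_mono)
          ultimately show "\<kappa> < f (g (- E / (4*R) - 2 * b * E / (4*R\<^sup>2) + 2 * (E / (4*R\<^sup>2)) * y) * (2 * (E / (4*R\<^sup>2))))"
            unfolding \<kappa>_def using R by (intro C2)
        next
          fix y assume y: "y \<in> {b - R..x2}"
          define h where "h = b - y"
          have h: "y = b - h" "0 < h" "h \<le> R" using y x2 by (auto simp: h_def)
          show "?P (y, \<alpha> + \<tau>1) \<le> A (y, \<alpha> + \<tau>1)"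
          proof (cases "h < \<zeta> * R")
            case True
            have hR: "0 \<le> h/R" "h/R \<le> \<zeta>" using h True R by (auto simp: field_simps)
            have "(h/R)\<^sup>2 \<le> \<zeta>\<^sup>2" using hR by (intro power_mono) auto
            then have "1 - \<zeta>/4 - \<zeta>\<^sup>2/4 \<le> 1 - h/R/4 - (h/R)\<^sup>2/4" using hR(2)
              by (intro diff_mono divide_right_mono) auto
            then have "E * (1 - \<zeta>/4 - \<zeta>\<^sup>2/4) \<le> E * (1 - h/R/4 - (h/R)\<^sup>2/4)" using E by (intro mult_left_mono) auto
            moreover have "D \<le> E * (1 - \<zeta>/4 - \<zeta>\<^sup>2/4)"
            proof -
              have "(1 + \<zeta>) * (1 - \<zeta>/4 - \<zeta>\<^sup>2/4) = 1 + \<zeta> * (1 - \<zeta>) * (3 + \<zeta>) / 4"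
                by (simp add: field_simps power2_eq_square)
              then have "1 \<le> (1 + \<zeta>) * (1 - \<zeta>/4 - \<zeta>\<^sup>2/4)"
                using \<zeta> by simp
              then have "D * 1 \<le> D * ((1 + \<zeta>) * (1 - \<zeta>/4 - \<zeta>\<^sup>2/4))" using Dpos by (intro mult_left_mono) auto
              then show ?thesis by (simp add: E_def mult_ac)
            qed
            moreover have "M - D \<le> A (y, \<alpha> + \<tau>1)"
              using h Rd0 d0 \<tau>1(1) \<tau>12 d\<tau> \<delta>' by (intro \<delta>(2)) auto
            ultimately show ?thesis unfolding h(1) P by simp
          next
            case False
            then have "(\<zeta> * R) powr s \<le> h powr s" using \<zeta> R s by (intro powr_mono2) auto
            then have "\<tau>1 \<le> c * h powr s" using c by (simp add: \<tau>1_def)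
            then have "M - Dm/4 \<le> A (y, \<alpha> + \<tau>1)"
              unfolding h(1) using h Rd0 \<tau>1(1) \<tau>12 d\<tau> \<delta>' by (intro outer) auto
            moreover have "?P (y, \<alpha> + \<tau>1) \<le> M - D/4" unfolding h(1) using h \<tau>12 \<tau>pos by (intro P_le) auto
            ultimately show ?thesis using D by auto
          qed
        next
          fix u assume u: "u \<in> {\<alpha> + \<tau>1..\<alpha> + \<tau>}"
          define v where "v = u - \<alpha>"
          have v: "u = \<alpha> + v" "\<tau>1 \<le> v" "v \<le> \<tau>" using u by (auto simp: v_def)
          have "M - Dm/4 \<le> A (b - R, u)"
            unfolding v(1) using v Rd0 R \<tau>1(1) d\<tau> \<delta>' by (intro outer) auto
          moreover have "?P (b - R, u) \<le> M - D/4" unfolding v(1) using v R by (intro P_le) auto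
          ultimately show "?P (b - R, u) \<le> A (b - R, u)" using D by auto
        next
          fix u assume u: "u \<in> {\<alpha> + \<tau>1..\<alpha> + \<tau>}"
          have "M - D/4 \<le> A (x2, u)" using u x2 by (intro \<delta>2(2)) auto
          moreover have "?P (b - (b - x2), \<alpha> + (u - \<alpha>)) \<le> M - D/4"
            using x2 dR u by (intro P_le) auto
          ultimately show "?P (x2, u) \<le> A (x2, u)" by simp
        qed (use x2 dR Rd0 d0 \<alpha> \<tau>1(1) \<tau>12 d\<tau> \<tau>pos b_pos in auto)
        moreover have "M - E + k1/2 \<le> ?P (x, t)"
        proof -
          have "\<kappa> * (\<tau>/2) \<le> \<kappa> * (\<tau> - \<tau>1)" using \<kappa> \<tau>12 by (intro mult_left_mono) auto
          moreover have "0 \<le> d/R" using d\<tau>(3) R(1) by simp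
          moreover have "E * (1 - q/4 - q\<^sup>2/4) \<le> E * 1" if "0 \<le> q" for q
            using E that order_trans[of "- q" 0 "q\<^sup>2"] by (intro mult_left_mono) auto
          ultimately have "E * (1 - d/R/4 - (d/R)\<^sup>2/4) \<le> E * 1" "\<kappa> * (\<tau>/2) \<le> \<kappa> * (\<tau> - \<tau>1)"
            by blast+
          then show ?thesis unfolding d\<tau>(1,2) P using \<kappa> by simp
        qed
        ultimately show ?thesis using E by simp
      qed
    qed
    then show ?thesis unfolding corner_ge_def using \<delta>' by blast
  qed
  then show ?thesis using k1 by (intro exI[of _ "k1/4"]) auto
qed

text \<open>The gain in \<open>corner_step\<close> is uniform for defects between \<open>Dm\<close>
  and 2 \<open>Dm\<close>. Hence the infimum of the admissible defects cannot be positive: a defect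
  close to it would be lowered past it.\<close>

lemma corner:
  assumes \<alpha>: "\<alpha> > 0" and r0: "r0 > 0" and hot: "\<And>x. x \<in> {b-r0<..<b} \<Longrightarrow> M \<le> A (x, \<alpha>)"
    and \<theta>: "\<theta> > 0" "\<And>t. t \<in> {\<alpha><..<\<alpha>+\<theta>} \<Longrightarrow> lat M t"
    and below: "corner_ge \<alpha> m" and e: "e > 0"
  shows "corner_ge \<alpha> (M - e)"
proof (rule ccontr)
  assume not: "\<not> corner_ge \<alpha> (M - e)"
  define S where "S = {D. corner_ge \<alpha> (M - D)}"
  have lb: "e \<le> D" if "D \<in> S" for D
    using that not corner_ge_mono[of \<alpha> "M - D" "M - e"] by (force simp: S_def)
  have ne: "S \<noteq> {}" using below by (auto simp: S_def intro!: exI[of _ "M - m"])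
  define Dm where "Dm = Inf S"
  have Dm: "e \<le> Dm" unfolding Dm_def using ne lb by (rule cInf_greatest)
  have Dm_le: "Dm \<le> D" if "D \<in> S" for D
    unfolding Dm_def using that lb by (intro cInf_lower) (auto simp: bdd_below_def)
  obtain k where k: "k > 0" "\<And>D. D \<in> {Dm..2*Dm} \<Longrightarrow> corner_ge \<alpha> (M - D) \<Longrightarrow> corner_ge \<alpha> (M - (D - k))"
    using corner_step[OF \<alpha> r0 hot \<theta>, of Dm] Dm e by auto
  obtain D where D: "D \<in> S" "D < Dm + min Dm k"
    using cInf_lessD[OF ne, of "Dm + min Dm k"] Dm e k by (auto simp: Dm_def)
  have "corner_ge \<alpha> (M - (D - k))"
    using D Dm_le[OF D(1)] by (intro k) (auto simp: S_def)
  then have "D - k \<in> S" by (simp add: S_def)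
  from Dm_le[OF this] D show False by auto
qed

end

section \<open>Baire category arguments in time\<close>

lemma baire_cover:
  fixes S :: "real set"
  assumes "closed S" "S \<noteq> {}" "S \<subseteq> (\<Union>n::nat. E n)"
  shows "\<exists>n x e. e > 0 \<and> x \<in> S \<and> S \<inter> ball x e \<subseteq> closure (E n \<inter> S)"
proof (rule ccontr)
  assume not: "\<not> ?thesis"
  \<comment> \<open>Relatively open in \<open>S\<close>, and dense if the claim fails. Their
    intersection would be dense in \<open>S\<close>, but a point of it would lie in no
    \<open>E n\<close>.\<close>
  define T where "T n = S - closure (E n \<inter> S)" for n
  have "S \<subseteq> closure (\<Inter>(range T))"
  proof (rule Baire[OF assms(1)])
    fix U assume "U \<in> range T"
    then obtain n where U: "U = T n" by auto
    have "openin (top_of_set S) U"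
      unfolding U T_def Diff_eq by (intro openin_open_Int) auto
    moreover have "S \<subseteq> closure U"
    proof
      fix x assume x: "x \<in> S"
      show "x \<in> closure U"
        unfolding closure_approachable
      proof (intro allI impI)
        fix e :: real assume "e > 0"
        with not x have "\<not> S \<inter> ball x e \<subseteq> closure (E n \<inter> S)" by auto
        then show "\<exists>y\<in>U. dist y x < e" by (auto simp: U T_def dist_commute)
      qed
    qed
    ultimately show "openin (top_of_set S) U \<and> S \<subseteq> closure U" ..
  qed auto
  then obtain x where "x \<in> \<Inter>(range T)" using assms(2) closure_empty by (metis ex_in_conv subset_empty)
  then have x: "x \<in> S" "\<And>n. x \<notin> closure (E n \<inter> S)" by (auto simp: T_def)
  then obtain n where "x \<in> E n" using assms(3) by auto
  with x closure_subset[of "E n \<inter> S"] show False by auto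
qed

context supersolution begin

text \<open>Countably many depths b/(n+1), as Baire's theorem requires; being at most
  \<open>b\<close>, they keep the strip inside the space interval.\<close>

definition hot_times :: "real \<Rightarrow> nat \<Rightarrow> real set" where
  "hot_times M n = {t. \<forall>x\<in>{b - b / (n + 1)<..<b}. M \<le> A (x, t)}"

lemma hot_times_cover:
  assumes "t > 0"
  shows "\<exists>n. t \<in> hot_times M n"
proof -
  obtain r where r: "r > 0" "\<forall>x\<in>{b-r<..<b}. M \<le> A (x, t)" using lateral[OF assms] by blast
  obtain n :: nat where "b / r < n" using reals_Archimedean2 by blast
  then have "b / (n + 1) < r" using r(1) b_pos by (simp add: field_simps)
  then show ?thesis using r unfolding hot_times_def by (intro exI[of _ n]) auto
qed

text \<open>\<open>left_persistence\<close> on small intervals inside the strip. Closedness under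
  limits from the left is what turns density, the outcome of Baire's theorem, into
  membership.\<close>

lemma hot_times_left_limit:
  assumes t: "t > 0" and ev: "\<And>\<eta>. \<eta> > 0 \<Longrightarrow> \<exists>s\<in>{t-\<eta><..<t}. s \<in> hot_times M n"
  shows "t \<in> hot_times M n"
  unfolding hot_times_def
proof (intro CollectI ballI)
  fix x assume x: "x \<in> {b - b / (n + 1)<..<b}"
  define l where "l = b - b / (n + 1)"
  define r where "r = min (x - l) (b - x) / 2"
  have "l < x" "x < b" using x by (auto simp: l_def)
  then have "r > 0" "l < x - r" "x + r < b" by (auto simp: r_def min_def field_simps)
  then have r: "r > 0" "b - b / (n + 1) < x - r" "x + r < b" by (auto simp: l_def)
  have n_le: "b / (n + 1) \<le> b" using b_pos by (simp add: field_simps)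
  show "M \<le> A (x, t)"
  proof (rule left_persistence[OF _ r(3,1) t])
    show "- b < x - r" using r(2) n_le b_pos by linarith
    fix \<eta> :: real assume "\<eta> > 0"
    then obtain s where "s \<in> {t-\<eta><..<t}" "s \<in> hot_times M n" using ev by blast
    then show "\<exists>s\<in>{t-\<eta><..<t}. \<forall>x\<in>{x-r..x+r}. M \<le> A (x, s)"
      using r by (intro bexI[of _ s]) (auto simp: hot_times_def)
  qed
qed

text \<open>Hot times for the level 0 and one depth are dense in some interval of times, and left
  limits fill it. The resulting floor is what the later barriers rest on at their inner
  side.\<close>

lemma bounded_below_interval:
  "\<exists>a c r. 0 < a \<and> a < c \<and> 0 < r \<and> (\<forall>x\<in>{b-r<..<b}. \<forall>t\<in>{a<..<c}. 0 \<le> A (x, t))"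
proof -
  have "{1..2::real} \<subseteq> (\<Union>n. hot_times 0 n)" using hot_times_cover by force
  then obtain n x e where e: "e > 0" "x \<in> {1..2::real}" "{1..2} \<inter> ball x e \<subseteq> closure (hot_times 0 n \<inter> {1..2})"
    using baire_cover[of "{1..2}" "hot_times 0"] by auto
  define a where "a = max 1 (x - e)"
  define c where "c = min 2 (x + e)"
  have ac: "1 \<le> a" "a < c" using e by (auto simp: a_def c_def)
  have "t \<in> hot_times 0 n" if t: "t \<in> {a<..<c}" for t
  proof (rule hot_times_left_limit)
    fix \<eta> :: real assume \<eta>: "\<eta> > 0"
    define u where "u = max (t - \<eta>) a"
    have u: "t - \<eta> \<le> u" "a \<le> u" "u < t" using \<eta> t by (auto simp: u_def)
    have "(u + t) / 2 \<in> {1..2} \<inter> ball x e"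
    proof -
      have "x - e < (u + t) / 2" "(u + t) / 2 < x + e" "1 \<le> (u + t) / 2" "(u + t) / 2 \<le> 2"
        using u t ac by (auto simp: a_def c_def)
      then show ?thesis by (auto simp: dist_real_def abs_if field_simps)
    qed
    then have "(u + t) / 2 \<in> closure (hot_times 0 n \<inter> {1..2})" using e by blast
    then obtain s where "s \<in> hot_times 0 n" "dist s ((u + t) / 2) < (t - u) / 2"
      unfolding closure_approachable using u by (metis IntD1 diff_gt_0_iff_gt half_gt_zero)
    then show "\<exists>s\<in>{t-\<eta><..<t}. s \<in> hot_times 0 n"
      using u by (intro bexI[of _ s]) (auto simp: dist_real_def abs_if field_simps split: if_splits)
  qed (use t ac in auto)
  then show ?thesis
    using ac b_pos by (intro exI[of _ a] exI[of _ c] exI[of _ "b / (n + 1)"]) (auto simp: hot_times_def)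
qed

text \<open>The barrier is affine in space, so its curvature term vanishes and any downward drift
  makes it strict. It is at most 0 at \<open>b - r\<close>, where only the floor is known, and
  approaches \<open>M\<close> at \<open>b\<close>. Near \<open>\<alpha>\<close> the lateral bound
  comes from \<open>corner\<close>, afterwards from compactness of \<open>lat\<close>; time
  \<open>s\<close> itself is reached by \<open>left_persistence\<close>.\<close>

lemma gap_estimate:
  assumes \<alpha>: "0 < \<alpha>" "\<alpha> < s" and r: "0 < r" "r < r1" "r1 < b" and M: "0 < M"
    and below: "\<And>x t. x \<in> {b-r1<..<b} \<Longrightarrow> t \<in> {\<alpha>..s} \<Longrightarrow> 0 \<le> A (x, t)"
    and hot: "\<And>x. x \<in> {b-r<..<b} \<Longrightarrow> M \<le> A (x, \<alpha>)"
    and lat: "\<And>t. t \<in> {\<alpha><..<s} \<Longrightarrow> lat M t"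
    and x: "x \<in> {b-r<..<b}"
  shows "M * (1 - (b - x) / r) \<le> A (x, s)"
proof -
  have cg: "corner_ge \<alpha> 0"
    unfolding corner_ge_def using below r \<alpha>
    by (intro exI[of _ "min r1 (s - \<alpha>)"]) auto
  have before: "M * (1 - (b - y) / r) \<le> A (y, u)" if y: "y \<in> {b-r<..<b}" and u: "u \<in> {\<alpha><..<s}" for y u
  proof -
    have "M * (1 - (b - y) / r) - e * (1 + (u - \<alpha>)) \<le> A (y, u)" if e: "e > 0" for e
    proof -
      have "corner_ge \<alpha> (M - e)"
        using corner[OF \<alpha>(1) r(1) hot _ _ cg e, of "s - \<alpha>"] lat \<alpha> by auto
      then obtain d where d: "d > 0" "\<And>x t. x \<in> {b-d<..<b} \<Longrightarrow> t \<in> {\<alpha>..\<alpha>+d} \<Longrightarrow> M - e \<le> A (x, t)"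
        unfolding corner_ge_def by blast
      obtain d' where d': "d' > 0" "\<And>x t. x \<in> {b-d'<..<b} \<Longrightarrow> t \<in> {\<alpha>+d..u} \<Longrightarrow> M - e \<le> A (x, t)"
        using lat_compact[of "\<alpha>+d" u M e] lat u e d(1) by auto
      define x2 where "x2 = b - min (min d d') (b - y) / 2"
      have x2: "b - d < x2" "b - d' < x2" "y < x2" "x2 < b"
        using d(1) d'(1) y by (auto simp: x2_def min_def field_simps)
      let ?P = "quad (M * (1 - b/r) - e + e * \<alpha>) (M / r) 0 (- e) 0"
      have P: "?P (z, v) = M * (1 - (b - z) / r) - e - e * (v - \<alpha>)" for z v
        using r by (simp add: quad_def field_simps)
      have P_le: "?P (z, v) \<le> M - e" if "z \<le> b" "\<alpha> \<le> v" for z v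
      proof -
        have "M * (1 - (b - z) / r) \<le> M * 1" using that r M by (intro mult_left_mono) auto
        moreover have "0 \<le> e * (v - \<alpha>)" using that e by simp
        ultimately show ?thesis unfolding P by simp
      qed
      have "?P (y, u) \<le> A (y, u)"
      proof (rule comparison_rect[where ?x1.0 = "b - r" and ?x2.0 = x2 and s = \<alpha> and ?t1.0 = u])
        fix z
        show "- e < f (g (M / r + 2 * 0 * z) * (2 * 0))" using e by (simp add: f_pow_def)
      next
        fix z assume z: "z \<in> {b-r..x2}"
        show "?P (z, \<alpha>) \<le> A (z, \<alpha>)"
        proof (cases "z = b - r")
          case True
          then show ?thesis using below[of z \<alpha>] r e \<alpha> unfolding P by simp
        next
          case False
          then show ?thesis using hot[of z] P_le[of z \<alpha>] z x2 e by auto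
        qed
      next
        fix v assume v: "v \<in> {\<alpha>..u}"
        have "0 \<le> e * (v - \<alpha>)" using v e by simp
        moreover have "0 \<le> A (b - r, v)" using r u v by (intro below) auto
        ultimately show "?P (b - r, v) \<le> A (b - r, v)" using r e unfolding P by simp
      next
        fix v assume v: "v \<in> {\<alpha>..u}"
        have "M - e \<le> A (x2, v)" using d(2)[of x2 v] d'(2)[of x2 v] v x2 by (cases "v \<le> \<alpha> + d") auto
        then show "?P (x2, v) \<le> A (x2, v)" using P_le[of x2 v] x2 v by auto
      qed (use r x2 y u \<alpha> b_pos in auto)
      then show ?thesis unfolding P by (simp add: algebra_simps)
    qed
    then have *: "M * (1 - (b - y) / r) \<le> A (y, u) + e * (1 + (u - \<alpha>))" if "e > 0" for e
      using that by (simp only: diff_le_eq)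
    have "M * (1 - (b - y) / r) \<le> A (y, u) + e" if "e > 0" for e
    proof -
      have "1 + (u - \<alpha>) > 0" using u by auto
      then have "e / (1 + (u - \<alpha>)) > 0" "e / (1 + (u - \<alpha>)) * (1 + (u - \<alpha>)) = e" using that by auto
      then show ?thesis using *[of "e / (1 + (u - \<alpha>))"] by simp
    qed
    then show ?thesis by (rule field_le_epsilon)
  qed
  \<comment> \<open>\<open>left_persistence\<close> needs a constant bound on a space interval; over
    a radius \<open>\<rho>\<close> the affine bound drops by \<open>M / r * \<rho>\<close>, which
    then tends to 0.\<close>
  have "M * (1 - (b - x) / r) - M / r * \<rho> \<le> A (x, s)" if \<rho>: "0 < \<rho>" "\<rho> < min (x - (b - r)) (b - x)" for \<rho>
  proof (rule left_persistence[of x \<rho> s])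
    fix \<eta> :: real assume \<eta>: "\<eta> > 0"
    define u where "u = max ((\<alpha> + s) / 2) (s - \<eta> / 2)"
    have u: "u \<in> {\<alpha><..<s}" "u \<in> {s-\<eta><..<s}" using \<eta> \<alpha> by (auto simp: u_def max_def field_simps)
    have "M * (1 - (b - x) / r) - M / r * \<rho> \<le> A (z, u)" if z: "z \<in> {x-\<rho>..x+\<rho>}" for z
    proof -
      have "M / r * (x - z) \<le> M / r * \<rho>" using z M r by (intro mult_left_mono) auto
      moreover have "M * (1 - (b - z) / r) = M * (1 - (b - x) / r) - M / r * (x - z)"
        by (simp add: algebra_simps diff_divide_distrib)
      ultimately have "M * (1 - (b - x) / r) - M / r * \<rho> \<le> M * (1 - (b - z) / r)" by linarith
      also have "\<dots> \<le> A (z, u)" using z \<rho> u by (intro before) auto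
      finally show ?thesis .
    qed
    with u show "\<exists>u\<in>{s-\<eta><..<s}. \<forall>z\<in>{x-\<rho>..x+\<rho>}. M * (1 - (b - x) / r) - M / r * \<rho> \<le> A (z, u)" by blast
  qed (use \<rho> r \<alpha> b_pos in auto)
  then have *: "M * (1 - (b - x) / r) - M / r * \<rho> \<le> A (x, s)" if "0 < \<rho>" "\<rho> < min (x - (b - r)) (b - x)" for \<rho>
    using that by blast
  show ?thesis
  proof (rule field_le_epsilon)
    fix e :: real assume e: "e > 0"
    define w where "w = min (x - (b - r)) (b - x)"
    have w: "w > 0" using x by (auto simp: w_def)
    define \<rho> where "\<rho> = min (e * r / M) (w / 2)"
    have "0 < \<rho>" "\<rho> \<le> w / 2"
      unfolding \<rho>_def using e r M w by (simp, intro min.cobounded2)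
    with w have "0 < \<rho>" "\<rho> < w" by auto
    then have \<rho>: "0 < \<rho>" "\<rho> < min (x - (b - r)) (b - x)" unfolding w_def by blast+
    have "M / r * \<rho> \<le> M / r * (e * r / M)" using M r by (intro mult_left_mono) (auto simp: \<rho>_def)
    also have "\<dots> = e" using M r by simp
    finally show "M * (1 - (b - x) / r) \<le> A (x, s) + e" using *[OF \<rho>] by simp
  qed
qed

text \<open>In a suitable portion of the bad set \<open>K\<close>, hot times of one depth are dense.
  A time there is either a left limit of \<open>K\<close>, hence hot, or the right end of a gap with
  a hot left end. Both cases give the same affine bound on a strip of fixed width, so bad times of
  the portion turn out to be good.\<close>

lemma lat_interval:
  assumes ac: "0 < a" "a < c" and r1: "0 < r1" "r1 < b" and M: "0 < M"
    and below: "\<And>x t. x \<in> {b-r1<..<b} \<Longrightarrow> t \<in> {a<..<c} \<Longrightarrow> 0 \<le> A (x, t)"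
    and t: "t \<in> {a<..<c}"
  shows "lat M t"
proof (rule ccontr)
  assume nlat: "\<not> lat M t"
  define G where "G = {t \<in> {a<..<c}. \<exists>e>0. \<forall>s\<in>{t-e<..<t+e} \<inter> {a<..<c}. lat M s}"
  define K where "K = {a<..<c} - G"
  have lat_G: "lat M s" if "s \<in> {a<..<c}" "s \<notin> K" for s
    using that by (force simp: K_def G_def)
  have tK: "t \<in> K" using t nlat by (force simp: K_def G_def)
  have K_closed: "\<exists>\<eta>>0. K \<inter> {s-\<eta><..<s+\<eta>} = {}" if s: "s \<in> {a<..<c}" "s \<notin> K" for s
  proof -
    obtain e where e: "e > 0" "\<forall>u\<in>{s-e<..<s+e} \<inter> {a<..<c}. lat M u"
      using s by (auto simp: K_def G_def)
    have "u \<in> G" if u: "u \<in> {s-e<..<s+e}" "u \<in> {a<..<c}" for u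
      unfolding G_def
    proof (intro CollectI conjI exI ballI)
      show "0 < e - \<bar>u - s\<bar>" using u by auto
      fix v assume "v \<in> {u - (e - \<bar>u - s\<bar>)<..<u + (e - \<bar>u - s\<bar>)} \<inter> {a<..<c}"
      then show "lat M v" using e(2) by (auto simp: abs_if split: if_splits)
    qed (use u in auto)
    then have "K \<inter> {s-e<..<s+e} = {}" by (auto simp: K_def)
    with e(1) show ?thesis by blast
  qed
  define a' where "a' = (a + t) / 2"
  define c' where "c' = (t + c) / 2"
  have ac': "a < a'" "a' < t" "t < c'" "c' < c" using t by (auto simp: a'_def c'_def)
  define S where "S = closure (K \<inter> {a'<..<c'})"
  have S_sub: "S \<subseteq> {a'..c'}"
    unfolding S_def by (rule closure_minimal) auto
  have S_K: "S \<subseteq> K"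
  proof
    fix s assume s: "s \<in> S"
    then have s': "s \<in> {a<..<c}" using S_sub ac' by force
    show "s \<in> K"
    proof (rule ccontr)
      assume "s \<notin> K"
      then obtain \<eta> where \<eta>: "\<eta> > 0" "K \<inter> {s-\<eta><..<s+\<eta>} = {}" using K_closed s' by blast
      obtain y where "y \<in> K" "dist y s < \<eta>"
        using s \<eta>(1) unfolding S_def closure_approachable by blast
      with \<eta>(2) show False by (force simp: dist_real_def abs_less_iff)
    qed
  qed
  have tS: "t \<in> S" unfolding S_def using tK ac' by (intro subsetD[OF closure_subset]) auto
  have cover: "S \<subseteq> (\<Union>n. hot_times M n)"
  proof
    fix s assume "s \<in> S"
    then have "s > 0" using S_sub ac ac' by force
    then show "s \<in> (\<Union>n. hot_times M n)" using hot_times_cover by auto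
  qed
  have "closed S" "S \<noteq> {}" using tS by (auto simp: S_def)
  from baire_cover[OF this cover] obtain n x e where e: "e > 0" "x \<in> S" "S \<inter> ball x e \<subseteq> closure (hot_times M n \<inter> S)"
    by blast
  obtain td where td: "td \<in> K" "td \<in> {a'<..<c'}" "dist td x < e"
    using e(1,2) unfolding S_def closure_approachable by blast
  define lo where "lo = max a' (x - e)"
  define hi where "hi = min c' (x + e)"
  have td': "td \<in> {lo<..<hi}" using td by (auto simp: lo_def hi_def dist_real_def)
  have lohi: "a < lo" "hi < c" using ac' by (auto simp: lo_def hi_def)
  have K_hot: "k \<in> closure (hot_times M n \<inter> S)" if "k \<in> K" "k \<in> {lo<..<hi}" for k
  proof -
    have "k \<in> K \<inter> {a'<..<c'}" using that by (auto simp: lo_def hi_def)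
    then have "k \<in> S" unfolding S_def by (rule subsetD[OF closure_subset])
    moreover have "k \<in> ball x e" using that by (auto simp: lo_def hi_def dist_real_def)
    ultimately show ?thesis using e(3) by blast
  qed
  \<comment> \<open>Points of \<open>K\<close> accumulating from the left are themselves limits of
    hot times, so hot times accumulate at \<open>k\<close> from the left too.\<close>
  have limit_hot: "k \<in> hot_times M n" if k: "k \<in> {lo<..<hi}" "\<And>\<eta>. \<eta> > 0 \<Longrightarrow> K \<inter> {k-\<eta><..<k} \<noteq> {}" for k
  proof (rule hot_times_left_limit)
    fix \<eta> :: real assume "\<eta> > 0"
    then have "min \<eta> (k - lo) > 0" using k(1) by auto
    from k(2)[OF this] obtain k' where k': "k' \<in> K" "k - min \<eta> (k - lo) < k'" "k' < k" by auto
    then have "k' \<in> closure (hot_times M n \<inter> S)" using k(1) by (intro K_hot) auto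
    moreover have "min (k - k') (k' - (k - \<eta>)) > 0" using k' by auto
    ultimately obtain s where "s \<in> hot_times M n" "dist s k' < min (k - k') (k' - (k - \<eta>))"
      unfolding closure_approachable by blast
    then show "\<exists>s\<in>{k-\<eta><..<k}. s \<in> hot_times M n"
      by (intro bexI[of _ s]) (auto simp: dist_real_def)
  qed (use k lohi ac in auto)
  \<comment> \<open>A left end of a gap that is not a left limit of \<open>K\<close> is isolated in
    \<open>K\<close>. Density in \<open>S\<close> then gives the point itself, since
    \<open>S\<close> lies in \<open>K\<close>.\<close>
  have isolated_hot: "k \<in> hot_times M n"
    if k: "k \<in> K" "k \<in> {lo<..<hi}" and \<eta>: "\<eta> > 0" "K \<inter> {k-\<eta><..<k} = {}" "K \<inter> {k<..<k+\<eta>} = {}" for k \<eta>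
  proof -
    obtain s where s: "s \<in> hot_times M n" "s \<in> S" "dist s k < \<eta>"
      using K_hot[OF k] \<eta>(1) unfolding closure_approachable by blast
    then have "s \<in> K" using S_K by blast
    moreover have "s \<in> {k-\<eta><..<k} \<or> s = k \<or> s \<in> {k<..<k+\<eta>}"
      using s(3) by (auto simp: dist_real_def)
    ultimately show ?thesis using \<eta> s(1) by blast
  qed
  \<comment> \<open>An artificial starting time, hot with a depth of its own, for gaps that would
    begin before the portion under consideration.\<close>
  define s0 where "s0 = (lo + td) / 2"
  have s0: "lo < s0" "s0 < td" using td' by (auto simp: s0_def)
  obtain r0 where r0: "r0 > 0" "\<forall>x\<in>{b-r0<..<b}. M \<le> A (x, s0)"
    using lateral[of s0 M] s0 lohi ac by auto
  \<comment> \<open>One depth serves every possible left end of a gap: \<open>r0\<close> for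
    \<open>s0\<close> and b/(n+1) for points of \<open>K\<close>; the bound r1/2 keeps it inside the
    region of the floor.\<close>
  define r where "r = min r0 (min (b / (n + 1)) (r1 / 2))"
  have r: "0 < r" "r \<le> r0" "r \<le> b / (n + 1)" "r < r1" using r0 r1 by (auto simp: r_def)
  have hot_r: "M \<le> A (x, k)" if "k \<in> hot_times M n \<or> k = s0" "x \<in> {b-r<..<b}" for k x
    using that r r0(2) by (auto simp: hot_times_def)
  have est: "M * (1 - (b - x) / r) \<le> A (x, s)" if s: "s \<in> {s0<..<hi}" and x: "x \<in> {b-r<..<b}" for s x
  proof (cases "\<forall>\<eta>>0. K \<inter> {s-\<eta><..<s} \<noteq> {}")
    case True
    then have "M \<le> A (x, s)" using s s0 x by (intro hot_r disjI1 limit_hot) auto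
    moreover have "M * (1 - (b - x) / r) \<le> M * 1" using M x r by (intro mult_left_mono) auto
    ultimately show ?thesis by simp
  next
    case False
    then obtain \<eta> where \<eta>: "\<eta> > 0" "K \<inter> {s-\<eta><..<s} = {}" by blast
    \<comment> \<open>Its supremum is the left end of the maximal gap of \<open>K\<close> before
      \<open>s\<close>, cut off at \<open>s0\<close>.\<close>
    define Z where "Z = insert s0 K \<inter> {s0..<s}"
    define \<alpha> where "\<alpha> = Sup Z"
    have Z: "s0 \<in> Z" "bdd_above Z" using s by (auto simp: Z_def intro!: bdd_aboveI[of _ s])
    have Z_le: "z \<le> \<alpha>" if "z \<in> Z" for z unfolding \<alpha>_def using that Z by (intro cSup_upper)
    have "z \<le> max s0 (s - \<eta>)" if "z \<in> Z" for z
      using that \<eta> by (force simp: Z_def)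
    then have "\<alpha> \<le> max s0 (s - \<eta>)" unfolding \<alpha>_def using Z by (intro cSup_least) auto
    then have \<alpha>: "s0 \<le> \<alpha>" "\<alpha> < s" using Z_le[OF Z(1)] s \<eta> by auto
    have gap: "K \<inter> {\<alpha><..<s} = {}"
    proof (rule equals0I)
      fix z assume z: "z \<in> K \<inter> {\<alpha><..<s}"
      then have "z \<in> Z" using \<alpha> by (auto simp: Z_def)
      with Z_le[of z] z show False by auto
    qed
    have \<alpha>_hot: "\<alpha> \<in> hot_times M n \<or> \<alpha> = s0"
    proof (rule ccontr)
      assume neg: "\<not> ?thesis"
      then have \<alpha>s0: "s0 < \<alpha>" using \<alpha> by auto
      have \<alpha>in: "\<alpha> \<in> {lo<..<hi}" using \<alpha> s s0 by auto
      have "\<alpha> \<in> K"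
      proof (rule ccontr)
        assume "\<alpha> \<notin> K"
        then obtain \<eta>2 where e2: "\<eta>2 > 0" "K \<inter> {\<alpha>-\<eta>2<..<\<alpha>+\<eta>2} = {}"
          using K_closed[of \<alpha>] \<alpha>in lohi by auto
        have "max s0 (\<alpha> - \<eta>2) < \<alpha>" using \<alpha>s0 e2 by auto
        then obtain z where "z \<in> Z" "max s0 (\<alpha> - \<eta>2) < z"
          using less_cSupE[of _ Z] Z unfolding \<alpha>_def by blast
        then show False using e2 Z_le[of z] by (force simp: Z_def)
      qed
      show False
      proof (cases "\<forall>\<eta>>0. K \<inter> {\<alpha>-\<eta><..<\<alpha>} \<noteq> {}")
        case True
        then show False using limit_hot[OF \<alpha>in] neg by blast
      next
        case False
        then obtain \<eta>2 where e2: "\<eta>2 > 0" "K \<inter> {\<alpha>-\<eta>2<..<\<alpha>} = {}" by blast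
        have "\<alpha> \<in> hot_times M n"
        proof (rule isolated_hot[OF \<open>\<alpha> \<in> K\<close> \<alpha>in])
          show "min \<eta>2 (s - \<alpha>) > 0" using e2 \<alpha> by auto
          have "{\<alpha> - min \<eta>2 (s - \<alpha>)<..<\<alpha>} \<subseteq> {\<alpha>-\<eta>2<..<\<alpha>}" by auto
          then show "K \<inter> {\<alpha> - min \<eta>2 (s - \<alpha>)<..<\<alpha>} = {}" using e2 by blast
          have "{\<alpha><..<\<alpha> + min \<eta>2 (s - \<alpha>)} \<subseteq> {\<alpha><..<s}" by auto
          then show "K \<inter> {\<alpha><..<\<alpha> + min \<eta>2 (s - \<alpha>)} = {}" using gap by blast
        qed
        with neg show False by blast
      qed
    qed
    show ?thesis
    proof (rule gap_estimate[where \<alpha> = \<alpha> and ?r1.0 = r1])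
      fix u assume u: "u \<in> {\<alpha><..<s}"
      then have "u \<notin> K" using gap by blast
      then show "lat M u" using u \<alpha> s s0 lohi by (intro lat_G) auto
    qed (use \<alpha> s s0 lohi ac r r1 M x below hot_r[OF \<alpha>_hot] in auto)
  qed
  have lat_s: "lat M s" if s: "s \<in> {s0<..<hi}" for s
    unfolding lat_def
  proof (intro allI impI)
    fix e :: real assume e: "e > 0"
    define d where "d = min (min r (e * r / M)) (min (s - s0) (hi - s))"
    have d: "d > 0" "d \<le> r" "d \<le> e * r / M" "d \<le> s - s0" "d \<le> hi - s"
      using e r M s by (auto simp: d_def)
    have "M - e \<le> A (x, u)" if x: "x \<in> {b-d<..<b}" and u: "u \<in> {s-d<..<s+d}" for x u
    proof -
      have "b - x \<le> e * r / M" using x d by auto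
      then have "M * (b - x) / r \<le> e" using M r by (simp add: field_simps)
      then have "M - e \<le> M * (1 - (b - x) / r)" by (simp add: algebra_simps)
      also have "\<dots> \<le> A (x, u)" using x u d by (intro est) auto
      finally show ?thesis .
    qed
    with d(1) show "\<exists>\<delta>>0. \<forall>x\<in>{b-\<delta><..<b}. \<forall>s\<in>{s-\<delta><..<s+\<delta>}. M - e \<le> A (x, s)" by blast
  qed
  have "td \<in> G"
    unfolding G_def
  proof (intro CollectI conjI exI ballI)
    show "0 < min (td - s0) (hi - td)" using s0 td' by auto
    fix u assume "u \<in> {td - min (td - s0) (hi - td)<..<td + min (td - s0) (hi - td)} \<inter> {a<..<c}"
    then show "lat M u" by (intro lat_s) auto
  qed (use td' lohi in auto)
  with td(1) show False by (simp add: K_def)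
qed

text \<open>The profile (y - x1 + 1)^2 / 2 has slope at least 1 and curvature 1 on the strip, so its
  multiple by \<open>M\<close> has speed at least M^(\<beta> (p - 1)) \<ge> M > M \<kappa>. The
  strip, the time interval and \<open>\<kappa>\<close> do not depend on \<open>M\<close>.\<close>

theorem no_supersolution:
  assumes \<beta>: "\<beta> * (p - 1) \<ge> 1"
  shows False
proof -
  obtain a c r where acr: "0 < a" "a < c" "0 < r" "\<And>x t. x \<in> {b-r<..<b} \<Longrightarrow> t \<in> {a<..<c} \<Longrightarrow> 0 \<le> A (x, t)"
    using bounded_below_interval by blast
  define r1 where "r1 = min r (b / 2)"
  have r1: "0 < r1" "r1 < b" "r1 \<le> r" using acr b_pos by (auto simp: r1_def)
  have lat_all: "lat M t" if "M > 0" "t \<in> {a<..<c}" for M t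
    using acr r1 that by (intro lat_interval[of a c r1 M t]) auto
  \<comment> \<open>The outer thirds are discarded so that the closed time interval from
    \<open>s0\<close> to \<open>s1\<close> lies in the open one on which \<open>lat\<close> is
    known.\<close>
  define s0 where "s0 = (2 * a + c) / 3"
  define s1 where "s1 = (a + 2 * c) / 3"
  have s01: "a < s0" "s0 < s1" "s1 < c" using acr by (auto simp: s0_def s1_def)
  define T where "T = s1 - s0"
  have T: "T > 0" using s01 by (simp add: T_def)
  define l where "l = r1 / 2"
  define x1 where "x1 = b - l"
  have l: "l > 0" "l < r1" using r1 by (auto simp: l_def)
  \<comment> \<open>Below 1 for strictness, and so small that the barrier is still at most 0 at
    \<open>x1\<close> at the final time \<open>s1\<close>.\<close>
  define \<kappa> where "\<kappa> = min (1/2) (((l + 1)\<^sup>2 - 1) / 2 / T)"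
  have "(l + 1)\<^sup>2 > 1" using l by (simp add: power2_eq_square algebra_simps add_pos_pos)
  then have \<kappa>: "\<kappa> > 0" "\<kappa> < 1" using T by (auto simp: \<kappa>_def)
  have "\<kappa> * T \<le> ((l + 1)\<^sup>2 - 1) / 2 / T * T" using T by (intro mult_right_mono) (auto simp: \<kappa>_def)
  then have \<kappa>T: "\<kappa> * T \<le> ((l + 1)\<^sup>2 - 1) / 2" using T by simp
  \<comment> \<open>A depth at which the spatial part has fallen by at most \<kappa> T / 2 from its
    boundary value, so half of the rise \<kappa> T is left at time \<open>s1\<close>.\<close>
  define d where "d = min (l / 2) (\<kappa> * T / (2 * (l + 1)))"
  have d: "0 < d" "d \<le> l / 2" "d * (2 * (l + 1)) \<le> \<kappa> * T"
  proof -
    show "0 < d" using l \<kappa> T by (auto simp: d_def)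
    show "d \<le> l / 2" unfolding d_def by (rule min.cobounded1)
    have "d \<le> \<kappa> * T / (2 * (l + 1))" by (simp add: d_def)
    then show "d * (2 * (l + 1)) \<le> \<kappa> * T" using l by (simp add: field_simps)
  qed
  have "M * (\<kappa> * T / 2) \<le> A (b - d, s1)" if M: "M \<ge> 1" for M
  proof -
    let ?P = "quad (M * (- \<kappa> * s0 + ((1 - x1)\<^sup>2 - (l + 1)\<^sup>2) / 2)) (M * (1 - x1)) (M / 2) (M * \<kappa>) 0"
    have P: "?P (y, u) = M * (\<kappa> * (u - s0) + ((y - x1 + 1)\<^sup>2 - (l + 1)\<^sup>2) / 2)" for y u
      by (simp add: quad_def power2_eq_square field_simps)
    have half_diff: "a + (c - d) / 2 \<le> k" if "a \<le> k" "c \<le> d" for a c d k :: real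
      using that by (simp add: field_simps)
    have square: "(y - x1 + 1)\<^sup>2 \<le> (l + 1)\<^sup>2" if "x1 \<le> y" "y \<le> b" for y
      using that by (intro power_mono) (auto simp: x1_def)
    have P_le: "?P (y, u) \<le> M * \<kappa> * T" if "x1 \<le> y" "y \<le> b" "u \<le> s1" for y u
    proof -
      have "\<kappa> * (u - s0) \<le> \<kappa> * T" using \<kappa> that by (intro mult_left_mono) (auto simp: T_def)
      then have "M * (\<kappa> * (u - s0) + ((y - x1 + 1)\<^sup>2 - (l + 1)\<^sup>2) / 2) \<le> M * (\<kappa> * T)"
        using half_diff[OF _ square[OF that(1,2)]] M by (intro mult_left_mono) auto
      then show ?thesis unfolding P by (simp add: mult.assoc)
    qed
    \<comment> \<open>The summand 1 in the level is spent on the loss e = 1 in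
      \<open>lat_compact\<close>; \<open>M * \<kappa> * T\<close> bounds the barrier on the whole
      strip.\<close>
    obtain \<delta> where \<delta>: "\<delta> > 0" "\<And>x t. x \<in> {b-\<delta><..<b} \<Longrightarrow> t \<in> {s0..s1} \<Longrightarrow> M * \<kappa> * T + 1 - 1 \<le> A (x, t)"
      using lat_compact[of s0 s1 "M * \<kappa> * T + 1" 1] lat_all[of "M * \<kappa> * T + 1"] s01 M \<kappa> T
      by (auto simp: add_pos_pos)
    define x2 where "x2 = b - min \<delta> d / 2"
    have x2: "b - \<delta> < x2" "b - d < x2" "x2 < b" "x1 < x2" using \<delta> d l by (auto simp: x2_def min_def x1_def)
    have A0: "0 \<le> A (y, u)" if "x1 \<le> y" "y \<le> x2" "u \<in> {s0..s1}" for y u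
      using that x2 l r1 s01 by (intro acr(4)) (auto simp: x1_def)
    have "?P (b - d, s1) \<le> A (b - d, s1)"
    proof (rule comparison_rect[where ?x1.0 = x1 and ?x2.0 = x2 and s = s0 and ?t1.0 = s1])
      fix y assume y: "x1 < y" "y < x2"
      have q: "M * (1 - x1) + 2 * (M / 2) * y = M * (y - x1 + 1)" by (simp add: algebra_simps)
      have q_ge: "M \<le> M * (y - x1 + 1)" using M y by simp
      then have q_pos: "M * (y - x1 + 1) > 0" using M by linarith
      have "M powr (p - 2) \<le> (M * (y - x1 + 1)) powr (p - 2)"
        using q_ge M p_ge by (intro powr_mono2) auto
      also have "\<dots> \<le> (p - 1) * (M * (y - x1 + 1)) powr (p - 2)"
        using mult_right_mono[of 1 "p - 1" "(M * (y - x1 + 1)) powr (p - 2)"] p_ge by simp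
      also have "\<dots> \<le> g (M * (y - x1 + 1))"
        using g_lower[of "M * (y - x1 + 1)", OF less_imp_neq[OF q_pos, symmetric]] abs_of_pos[OF q_pos] by simp
      finally have "M powr (p - 2) * M \<le> g (M * (y - x1 + 1)) * M" using M by (intro mult_right_mono) auto
      moreover have "M powr (p - 2) * M = M powr (p - 1)"
        using M powr_add[of M "p - 2" 1] by simp
      ultimately have "f (M powr (p - 1)) \<le> f (g (M * (y - x1 + 1)) * M)" by (intro f_pow_mono \<beta>_pos) simp
      moreover have "f (M powr (p - 1)) = M powr (\<beta> * (p - 1))"
        by (simp add: f_pow_nonneg powr_powr mult.commute)
      moreover have "M powr 1 \<le> M powr (\<beta> * (p - 1))" using M \<beta> by (intro powr_mono) auto
      moreover have "M powr 1 = M" "M * \<kappa> < M" using M \<kappa> by auto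
      ultimately have "M * \<kappa> < f (g (M * (y - x1 + 1)) * M)" by linarith
      then show "M * \<kappa> < f (g (M * (1 - x1) + 2 * (M / 2) * y) * (2 * (M / 2)))"
        unfolding q by simp
    next
      fix y assume y: "y \<in> {x1..x2}"
      have "?P (y, s0) \<le> 0" unfolding P using half_diff[OF _ square[of y], of 0 0] y x2 M
        by (intro mult_nonneg_nonpos) auto
      also have "0 \<le> A (y, s0)" using y s01 by (intro A0) auto
      finally show "?P (y, s0) \<le> A (y, s0)" .
    next
      fix u assume u: "u \<in> {s0..s1}"
      have "\<kappa> * (u - s0) \<le> \<kappa> * T" using \<kappa> u by (intro mult_left_mono) (auto simp: T_def)
      then have "?P (x1, u) \<le> 0" unfolding P using \<kappa>T M by (intro mult_nonneg_nonpos) (auto simp: field_simps)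
      also have "0 \<le> A (x1, u)" using u x2 by (intro A0) auto
      finally show "?P (x1, u) \<le> A (x1, u)" .
    next
      fix u assume u: "u \<in> {s0..s1}"
      have "?P (x2, u) \<le> M * \<kappa> * T" using u x2 by (intro P_le) auto
      also have "\<dots> \<le> A (x2, u)" using \<delta>(2)[of x2 u] u x2 by auto
      finally show "?P (x2, u) \<le> A (x2, u)" .
    qed (use x2 d l r1 s01 acr b_pos in \<open>auto simp: x1_def\<close>)
    moreover have "M * (\<kappa> * T / 2) \<le> ?P (b - d, s1)"
      unfolding P
    proof (intro mult_left_mono)
      have "(b - d - x1 + 1)\<^sup>2 - (l + 1)\<^sup>2 = d * d - d * (2 * (l + 1))"
        by (simp add: x1_def power2_eq_square algebra_simps)
      moreover have "0 \<le> d * d" by simp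
      ultimately have "- (\<kappa> * T) \<le> (b - d - x1 + 1)\<^sup>2 - (l + 1)\<^sup>2" using d(3) by linarith
      moreover have "t / 2 \<le> t + w / 2" if "- t \<le> w" for t w :: real using that by simp
      ultimately show "\<kappa> * T / 2 \<le> \<kappa> * (s1 - s0) + ((b - d - x1 + 1)\<^sup>2 - (l + 1)\<^sup>2) / 2"
        unfolding T_def by blast
    qed (use M in auto)
    ultimately show ?thesis by simp
  qed
  note bound = this
  have kt: "\<kappa> * T / 2 > 0" using \<kappa> T by simp
  define M where "M = max 1 ((A (b - d, s1) + 1) / (\<kappa> * T / 2))"
  have "A (b - d, s1) + 1 = (A (b - d, s1) + 1) / (\<kappa> * T / 2) * (\<kappa> * T / 2)" using \<kappa> T by simp
  also have "\<dots> \<le> M * (\<kappa> * T / 2)" using kt by (intro mult_right_mono) (auto simp: M_def)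
  also have "\<dots> \<le> A (b - d, s1)" by (rule bound) (simp add: M_def)
  finally show False by simp
qed

end

section \<open>Semicontinuous envelopes and second-order jets\<close>

lemma upper_env_lessD:
  assumes "upper_env b u z < a"
  shows "\<exists>r>0. \<forall>w\<in>cyl0 b \<inter> ball z r. ereal (u w) < a"
proof -
  obtain r where "r > 0" "(SUP w\<in>cyl0 b \<inter> ball z r. ereal (u w)) < a"
    using assms unfolding upper_env_eq_INF INF_less_iff by auto
  then show ?thesis by (meson SUP_upper le_less_trans)
qed

lemma upper_env_leI:
  assumes "r > 0" "\<And>w. w \<in> cyl0 b \<Longrightarrow> dist z w < r \<Longrightarrow> ereal (u w) \<le> a"
  shows "upper_env b u z \<le> a"
  unfolding upper_env_eq_INF using assms
  by (intro INF_lower2[of r] SUP_least) auto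

lemma less_upper_envD:
  assumes "a < upper_env b u z" "r > 0"
  shows "\<exists>w\<in>cyl0 b. dist z w < r \<and> a < ereal (u w)"
  using upper_env_leI[OF assms(2), of b z u a] assms(1) by (meson not_le)

lemma upper_env_ge: "z \<in> cyl0 b \<Longrightarrow> ereal (u z) \<le> upper_env b u z"
  unfolding upper_env_eq_INF by (auto intro!: INF_greatest SUP_upper)

lemma upper_env_mono:
  assumes "\<And>w. w \<in> cyl0 b \<Longrightarrow> u w \<le> v w"
  shows "upper_env b u z \<le> upper_env b v z"
  unfolding upper_env_eq_INF using assms by (intro INF_mono' SUP_subset_mono) auto

lemma upper_env_usc:
  assumes "usc_on (cyl0 b) u" "z \<in> cyl0 b"
  shows "upper_env b u z = ereal (u z)"
proof (rule antisym[OF _ upper_env_ge[OF assms(2)]])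
  show "upper_env b u z \<le> ereal (u z)"
  proof (rule ereal_le_epsilon2)
    fix e :: real assume "e > 0"
    then have "\<forall>\<^sub>F y in at z within cyl0 b. u y < u z + e"
      using assms by (auto simp: usc_on_def)
    then obtain d where d: "d > 0" "\<And>y. y \<in> cyl0 b \<Longrightarrow> y \<noteq> z \<Longrightarrow> dist y z < d \<Longrightarrow> u y < u z + e"
      unfolding eventually_at by auto
    show "upper_env b u z \<le> ereal (u z) + ereal e"
    proof (rule upper_env_leI[OF d(1)])
      fix w assume "w \<in> cyl0 b" "dist z w < d"
      then show "ereal (u w) \<le> ereal (u z) + ereal e"
        using d(2)[of w] \<open>e > 0\<close> by (cases "w = z") (auto simp: dist_commute)
    qed
  qed
qed

lemma lower_env_uminus: "lower_env b u z = - upper_env b (\<lambda>w. - u w) z"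
proof -
  have "(\<lambda>w. ereal (- u w)) = (\<lambda>w. - ereal (u w))" by simp
  then show ?thesis
    unfolding lower_env_eq_SUP upper_env_eq_INF
    by (simp only: ereal_INF_uminus_eq ereal_SUP_uminus_eq ereal_uminus_uminus)
qed

lemma usc_upper_env:
  assumes "\<And>z. z \<in> cyl0 b \<Longrightarrow> \<bar>upper_env b u z\<bar> \<noteq> \<infinity>"
  shows "usc_on (cyl0 b) (\<lambda>z. real_of_ereal (upper_env b u z))"
  unfolding usc_on_def
proof (intro ballI allI impI)
  fix z a assume z: "z \<in> cyl0 b" and a: "real_of_ereal (upper_env b u z) < a"
  define a' where "a' = (real_of_ereal (upper_env b u z) + a) / 2"
  have a': "real_of_ereal (upper_env b u z) < a'" "a' < a" using a by (auto simp: a'_def)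
  then have "upper_env b u z < ereal a'"
    using assms[OF z] by (cases "upper_env b u z") auto
  then obtain r where r: "r > 0" "\<And>w. w \<in> cyl0 b \<Longrightarrow> dist z w < r \<Longrightarrow> u w < a'"
    using upper_env_lessD[of b u z "ereal a'"] by (metis IntI less_ereal.simps(1) mem_ball)
  have "real_of_ereal (upper_env b u y) < a" if y: "y \<in> cyl0 b" "dist y z < r / 2" for y
  proof -
    have "upper_env b u y \<le> ereal a'"
    proof (rule upper_env_leI[of "r / 2"])
      fix w assume w: "w \<in> cyl0 b" "dist y w < r / 2"
      then have "dist z w < r" using y dist_triangle[of z w y] by (simp add: dist_commute)
      then show "ereal (u w) \<le> ereal a'" using r(2)[OF w(1)] by simp
    qed (use r in auto)
    then show ?thesis using assms[OF y(1)] a'(2) by (cases "upper_env b u y") auto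
  qed
  then show "\<forall>\<^sub>F y in at z within cyl0 b. real_of_ereal (upper_env b u y) < a"
    unfolding eventually_at using r(1) by (intro exI[of _ "r / 2"]) auto
qed

text \<open>A test parabola centred at \<open>z\<close>, without constant and mixed terms.
  \<open>C\<close> is a free parameter, since the second time derivative does not enter the
  equation.\<close>

definition jet :: "real \<times> real \<Rightarrow> real \<Rightarrow> real \<Rightarrow> real \<Rightarrow> real \<Rightarrow> real \<times> real \<Rightarrow> real" where
  "jet z a q Y C w = a * (snd w - snd z) + q * (fst w - fst z)
      + Y / 2 * (fst w - fst z)\<^sup>2 + C * (snd w - snd z)\<^sup>2"

lemma jet_at [simp]: "jet z a q Y C z = 0"
  by (simp add: jet_def)

lemma continuous_on_jet: "continuous_on S (jet z a q Y C)"
  unfolding jet_def by (intro continuous_intros)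

text \<open>Needed because perturbed extrema occur at points \<open>\<zeta>\<close> near
  \<open>z\<close>: the same parabola, read from \<open>\<zeta>\<close>, is again a jet with shifted
  first-order coefficients.\<close>

lemma jet_recenter:
  "jet z a q Y C w = jet z a q Y C \<zeta>
     + jet \<zeta> (a + 2 * C * (snd \<zeta> - snd z)) (q + Y * (fst \<zeta> - fst z)) Y C w"
  by (simp add: jet_def field_simps power2_eq_square)

definition touches :: "(real \<times> real \<Rightarrow> real) \<Rightarrow> real \<times> real \<Rightarrow> real \<Rightarrow> real \<Rightarrow> real \<Rightarrow> real \<Rightarrow> bool" where
  "touches v z a q Y C \<longleftrightarrow> (\<forall>\<^sub>F w in nhds z. v w \<le> v z + jet z a q Y C w)"

lemma box_nhds:
  fixes z :: "real \<times> real"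
  assumes "r > 0"
  shows "\<forall>\<^sub>F w in nhds z. \<bar>fst w - fst z\<bar> < r \<and> \<bar>snd w - snd z\<bar> < r"
proof -
  have "\<forall>\<^sub>F w in nhds z. w \<in> ball z r"
    using assms by (intro eventually_nhds_in_open) auto
  then show ?thesis
  proof eventually_elim
    case (elim w)
    then show ?case
      using dist_fst_le[of w z] dist_snd_le[of w z] by (auto simp: dist_real_def dist_commute)
  qed
qed

lemma nhds_box:
  fixes z :: "real \<times> real"
  assumes "\<forall>\<^sub>F w in nhds z. P w"
  shows "\<exists>r>0. \<forall>w. \<bar>fst w - fst z\<bar> < r \<longrightarrow> \<bar>snd w - snd z\<bar> < r \<longrightarrow> P w"
proof -
  obtain e where e: "e > 0" "\<And>w. dist w z < e \<Longrightarrow> P w"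
    using assms unfolding eventually_nhds_metric by auto
  have "P w" if "\<bar>fst w - fst z\<bar> < e / 2" "\<bar>snd w - snd z\<bar> < e / 2" for w
  proof (rule e(2))
    have "dist w z \<le> \<bar>fst w - fst z\<bar> + \<bar>snd w - snd z\<bar>"
      unfolding dist_prod_def dist_real_def by (rule sqrt_sum_squares_le_sum) auto
    then show "dist w z < e" using that by linarith
  qed
  with e(1) show ?thesis by (intro exI[of _ "e / 2"]) auto
qed

lemma C1_on_DERIV:
  assumes "C1_on S \<phi>" "(x, t) \<in> S"
  shows "((\<lambda>y. \<phi> (y, t)) has_real_derivative dx \<phi> (x, t)) (at x)"
    and "((\<lambda>s. \<phi> (x, s)) has_real_derivative dt \<phi> (x, t)) (at t)"
  using assms unfolding C1_on_def dx_def dt_def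
  by (auto simp: DERIV_deriv_iff_real_differentiable dest!: bspec[of S _ "(x, t)"])

lemma MVT_abs:
  fixes h :: "real \<Rightarrow> real"
  assumes "\<And>y. \<bar>y - x\<bar> \<le> \<bar>x' - x\<bar> \<Longrightarrow> (h has_real_derivative h' y) (at y)"
  shows "\<exists>y. \<bar>y - x\<bar> \<le> \<bar>x' - x\<bar> \<and> h x' - h x = (x' - x) * h' y"
proof (cases x x' rule: linorder_cases)
  case less
  then obtain y where "x < y" "y < x'" "h x' - h x = (x' - x) * h' y"
    using MVT2[of x x' h h'] assms by auto
  then show ?thesis by (intro exI[of _ y]) auto
next
  case greater
  then obtain y where "x' < y" "y < x" "h x - h x' = (x - x') * h' y"
    using MVT2[of x' x h h'] assms by auto
  then show ?thesis by (intro exI[of _ y]) (auto simp: algebra_simps)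
qed (auto intro: exI[of _ x])

lemma taylor2_abs:
  fixes h :: "real \<Rightarrow> real"
  assumes "\<And>y. \<bar>y - x\<bar> \<le> \<bar>x' - x\<bar> \<Longrightarrow> (h has_real_derivative h' y) (at y)"
    and "\<And>y. \<bar>y - x\<bar> \<le> \<bar>x' - x\<bar> \<Longrightarrow> (h' has_real_derivative h'' y) (at y)"
  shows "\<exists>y. \<bar>y - x\<bar> \<le> \<bar>x' - x\<bar> \<and> h x' = h x + h' x * (x' - x) + h'' y / 2 * (x' - x)\<^sup>2"
proof (cases "x' = x")
  case False
  define diff where "diff m = (if m = 0 then h else if m = 1 then h' else h'')" for m :: nat
  define A where "A = x - \<bar>x' - x\<bar>"
  define B where "B = x + \<bar>x' - x\<bar>"
  have "\<exists>t. (if x' < x then x' < t \<and> t < x else x < t \<and> t < x') \<and>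
     h x' = (\<Sum>m<2. diff m x / fact m * (x' - x) ^ m) + diff 2 t / fact 2 * (x' - x) ^ 2"
  proof (rule Taylor[of 2 diff h A B x x'])
    show "\<forall>m t. m < 2 \<and> A \<le> t \<and> t \<le> B \<longrightarrow> (diff m has_real_derivative diff (Suc m) t) (at t)"
    proof (intro allI impI)
      fix m :: nat and t :: real assume *: "m < 2 \<and> A \<le> t \<and> t \<le> B"
      then have "\<bar>t - x\<bar> \<le> \<bar>x' - x\<bar>" by (auto simp: A_def B_def)
      moreover have "m = 0 \<or> m = 1" using * by auto
      ultimately show "(diff m has_real_derivative diff (Suc m) t) (at t)"
        using assms by (auto simp: diff_def)
    qed
  qed (use False in \<open>auto simp: diff_def A_def B_def\<close>)
  then obtain t where t: "if x' < x then x' < t \<and> t < x else x < t \<and> t < x'"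
     "h x' = (\<Sum>m<2. diff m x / fact m * (x' - x) ^ m) + diff 2 t / fact 2 * (x' - x) ^ 2" by blast
  have "\<bar>t - x\<bar> \<le> \<bar>x' - x\<bar>" using t(1) by (auto split: if_splits)
  moreover have "h x' = h x + h' x * (x' - x) + h'' t / 2 * (x' - x)\<^sup>2"
    using t(2) by (simp add: diff_def numeral_2_eq_2)
  ultimately show ?thesis by blast
qed (auto intro: exI[of _ x])

text \<open>The mixed term \<open>\<xi> \<tau>\<close> is absorbed into \<open>\<delta> \<xi>\<^sup>2 + C \<tau>\<^sup>2\<close>, so that jets need no mixed derivative.\<close>

lemma C2_expansion:
  assumes \<phi>: "C2_on S \<phi>" and S: "open S" "z \<in> S" and \<delta>: "\<delta> > 0"
  shows "\<exists>C. \<forall>\<^sub>F w in nhds z. \<bar>\<phi> w - (\<phi> z + jet z (dt \<phi> z) (dx \<phi> z) (dx (dx \<phi>) z) 0 w)\<bar>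
            \<le> \<delta> / 2 * (fst w - fst z)\<^sup>2 + C * (snd w - snd z)\<^sup>2"
proof -
  \<comment> \<open>Two errors of size D/2 \<xi>^2 will add up: the oscillation of the second space
    derivative and the share of the mixed term.\<close>
  define D where "D = \<delta> / 2"
  have D: "D > 0" using \<delta> by (simp add: D_def)
  define L where "L = max \<bar>dx (dt \<phi>) z\<bar> \<bar>dt (dt \<phi>) z\<bar> + 1"
  have L: "L > 0" by (simp add: L_def)
  have C1: "C1_on S \<phi>" "C1_on S (dx \<phi>)" "C1_on S (dt \<phi>)" using \<phi> by (auto simp: C2_on_def)
  have cont: "continuous_on S (dx (dx \<phi>))" "continuous_on S (dx (dt \<phi>))" "continuous_on S (dt (dt \<phi>))"
    using C1 by (auto simp: C1_on_def)
  have lim: "(h \<longlongrightarrow> h z) (nhds z)" if "continuous_on S h" for h :: "real \<times> real \<Rightarrow> real"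
    using that S by (simp add: continuous_on_eq_continuous_at isCont_def tendsto_at_iff_tendsto_nhds)
  have "\<forall>\<^sub>F w in nhds z. w \<in> S" using S by (intro eventually_nhds_in_open)
  moreover have "\<forall>\<^sub>F w in nhds z. \<bar>dx (dx \<phi>) w - dx (dx \<phi>) z\<bar> < D"
    using tendstoD[OF lim[OF cont(1)] D] by (simp add: dist_real_def)
  moreover have "\<forall>\<^sub>F w in nhds z. \<bar>dx (dt \<phi>) w\<bar> < L"
    by (rule order_tendstoD(2)[OF tendsto_rabs[OF lim[OF cont(2)]]]) (simp add: L_def)
  moreover have "\<forall>\<^sub>F w in nhds z. \<bar>dt (dt \<phi>) w\<bar> < L"
    by (rule order_tendstoD(2)[OF tendsto_rabs[OF lim[OF cont(3)]]]) (simp add: L_def)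
  ultimately have "\<forall>\<^sub>F w in nhds z. w \<in> S \<and> \<bar>dx (dx \<phi>) w - dx (dx \<phi>) z\<bar> < D
      \<and> \<bar>dx (dt \<phi>) w\<bar> < L \<and> \<bar>dt (dt \<phi>) w\<bar> < L"
    by eventually_elim auto
  from nhds_box[OF this] obtain r where r: "r > 0" "\<And>w. \<bar>fst w - fst z\<bar> < r \<Longrightarrow> \<bar>snd w - snd z\<bar> < r \<Longrightarrow>
     w \<in> S \<and> \<bar>dx (dx \<phi>) w - dx (dx \<phi>) z\<bar> < D \<and> \<bar>dx (dt \<phi>) w\<bar> < L \<and> \<bar>dt (dt \<phi>) w\<bar> < L"
    by blast
  obtain x t where z: "z = (x, t)" by force
  have "\<bar>\<phi> w - (\<phi> z + jet z (dt \<phi> z) (dx \<phi> z) (dx (dx \<phi>) z) 0 w)\<bar>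
          \<le> \<delta> / 2 * (fst w - fst z)\<^sup>2 + (L\<^sup>2 / D + L) * (snd w - snd z)\<^sup>2"
    if w: "\<bar>fst w - fst z\<bar> < r \<and> \<bar>snd w - snd z\<bar> < r" for w
  proof -
    obtain x' t' where w': "w = (x', t')" by force
    have box: "(y, s) \<in> S" "\<bar>dx (dx \<phi>) (y, s) - dx (dx \<phi>) z\<bar> < D" "\<bar>dx (dt \<phi>) (y, s)\<bar> < L" "\<bar>dt (dt \<phi>) (y, s)\<bar> < L"
      if "\<bar>y - x\<bar> \<le> \<bar>x' - x\<bar>" "\<bar>s - t\<bar> \<le> \<bar>t' - t\<bar>" for y s
      using r(2)[of "(y, s)"] that w by (auto simp: z w')
    have dX: "((\<lambda>y. \<phi> (y, t)) has_real_derivative dx \<phi> (y, t)) (at y)"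
      "((\<lambda>y. dx \<phi> (y, t)) has_real_derivative dx (dx \<phi>) (y, t)) (at y)"
      "((\<lambda>y. dt \<phi> (y, t)) has_real_derivative dx (dt \<phi>) (y, t)) (at y)"
      if "\<bar>y - x\<bar> \<le> \<bar>x' - x\<bar>" for y
      using C1[THEN C1_on_DERIV(1), OF box(1)[OF that, of t]] by simp_all
    have dT: "((\<lambda>s. \<phi> (x', s)) has_real_derivative dt \<phi> (x', s)) (at s)"
      "((\<lambda>s. dt \<phi> (x', s)) has_real_derivative dt (dt \<phi>) (x', s)) (at s)"
      if "\<bar>s - t\<bar> \<le> \<bar>t' - t\<bar>" for s
      using C1(1,3)[THEN C1_on_DERIV(2), OF box(1)[OF _ that, of x']] by simp_all
    \<comment> \<open>The path goes first in space at time \<open>t\<close>, to second order, and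
      then in time at \<open>x'\<close>. The time derivative at (x', s) is compared with that at
      \<open>z\<close> via (x', t), which brings in the mixed derivative.\<close>
    have "\<exists>y. \<bar>y - x\<bar> \<le> \<bar>x' - x\<bar> \<and>
      \<phi> (x', t) = \<phi> (x, t) + dx \<phi> (x, t) * (x' - x) + dx (dx \<phi>) (y, t) / 2 * (x' - x)\<^sup>2"
      by (rule taylor2_abs) (fact dX(1), fact dX(2))
    then obtain y where y: "\<bar>y - x\<bar> \<le> \<bar>x' - x\<bar>"
      "\<phi> (x', t) = \<phi> (x, t) + dx \<phi> (x, t) * (x' - x) + dx (dx \<phi>) (y, t) / 2 * (x' - x)\<^sup>2" by blast
    have "\<exists>s. \<bar>s - t\<bar> \<le> \<bar>t' - t\<bar> \<and> \<phi> (x', t') - \<phi> (x', t) = (t' - t) * dt \<phi> (x', s)"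
      by (rule MVT_abs) (fact dT(1))
    then obtain s where s: "\<bar>s - t\<bar> \<le> \<bar>t' - t\<bar>" "\<phi> (x', t') - \<phi> (x', t) = (t' - t) * dt \<phi> (x', s)"
      by blast
    have "\<exists>s1. \<bar>s1 - t\<bar> \<le> \<bar>s - t\<bar> \<and> dt \<phi> (x', s) - dt \<phi> (x', t) = (s - t) * dt (dt \<phi>) (x', s1)"
      by (rule MVT_abs, rule dT(2)) (use s(1) in linarith)
    then obtain s1 where s1: "\<bar>s1 - t\<bar> \<le> \<bar>s - t\<bar>" "dt \<phi> (x', s) - dt \<phi> (x', t) = (s - t) * dt (dt \<phi>) (x', s1)"
      by blast
    have "\<exists>y1. \<bar>y1 - x\<bar> \<le> \<bar>x' - x\<bar> \<and> dt \<phi> (x', t) - dt \<phi> (x, t) = (x' - x) * dx (dt \<phi>) (y1, t)"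
      by (rule MVT_abs) (fact dX(3))
    then obtain y1 where y1: "\<bar>y1 - x\<bar> \<le> \<bar>x' - x\<bar>" "dt \<phi> (x', t) - dt \<phi> (x, t) = (x' - x) * dx (dt \<phi>) (y1, t)"
      by blast
    define \<xi> where "\<xi> = x' - x"
    define \<tau> where "\<tau> = t' - t"
    have "\<bar>(s - t) * dt (dt \<phi>) (x', s1)\<bar> \<le> \<bar>\<tau>\<bar> * L"
      unfolding abs_mult \<tau>_def using s(1) s1(1) box(4)[of x' s1] by (intro mult_mono) auto
    moreover have "\<bar>(x' - x) * dx (dt \<phi>) (y1, t)\<bar> \<le> \<bar>\<xi>\<bar> * L"
      unfolding abs_mult \<xi>_def using y1(1) box(3)[of y1 t] by (intro mult_mono) auto
    ultimately have "\<bar>dt \<phi> (x', s) - dt \<phi> (x, t)\<bar> \<le> L * \<bar>\<tau>\<bar> + L * \<bar>\<xi>\<bar>"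
      using s1(2) y1(2) by (simp add: mult.commute)
    then have "\<bar>\<tau>\<bar> * \<bar>dt \<phi> (x', s) - dt \<phi> (x, t)\<bar> \<le> \<bar>\<tau>\<bar> * (L * \<bar>\<tau>\<bar> + L * \<bar>\<xi>\<bar>)" by (intro mult_left_mono) auto
    also have "\<dots> = L * \<tau>\<^sup>2 + (L * \<bar>\<tau>\<bar>) * \<bar>\<xi>\<bar>" by (simp add: power2_eq_square algebra_simps)
    \<comment> \<open>Young's inequality, weighted so that only a small multiple of \<xi>^2
      appears.\<close>
    also have "(L * \<bar>\<tau>\<bar>) * \<bar>\<xi>\<bar> \<le> L\<^sup>2 / D * \<tau>\<^sup>2 + D / 2 * \<xi>\<^sup>2"
    proof -
      have "0 \<le> (L * \<bar>\<tau>\<bar> - D * \<bar>\<xi>\<bar>)\<^sup>2" by simp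
      then have "2 * (L * \<bar>\<tau>\<bar> * (D * \<bar>\<xi>\<bar>)) \<le> L\<^sup>2 * \<tau>\<^sup>2 + D\<^sup>2 * \<xi>\<^sup>2"
        by (simp add: power2_diff power_mult_distrib algebra_simps)
      moreover have "0 \<le> L\<^sup>2 * \<tau>\<^sup>2" by simp
      ultimately have "L * \<bar>\<tau>\<bar> * (D * \<bar>\<xi>\<bar>) \<le> L\<^sup>2 * \<tau>\<^sup>2 + D\<^sup>2 * \<xi>\<^sup>2 / 2" by linarith
      then show ?thesis using D by (simp add: field_simps power2_eq_square)
    qed
    finally have 1: "\<bar>\<tau> * (dt \<phi> (x', s) - dt \<phi> (x, t))\<bar> \<le> (L\<^sup>2 / D + L) * \<tau>\<^sup>2 + D / 2 * \<xi>\<^sup>2"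
      unfolding abs_mult distrib_right by linarith
    have "\<bar>dx (dx \<phi>) (y, t) - dx (dx \<phi>) z\<bar> / 2 * \<xi>\<^sup>2 \<le> D / 2 * \<xi>\<^sup>2"
      using box(2)[of y t] y(1) by (intro mult_right_mono divide_right_mono) auto
    then have 2: "\<bar>(dx (dx \<phi>) (y, t) - dx (dx \<phi>) z) / 2 * \<xi>\<^sup>2\<bar> \<le> D / 2 * \<xi>\<^sup>2"
      by (simp add: abs_mult)
    have "\<phi> w - (\<phi> z + jet z (dt \<phi> z) (dx \<phi> z) (dx (dx \<phi>) z) 0 w)
       = \<tau> * (dt \<phi> (x', s) - dt \<phi> (x, t)) + (dx (dx \<phi>) (y, t) - dx (dx \<phi>) z) / 2 * \<xi>\<^sup>2"
    proof -
      have "\<phi> w = \<phi> z + dx \<phi> z * \<xi> + dx (dx \<phi>) (y, t) / 2 * \<xi>\<^sup>2 + \<tau> * dt \<phi> (x', s)"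
        using y(2) s(2) unfolding w' z \<xi>_def \<tau>_def by linarith
      moreover have "jet z (dt \<phi> z) (dx \<phi> z) (dx (dx \<phi>) z) 0 w
          = dt \<phi> z * \<tau> + dx \<phi> z * \<xi> + dx (dx \<phi>) z / 2 * \<xi>\<^sup>2"
        unfolding jet_def w' z \<xi>_def \<tau>_def by simp
      moreover have "\<tau> * (dt \<phi> (x', s) - dt \<phi> (x, t)) = \<tau> * dt \<phi> (x', s) - dt \<phi> z * \<tau>"
        unfolding z by (simp add: algebra_simps)
      ultimately show ?thesis unfolding diff_divide_distrib left_diff_distrib by linarith
    qed
    then have "\<bar>\<phi> w - (\<phi> z + jet z (dt \<phi> z) (dx \<phi> z) (dx (dx \<phi>) z) 0 w)\<bar>
        \<le> (L\<^sup>2 / D + L) * \<tau>\<^sup>2 + D / 2 * \<xi>\<^sup>2 + D / 2 * \<xi>\<^sup>2"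
      using 1 2 by linarith
    also have "\<dots> = \<delta> / 2 * \<xi>\<^sup>2 + (L\<^sup>2 / D + L) * \<tau>\<^sup>2"
      unfolding D_def by simp
    finally show ?thesis unfolding \<xi>_def \<tau>_def w' z fst_conv snd_conv .
  qed
  then show ?thesis
    by (intro exI[of _ "L\<^sup>2 / D + L"] eventually_mono[OF box_nhds[OF r(1), of z]])
qed

section \<open>Perron's method\<close>

lemma usc_on_subset: "usc_on S w \<Longrightarrow> T \<subseteq> S \<Longrightarrow> usc_on T w"
  unfolding usc_on_def by (blast intro: filter_leD[OF at_le])

lemma lsc_on_uminus:
  assumes "usc_on S w"
  shows "lsc_on S (\<lambda>z. - w z)"
  unfolding lsc_on_def
proof (intro ballI allI impI)
  fix z a assume "z \<in> S" "a < - w z"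
  then have "\<forall>\<^sub>F y in at z within S. w y < - a" using assms unfolding usc_on_def by auto
  then show "\<forall>\<^sub>F y in at z within S. a < - w y" by eventually_elim auto
qed

text \<open>If \<open>h''\<close> were positive, \<open>h'\<close> would be positive just to the
  right of \<open>x\<close>, and by the mean value theorem \<open>h\<close> would increase
  there.\<close>

lemma DERIV_local_max_le:
  fixes h :: "real \<Rightarrow> real"
  assumes h: "\<forall>\<^sub>F y in nhds x. (h has_real_derivative h' y) (at y)"
    and h': "(h' has_real_derivative h'') (at x)"
    and max: "\<forall>\<^sub>F y in nhds x. h y \<le> h x"
  shows "h' x = 0 \<and> h'' \<le> 0"
proof -
  obtain d where d: "d > 0" "\<And>y. dist y x < d \<Longrightarrow> (h has_real_derivative h' y) (at y) \<and> h y \<le> h x"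
    using eventually_conj[OF h max] unfolding eventually_nhds_metric by auto
  have h0: "h' x = 0"
    using d by (intro DERIV_local_max[of h "h' x" x d]) (auto simp: dist_real_def abs_minus_commute)
  have "h'' \<le> 0"
  proof (rule ccontr)
    assume "\<not> h'' \<le> 0"
    then obtain e where e: "e > 0" "\<And>k. 0 < k \<Longrightarrow> k < e \<Longrightarrow> h' x < h' (x + k)"
      using DERIV_pos_inc_right[OF h'] by auto
    define k where "k = min d e / 2"
    have k: "0 < k" "k < d" "k < e" using d(1) e(1) by (auto simp: k_def)
    have "\<exists>y. x < y \<and> y < x + k \<and> h (x + k) - h x = (x + k - x) * h' y"
      using d k by (intro MVT2) (auto simp: dist_real_def)
    then obtain y where y: "x < y" "y < x + k" "h (x + k) - h x = k * h' y" by auto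
    then have "h' y > 0" using e(2)[of "y - x"] k h0 by simp
    then have "h (x + k) > h x" using y(3) k by (simp add: algebra_simps)
    then show False using d(2)[of "x + k"] k by (simp add: dist_real_def)
  qed
  with h0 show ?thesis ..
qed

lemma touches_derivs:
  assumes touch: "touches v (x, t) a q Y C"
    and t: "((\<lambda>s. v (x, s)) has_real_derivative vt) (at t)"
    and x: "\<forall>\<^sub>F y in nhds x. ((\<lambda>y. v (y, t)) has_real_derivative vx y) (at y)"
    and xx: "(vx has_real_derivative vxx) (at x)"
  shows "a = vt" "q = vx x" "vxx \<le> Y"
proof -
  have lim: "((\<lambda>s. (x, s)) \<longlongrightarrow> (x, t)) (nhds t)" "((\<lambda>y. (y, t)) \<longlongrightarrow> (x, t)) (nhds x)"
    by (auto intro!: tendsto_intros filterlim_ident)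
  have "\<forall>\<^sub>F s in nhds t. v (x, s) \<le> v (x, t) + jet (x, t) a q Y C (x, s)"
    using touch unfolding touches_def by (rule eventually_compose_filterlim[OF _ lim(1)])
  then obtain d where d: "d > 0" "\<And>s. dist s t < d \<Longrightarrow> v (x, s) \<le> v (x, t) + jet (x, t) a q Y C (x, s)"
    unfolding eventually_nhds_metric by auto
  have "((\<lambda>s. v (x, s) - a * (s - t) - C * (s - t)\<^sup>2) has_real_derivative vt - a) (at t)"
    by (auto intro!: derivative_eq_intros t)
  then have "vt - a = 0"
    using d by (rule_tac DERIV_local_max) (auto simp: jet_def dist_real_def abs_minus_commute algebra_simps)
  then show "a = vt" by simp
  have "\<forall>\<^sub>F y in nhds x. v (y, t) \<le> v (x, t) + jet (x, t) a q Y C (y, t)"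
    using touch unfolding touches_def by (rule eventually_compose_filterlim[OF _ lim(2)])
  then have max: "\<forall>\<^sub>F y in nhds x. v (y, t) - q * (y - x) - Y / 2 * (y - x)\<^sup>2 \<le> v (x, t) - q * (x - x) - Y / 2 * (x - x)\<^sup>2"
    by eventually_elim (simp add: jet_def)
  have "vx x - q - Y * (x - x) = 0 \<and> vxx - Y \<le> 0"
  proof (rule DERIV_local_max_le[where h' = "\<lambda>y. vx y - q - Y * (y - x)", OF _ _ max])
    show "\<forall>\<^sub>F y in nhds x. ((\<lambda>y. v (y, t) - q * (y - x) - Y / 2 * (y - x)\<^sup>2) has_real_derivative vx y - q - Y * (y - x)) (at y)"
      using x by eventually_elim (auto intro!: derivative_eq_intros)
    show "((\<lambda>y. vx y - q - Y * (y - x)) has_real_derivative vxx - Y) (at x)"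
      by (auto intro!: derivative_eq_intros xx)
  qed
  then show "q = vx x" "vxx \<le> Y" by auto
qed

section \<open>Viscosity inequalities expressed by jets\<close>

context equation begin

text \<open>The subsolution inequality tested with parabolas only and separated from semicontinuity.
  Perturbing and recentring test functions thereby becomes algebra with coefficients.\<close>

definition vsub :: "(real \<times> real \<Rightarrow> real) \<Rightarrow> bool" where
  "vsub v \<longleftrightarrow> (\<forall>z\<in>cyl b. \<forall>a q Y C. touches v z a q Y C \<longrightarrow> a + F q Y \<le> 0)"

lemma vsubD: "vsub v \<Longrightarrow> z \<in> cyl b \<Longrightarrow> touches v z a q Y C \<Longrightarrow> a + F q Y \<le> 0"
  unfolding vsub_def by blast

text \<open>Continuity of \<open>F\<close> allows the test parabola to be opened by a small
  \<open>d\<close>; this absorbs Taylor remainders and makes contacts strict.\<close>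

lemma F_le_limit:
  assumes "\<And>d. d > 0 \<Longrightarrow> a + F q (Y + d) \<le> 0"
  shows "a + F q Y \<le> 0"
proof (rule tendsto_le[OF _ tendsto_const])
  show "((\<lambda>d. a + F q (Y + d)) \<longlongrightarrow> a + F q Y) (at_right 0)"
    by (intro tendsto_intros tendsto_F) (auto intro!: tendsto_eq_intros)
  show "\<forall>\<^sub>F d in at_right 0. a + F q (Y + d) \<le> 0"
    unfolding eventually_at_filter using assms by auto
qed auto

lemma sub_solutionI:
  assumes "usc_on (cyl0 b) v" "vsub v"
  shows "sub_solution b p \<beta> \<epsilon> v"
  unfolding sub_solution_def
proof (intro conjI assms ballI allI impI)
  fix z \<phi> assume z: "z \<in> cyl b" and *: "C2_on (cyl b) \<phi> \<and> (\<forall>\<^sub>F w in nhds z. v w - \<phi> w \<le> v z - \<phi> z)"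
  show "dt \<phi> z + F (dx \<phi> z) (dx (dx \<phi>) z) \<le> 0"
  proof (rule F_le_limit)
    fix d :: real assume "d > 0"
    then obtain C where "\<forall>\<^sub>F w in nhds z. \<bar>\<phi> w - (\<phi> z + jet z (dt \<phi> z) (dx \<phi> z) (dx (dx \<phi>) z) 0 w)\<bar>
            \<le> d / 2 * (fst w - fst z)\<^sup>2 + C * (snd w - snd z)\<^sup>2"
      using C2_expansion[OF _ open_cyl z] * by blast
    moreover have "\<forall>\<^sub>F w in nhds z. v w - \<phi> w \<le> v z - \<phi> z" using * by blast
    ultimately have "touches v z (dt \<phi> z) (dx \<phi> z) (dx (dx \<phi>) z + d) C"
      unfolding touches_def
    proof eventually_elim
      case (elim w)
      have "jet z (dt \<phi> z) (dx \<phi> z) (dx (dx \<phi>) z + d) C w = jet z (dt \<phi> z) (dx \<phi> z) (dx (dx \<phi>) z) 0 w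
         + (d / 2 * (fst w - fst z)\<^sup>2 + C * (snd w - snd z)\<^sup>2)"
        by (simp add: jet_def add_divide_distrib distrib_right)
      then show ?case using elim by linarith
    qed
    then show "dt \<phi> z + F (dx \<phi> z) (dx (dx \<phi>) z + d) \<le> 0"
      using assms(2) z by (intro vsubD)
  qed
qed

lemma super_solutionI:
  assumes "lsc_on (cyl0 b) v" "vsub (\<lambda>z. - v z)"
    and "\<And>t. t > 0 \<Longrightarrow> filterlim (\<lambda>x. v (x, t)) at_top (at_left b)"
    and "\<And>t. t > 0 \<Longrightarrow> filterlim (\<lambda>x. v (x, t)) at_top (at_right (- b))"
  shows "super_solution b p \<beta> \<epsilon> v"
  unfolding super_solution_def
proof (intro conjI assms ballI allI impI)
  fix z \<phi> assume z: "z \<in> cyl b" and *: "C2_on (cyl b) \<phi> \<and> (\<forall>\<^sub>F w in nhds z. v w - \<phi> w \<ge> v z - \<phi> z)"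
  have "- dt \<phi> z + F (- dx \<phi> z) (- dx (dx \<phi>) z) \<le> 0"
  proof (rule F_le_limit)
    fix d :: real assume "d > 0"
    then obtain C where "\<forall>\<^sub>F w in nhds z. \<bar>\<phi> w - (\<phi> z + jet z (dt \<phi> z) (dx \<phi> z) (dx (dx \<phi>) z) 0 w)\<bar>
            \<le> d / 2 * (fst w - fst z)\<^sup>2 + C * (snd w - snd z)\<^sup>2"
      using C2_expansion[OF _ open_cyl z] * by blast
    moreover have "\<forall>\<^sub>F w in nhds z. v w - \<phi> w \<ge> v z - \<phi> z" using * by blast
    ultimately have "touches (\<lambda>z. - v z) z (- dt \<phi> z) (- dx \<phi> z) (- dx (dx \<phi>) z + d) C"
      unfolding touches_def
    proof eventually_elim
      case (elim w)
      have "jet z (- dt \<phi> z) (- dx \<phi> z) (- dx (dx \<phi>) z + d) C w = - jet z (dt \<phi> z) (dx \<phi> z) (dx (dx \<phi>) z) 0 w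
         + (d / 2 * (fst w - fst z)\<^sup>2 + C * (snd w - snd z)\<^sup>2)"
        by (simp add: jet_def add_divide_distrib diff_divide_distrib distrib_right left_diff_distrib)
      then show ?case using elim by linarith
    qed
    then show "- dt \<phi> z + F (- dx \<phi> z) (- dx (dx \<phi>) z + d) \<le> 0"
      using assms(2) z by (intro vsubD[of "\<lambda>z. - v z"])
  qed
  then show "0 \<le> dt \<phi> z + F (dx \<phi> z) (dx (dx \<phi>) z)" by (simp add: F_op_minus)
qed

text \<open>A jet touching from above has the first derivatives of \<open>v\<close> and at least its
  second space derivative, and \<open>F\<close> decreases in its second argument.\<close>

lemma vsub_classical:
  assumes "\<And>x t. (x, t) \<in> cyl b \<Longrightarrow> ((\<lambda>s. v (x, s)) has_real_derivative vt x t) (at t)"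
    and "\<And>x t. (x, t) \<in> cyl b \<Longrightarrow> ((\<lambda>y. v (y, t)) has_real_derivative vx x t) (at x)"
    and "\<And>x t. (x, t) \<in> cyl b \<Longrightarrow> ((\<lambda>y. vx y t) has_real_derivative vxx x t) (at x)"
    and "\<And>x t. (x, t) \<in> cyl b \<Longrightarrow> vt x t + F (vx x t) (vxx x t) \<le> 0"
  shows "vsub v"
  unfolding vsub_def
proof (intro ballI allI impI)
  fix z a q Y C assume z: "z \<in> cyl b" and touch: "touches v z a q Y C"
  obtain x t where xt: "z = (x, t)" by force
  have "\<forall>\<^sub>F y in nhds x. y \<in> {-b<..<b}"
    using z by (intro eventually_nhds_in_open) (auto simp: cyl_def xt)
  then have "\<forall>\<^sub>F y in nhds x. ((\<lambda>y. v (y, t)) has_real_derivative vx y t) (at y)"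
    by eventually_elim (use z in \<open>auto simp: cyl_def xt intro: assms(2)\<close>)
  note td = touches_derivs[OF touch[unfolded xt] assms(1) this assms(3)]
  have "F q Y \<le> F q (vxx x t)" using td(3) z by (intro F_antimono) (auto simp: xt)
  then show "a + F q Y \<le> 0"
    using td(1,2) assms(4)[of x t] z by (simp add: xt)
qed

text \<open>Used both for the envelope of the Perron supremum and for the negated lower envelope of
  \<open>W\<close>; this is why \<open>e\<close> is described only by domination and approximation.
  Contacts of nearly optimal members with a strict parabola converge to \<open>z\<close>, and
  \<open>F\<close> is continuous.\<close>

lemma vsub_sup:
  assumes sub: "\<And>v. v \<in> \<F> \<Longrightarrow> usc_on (cyl b) v \<and> vsub v"
    and le: "\<And>v w. v \<in> \<F> \<Longrightarrow> w \<in> cyl b \<Longrightarrow> v w \<le> e w"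
    and approx: "\<And>z \<eta>. z \<in> cyl b \<Longrightarrow> \<eta> > 0 \<Longrightarrow> \<exists>w\<in>cyl b. dist z w < \<eta> \<and> (\<exists>v\<in>\<F>. e z - \<eta> < v w)"
  shows "vsub e"
  unfolding vsub_def
proof (intro ballI allI impI)
  fix z a q Y C assume z: "z \<in> cyl b" and touch: "touches e z a q Y C"
  show "a + F q Y \<le> 0"
  proof (rule F_le_limit)
    fix d :: real assume d: "d > 0"
    \<comment> \<open>Raising \<open>Y\<close> by \<open>d\<close> and \<open>C\<close> by d/2 adds
      exactly \<sigma> times the squared distance, which makes the contact strict.\<close>
    define \<sigma> where "\<sigma> = d / 2"
    have \<sigma>: "\<sigma> > 0" using d by (simp add: \<sigma>_def)
    have "\<forall>\<^sub>F w in nhds z. e w \<le> e z + jet z a q Y C w \<and> w \<in> cyl b"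
      using touch open_cyl z unfolding touches_def by (intro eventually_conj eventually_nhds_in_open)
    then obtain r' where r': "r' > 0" "\<And>w. dist w z < r' \<Longrightarrow> e w \<le> e z + jet z a q Y C w \<and> w \<in> cyl b"
      unfolding eventually_nhds_metric by auto
    define r where "r = r' / 2"
    have r: "r > 0" "\<And>w. w \<in> cball z r \<Longrightarrow> e w \<le> e z + jet z a q Y C w \<and> w \<in> cyl b"
      using r' by (auto simp: r_def dist_commute)
    define P where "P = jet z a q (Y + d) (C + \<sigma>)"
    have P: "P w = jet z a q Y C w + \<sigma> * (dist w z)\<^sup>2" for w
      by (simp add: P_def jet_def \<sigma>_def dist_prod_def dist_real_def field_simps)
    have contP: "continuous_on S P" for S unfolding P_def by (rule continuous_on_jet)
    \<comment> \<open>For a member within \<open>\<eta>\<close> of the envelope near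
      \<open>z\<close>, the extremum \<open>\<zeta>\<close> over the ball cannot be far: the strict
      term would exceed 2 \<eta>. It is therefore interior, and the recentred jet touches the member
      at \<open>\<zeta>\<close>.\<close>
    have key: "\<exists>\<zeta>\<in>cyl b. \<sigma> * (dist \<zeta> z)\<^sup>2 \<le> 2 * \<eta> \<and>
        a + 2 * (C + \<sigma>) * (snd \<zeta> - snd z) + F (q + (Y + d) * (fst \<zeta> - fst z)) (Y + d) \<le> 0"
      if \<eta>: "0 < \<eta>" "2 * \<eta> < \<sigma> * r\<^sup>2" for \<eta>
    proof -
      have "continuous (at z) P" using contP[of UNIV] continuous_on_eq_continuous_at[OF open_UNIV] by blast
      then obtain \<rho> where \<rho>: "\<rho> > 0" "\<And>w. dist w z < \<rho> \<Longrightarrow> dist (P w) (P z) < \<eta>"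
        unfolding continuous_at_eps_delta using \<eta> by (auto simp: dist_real_def)
      define \<eta>' where "\<eta>' = min \<eta> (min \<rho> r)"
      obtain w v where w: "w \<in> cyl b" "dist z w < \<eta>'" "v \<in> \<F>" "e z - \<eta>' < v w"
        using approx[OF z, of \<eta>'] \<eta> \<rho> r by (auto simp: \<eta>'_def)
      have usc: "usc_on (cball z r) v"
        using sub[OF w(3)] r(2) usc_on_subset[of "cyl b" v "cball z r"] by blast
      have "lsc_on (cball z r) (\<lambda>w. - v w + P w)"
        by (intro lsc_on_add_continuous lsc_on_uminus usc contP)
      from lsc_attains_min[OF compact_cball _ this]
      obtain \<zeta> where \<zeta>: "\<zeta> \<in> cball z r" "\<And>y. y \<in> cball z r \<Longrightarrow> - v \<zeta> + P \<zeta> \<le> - v y + P y"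
        using r by auto
      have "- v \<zeta> + P \<zeta> \<le> - v w + P w" using w by (intro \<zeta>) (auto simp: \<eta>'_def)
      also have "P w < \<eta>" using \<rho>(2)[of w] w(2) by (auto simp: \<eta>'_def dist_commute dist_real_def P_def)
      finally have 1: "e z - 2 * \<eta> \<le> v \<zeta> - P \<zeta>" using w(4) by (auto simp: \<eta>'_def)
      have "v \<zeta> \<le> e z + jet z a q Y C \<zeta>"
        using le[OF w(3), of \<zeta>] r(2)[OF \<zeta>(1)] by linarith
      with 1 have near: "\<sigma> * (dist \<zeta> z)\<^sup>2 \<le> 2 * \<eta>" unfolding P by linarith
      have "dist \<zeta> z < r"
      proof (rule ccontr)
        assume "\<not> dist \<zeta> z < r"
        then have "\<sigma> * r\<^sup>2 \<le> \<sigma> * (dist \<zeta> z)\<^sup>2" using \<sigma> r by (intro mult_left_mono power_mono) auto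
        with near \<eta> show False by simp
      qed
      then have "\<forall>\<^sub>F y in nhds \<zeta>. y \<in> ball z r"
        by (intro eventually_nhds_in_open) (auto simp: dist_commute)
      then have "touches v \<zeta> (a + 2 * (C + \<sigma>) * (snd \<zeta> - snd z)) (q + (Y + d) * (fst \<zeta> - fst z)) (Y + d) (C + \<sigma>)"
        unfolding touches_def
      proof eventually_elim
        case (elim y)
        then have "- v \<zeta> + P \<zeta> \<le> - v y + P y" by (intro \<zeta>) auto
        then show ?case unfolding P_def by (subst (asm) (2) jet_recenter[of _ _ _ _ _ _ \<zeta>]) linarith
      qed
      then have "a + 2 * (C + \<sigma>) * (snd \<zeta> - snd z) + F (q + (Y + d) * (fst \<zeta> - fst z)) (Y + d) \<le> 0"
        using sub[OF w(3)] r(2)[OF \<zeta>(1)] by (intro vsubD) auto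
      with near r(2)[OF \<zeta>(1)] show ?thesis by blast
    qed
    \<comment> \<open>Positive, small enough for \<open>key\<close>, and tending to 0.\<close>
    define \<eta> where "\<eta> n = \<sigma> * r\<^sup>2 / (4 * (real n + 1))" for n :: nat
    have \<eta>: "0 < \<eta> n" "2 * \<eta> n < \<sigma> * r\<^sup>2" for n
    proof -
      show "0 < \<eta> n" using \<sigma> r by (simp add: \<eta>_def)
      have "2 * \<eta> n = \<sigma> * r\<^sup>2 * (1 / (2 * (real n + 1)))" by (simp add: \<eta>_def field_simps)
      also have "\<dots> < \<sigma> * r\<^sup>2 * 1" using \<sigma> r by (intro mult_strict_left_mono) auto
      finally show "2 * \<eta> n < \<sigma> * r\<^sup>2" by simp
    qed
    obtain \<zeta> where \<zeta>: "\<And>n. \<sigma> * (dist (\<zeta> n) z)\<^sup>2 \<le> 2 * \<eta> n"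
      "\<And>n. a + 2 * (C + \<sigma>) * (snd (\<zeta> n) - snd z) + F (q + (Y + d) * (fst (\<zeta> n) - fst z)) (Y + d) \<le> 0"
      using key[OF \<eta>] by metis
    have upper: "(\<lambda>n. r\<^sup>2 / 2 * inverse (real (Suc n))) \<longlonglongrightarrow> 0"
      by (rule tendsto_mult_right_zero[OF LIMSEQ_inverse_real_of_nat])
    have bound: "(dist (\<zeta> n) z)\<^sup>2 \<le> r\<^sup>2 / 2 * inverse (real (Suc n))" for n
    proof -
      have "\<sigma> * (dist (\<zeta> n) z)\<^sup>2 \<le> \<sigma> * (r\<^sup>2 / 2 * inverse (real (Suc n)))"
        using \<zeta>(1)[of n] by (simp add: \<eta>_def field_simps)
      then show ?thesis using \<sigma> by simp
    qed
    have "(\<lambda>n. (dist (\<zeta> n) z)\<^sup>2) \<longlonglongrightarrow> 0"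
      by (rule tendsto_sandwich[OF _ _ tendsto_const upper])
        (intro always_eventually allI zero_le_power2 bound)+
    from tendsto_real_sqrt[OF this] have "\<zeta> \<longlonglongrightarrow> z"
      by (simp add: tendsto_dist_iff[of \<zeta>])
    then have lim: "(\<lambda>n. a + 2 * (C + \<sigma>) * (snd (\<zeta> n) - snd z) + F (q + (Y + d) * (fst (\<zeta> n) - fst z)) (Y + d))
        \<longlonglongrightarrow> a + 2 * (C + \<sigma>) * (snd z - snd z) + F (q + (Y + d) * (fst z - fst z)) (Y + d)"
      by (intro tendsto_intros tendsto_F)
    have "a + 2 * (C + \<sigma>) * (snd z - snd z) + F (q + (Y + d) * (fst z - fst z)) (Y + d) \<le> 0"
      using \<zeta>(2) by (intro LIMSEQ_le_const2[OF lim]) auto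
    then show "a + F q (Y + d) \<le> 0" by simp
  qed
qed

end

lemma usc_on_continuous: "continuous_on S h \<Longrightarrow> usc_on S (h :: 'a::topological_space \<Rightarrow> real)"
  unfolding usc_on_def continuous_on_def by (auto intro: order_tendstoD)

lemma cyl_subset: "cyl b \<subseteq> cyl0 b"
  by (auto simp: cyl_def cyl0_def)

lemma upper_env_finite:
  assumes "z \<in> cyl0 b" "usc_on (cyl0 b) W" "\<And>w. w \<in> cyl0 b \<Longrightarrow> u w \<le> W w"
  shows "\<bar>upper_env b u z\<bar> \<noteq> \<infinity>" "real_of_ereal (upper_env b u z) \<le> W z" "u z \<le> real_of_ereal (upper_env b u z)"
proof -
  have "upper_env b u z \<le> ereal (W z)"
    using upper_env_mono[of b u W z] assms upper_env_usc by metis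
  moreover have "ereal (u z) \<le> upper_env b u z" using assms(1) by (rule upper_env_ge)
  ultimately show "\<bar>upper_env b u z\<bar> \<noteq> \<infinity>" "real_of_ereal (upper_env b u z) \<le> W z" "u z \<le> real_of_ereal (upper_env b u z)"
    by (cases "upper_env b u z"; simp)+
qed

context equation begin

text \<open>As \<open>F\<close> is odd, super-solutions are treated as negatives of sub-solutions; \<open>neg_env u\<close> is the negative
  of the lower envelope of \<open>u\<close>.\<close>

abbreviation neg_env :: "(real \<times> real \<Rightarrow> real) \<Rightarrow> real \<times> real \<Rightarrow> real" where
  "neg_env u \<equiv> \<lambda>z. real_of_ereal (upper_env b (\<lambda>w. - u w) z)"

text \<open>\<open>u\<close> is the upper envelope of the supremum of all subsolutions below
  \<open>W\<close>. Upper semicontinuity of \<open>W\<close> keeps \<open>u\<close> below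
  \<open>W\<close>, so \<open>u\<close> is the largest of them. If the inequality for
  \<open>neg_env u\<close> failed, a small bump could be added to \<open>u\<close> below
  \<open>W\<close>, against maximality; where there is no room below \<open>W\<close>, the
  inequality for \<open>neg_env W\<close> takes over.\<close>

lemma perron:
  assumes W: "usc_on (cyl0 b) W"
    and w0: "continuous_on (cyl0 b) w0" "vsub w0" "\<And>z. z \<in> cyl0 b \<Longrightarrow> w0 z \<le> W z"
    and NW: "vsub (neg_env W)"
  shows "\<exists>u. usc_on (cyl0 b) u \<and> vsub u \<and> (\<forall>z\<in>cyl0 b. u z \<le> W z)
    \<and> (\<forall>v. usc_on (cyl0 b) v \<longrightarrow> vsub v \<longrightarrow> (\<forall>z\<in>cyl0 b. v z \<le> W z) \<longrightarrow> (\<forall>z\<in>cyl0 b. v z \<le> u z))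
    \<and> vsub (neg_env u)"
proof -
  define \<S> where "\<S> = {v. usc_on (cyl0 b) v \<and> vsub v \<and> (\<forall>z\<in>cyl0 b. v z \<le> W z)}"
  have w0S: "w0 \<in> \<S>" using w0 usc_on_continuous by (auto simp: \<S>_def)
  define s where "s z = (SUP v\<in>\<S>. v z)" for z
  have bdd: "bdd_above ((\<lambda>v. v z) ` \<S>)" if "z \<in> cyl0 b" for z
    using that by (intro bdd_aboveI[of _ "W z"]) (auto simp: \<S>_def)
  have le_s: "v z \<le> s z" if "v \<in> \<S>" "z \<in> cyl0 b" for v z
    unfolding s_def using that bdd by (intro cSUP_upper) auto
  have s_W: "s z \<le> W z" if "z \<in> cyl0 b" for z
    unfolding s_def using that w0S by (intro cSUP_least) (auto simp: \<S>_def)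
  define u where "u z = real_of_ereal (upper_env b s z)" for z
  have fin: "\<bar>upper_env b s z\<bar> \<noteq> \<infinity>" "u z \<le> W z" "s z \<le> u z" if "z \<in> cyl0 b" for z
    using upper_env_finite[OF that W s_W] by (auto simp: u_def)
  have usc_u: "usc_on (cyl0 b) u"
    unfolding u_def[abs_def] using fin(1) by (rule usc_upper_env)
  have vsub_u: "vsub u"
  proof (rule vsub_sup[of \<S>])
    fix v assume "v \<in> \<S>"
    then show "usc_on (cyl b) v \<and> vsub v"
      using usc_on_subset[OF _ cyl_subset] by (auto simp: \<S>_def)
  next
    fix v w assume "v \<in> \<S>" "w \<in> cyl b"
    then show "v w \<le> u w" using le_s[of v w] fin(3)[of w] cyl_subset[of b] by force
  next
    fix z and \<eta> :: real assume z: "z \<in> cyl b" and \<eta>: "\<eta> > 0"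
    have z0: "z \<in> cyl0 b" using z cyl_subset by blast
    obtain r where r: "r > 0" "ball z r \<subseteq> cyl b" using open_cyl z open_contains_ball by blast
    have "ereal (u z - \<eta>) < upper_env b s z"
      using fin(1)[OF z0] \<eta> unfolding u_def by (cases "upper_env b s z") auto
    then obtain w where w: "w \<in> cyl0 b" "dist z w < min \<eta> r" "u z - \<eta> < s w"
      using less_upper_envD[of _ b s z "min \<eta> r"] \<eta> r(1) by fastforce
    then obtain v where "v \<in> \<S>" "u z - \<eta> < v w"
      using less_cSUP_iff[OF _ bdd[OF w(1)]] w0S unfolding s_def by blast
    moreover have "w \<in> cyl b" using r(2) w(2) by auto
    ultimately show "\<exists>w\<in>cyl b. dist z w < \<eta> \<and> (\<exists>v\<in>\<S>. u z - \<eta> < v w)" using w(2) by auto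
  qed
  have max: "v z \<le> u z" if "usc_on (cyl0 b) v" "vsub v" "\<forall>z\<in>cyl0 b. v z \<le> W z" "z \<in> cyl0 b" for v z
    using le_s[of v z] fin(3)[of z] that by (force simp: \<S>_def)
  define N where "N z = neg_env u z" for z
  define M where "M z = neg_env W z" for z
  have usc_w0: "usc_on (cyl0 b) (\<lambda>z. - w0 z)"
    using w0 by (intro usc_on_continuous continuous_intros)
  have w0_u: "- u z \<le> - w0 z" "- W z \<le> - w0 z" if "z \<in> cyl0 b" for z
    using le_s[OF w0S that] fin(3)[OF that] w0(3)[OF that] by auto
  have N: "\<bar>upper_env b (\<lambda>w. - u w) z\<bar> \<noteq> \<infinity>" "- u z \<le> N z" if "z \<in> cyl0 b" for z
    using upper_env_finite[OF that usc_w0 w0_u(1)] by (auto simp: N_def)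
  have M: "\<bar>upper_env b (\<lambda>w. - W w) z\<bar> \<noteq> \<infinity>" if "z \<in> cyl0 b" for z
    using upper_env_finite[OF that usc_w0 w0_u(2)] by (auto simp: M_def)
  have M_N: "M z \<le> N z" if "z \<in> cyl0 b" for z
  proof -
    have "upper_env b (\<lambda>w. - W w) z \<le> upper_env b (\<lambda>w. - u w) z"
      using fin(2) by (intro upper_env_mono) auto
    then show ?thesis using N(1)[OF that] M[OF that] unfolding N_def M_def
      by (cases "upper_env b (\<lambda>w. - W w) z"; cases "upper_env b (\<lambda>w. - u w) z") auto
  qed
  have "vsub N"
    unfolding vsub_def
  proof (intro ballI allI impI, rule ccontr)
    fix z a q Y C assume z: "z \<in> cyl b" and touch: "touches N z a q Y C" and "\<not> a + F q Y \<le> 0"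
    then have pos: "a + F q Y > 0" by simp
    have z0: "z \<in> cyl0 b" using z cyl_subset by blast
    have ev_cyl: "\<forall>\<^sub>F w in nhds z. w \<in> cyl b" using z open_cyl by (intro eventually_nhds_in_open)
    \<comment> \<open>If the two lower envelopes agreed at \<open>z\<close>, the parabola would also
      touch \<open>neg_env W\<close> there, whose inequality is assumed. Hence there is room for a
      bump.\<close>
    have "M z \<noteq> N z"
    proof
      assume eq: "M z = N z"
      have "touches M z a q Y C"
        using touch ev_cyl unfolding touches_def
      proof eventually_elim
        case (elim w)
        then show ?case using M_N[of w] cyl_subset[of b] eq by force
      qed
      then have "a + F q Y \<le> 0" using NW z unfolding M_def[abs_def] by (intro vsubD)
      with pos show False by simp
    qed
    \<comment> \<open>A quarter of the room below \<open>W\<close>: one share each for the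
      semicontinuity of \<open>W\<close>, for the variation of \<open>J\<close>, for the lift
      \<open>\<kappa>\<close>, and for strictness.\<close>
    define \<eta> where "\<eta> = (N z - M z) / 4"
    have \<eta>: "\<eta> > 0" using \<open>M z \<noteq> N z\<close> M_N[OF z0] by (simp add: \<eta>_def)
    have "((\<lambda>d. a + F q (Y + 2 * d)) \<longlongrightarrow> a + F q (Y + 2 * 0)) (at_right 0)"
      by (intro tendsto_intros tendsto_F)
    then have "\<forall>\<^sub>F d in at_right 0. a + F q (Y + 2 * d) > 0"
      using pos by (intro order_tendstoD(1)) auto
    then have "\<forall>\<^sub>F d in at_right 0. a + F q (Y + 2 * d) > 0 \<and> d > 0"
      using eventually_at_right_less by (rule eventually_conj)
    \<comment> \<open>The violated inequality leaves slack to open the parabola and still violate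
      it.\<close>
    then obtain \<sigma> where \<sigma>: "a + F q (Y + 2 * \<sigma>) > 0" "\<sigma> > 0"
      using eventually_happens' trivial_limit_at_right_real by blast
    define J where "J = jet z a q (Y + 2 * \<sigma>) (C + \<sigma>)"
    have J: "J w = jet z a q Y C w + \<sigma> * (dist w z)\<^sup>2" for w
      by (simp add: J_def jet_def dist_prod_def dist_real_def field_simps)
    have limJ: "(J \<longlongrightarrow> 0) (nhds z)"
    proof -
      have "isCont J z"
        using continuous_on_jet continuous_on_eq_continuous_at[OF open_UNIV] unfolding J_def by blast
      moreover have "J z = 0" by (simp add: J_def)
      ultimately show ?thesis unfolding isCont_def tendsto_at_iff_tendsto_nhds by simp
    qed
    define aQ where "aQ w = a + 2 * (C + \<sigma>) * (snd w - snd z)" for w :: "real \<times> real"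
    define qQ where "qQ w = q + (Y + 2 * \<sigma>) * (fst w - fst z)" for w :: "real \<times> real"
    have "((\<lambda>w. aQ w + F (qQ w) (Y + 2 * \<sigma>)) \<longlongrightarrow> (a + 2 * (C + \<sigma>) * (snd z - snd z)) + F (q + (Y + 2 * \<sigma>) * (fst z - fst z)) (Y + 2 * \<sigma>)) (nhds z)"
      unfolding aQ_def qQ_def by (intro tendsto_intros tendsto_F filterlim_ident)
    then have evQ: "\<forall>\<^sub>F w in nhds z. aQ w + F (qQ w) (Y + 2 * \<sigma>) > 0"
      using \<sigma>(1) by (intro order_tendstoD(1)) auto
    have "upper_env b (\<lambda>w. - W w) z < ereal (M z + \<eta>)"
      using M[OF z0] \<eta> unfolding M_def by (cases "upper_env b (\<lambda>w. - W w) z") auto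
    from upper_env_lessD[OF this] obtain \<rho> where \<rho>: "\<rho> > 0" "\<And>w. w \<in> cyl0 b \<Longrightarrow> dist z w < \<rho> \<Longrightarrow> - W w < M z + \<eta>"
      by auto
    have evJ: "\<forall>\<^sub>F w in nhds z. - \<eta> < J w" using \<eta> by (intro order_tendstoD(1)[OF limJ]) auto
    have "\<forall>\<^sub>F w in nhds z. w \<in> ball z \<rho>" using \<rho>(1) by (intro eventually_nhds_in_open) auto
    then have "\<forall>\<^sub>F w in nhds z. w \<in> cyl b \<and> - W w < M z + \<eta> \<and> N w \<le> N z + jet z a q Y C w
        \<and> - \<eta> < J w \<and> aQ w + F (qQ w) (Y + 2 * \<sigma>) > 0"
      using ev_cyl touch[unfolded touches_def] evJ evQ
    proof eventually_elim
      case (elim w)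
      then show ?case using \<rho>(2)[of w] cyl_subset[of b] by auto
    qed
    then obtain r where r: "r > 0" "\<And>w. dist w z < r \<Longrightarrow> w \<in> cyl b \<and> - W w < M z + \<eta> \<and> N w \<le> N z + jet z a q Y C w
        \<and> - \<eta> < J w \<and> aQ w + F (qQ w) (Y + 2 * \<sigma>) > 0"
      unfolding eventually_nhds_metric by blast
    \<comment> \<open>By \<sigma> (r/2)^2 \<ge> 2 \<kappa> the lifted parabola is already below
      \<open>u\<close> on the outer half of the ball, so the maximum glues with
      \<open>u\<close>.\<close>
    define \<kappa> where "\<kappa> = min \<eta> (\<sigma> * r\<^sup>2 / 8)"
    have \<kappa>: "\<kappa> > 0" "\<kappa> \<le> \<eta>" "\<kappa> \<le> \<sigma> * r\<^sup>2 / 8" using \<eta> \<sigma> r by (auto simp: \<kappa>_def)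
    \<comment> \<open>Without \<open>\<kappa>\<close> it touches the lower envelope of
      \<open>u\<close> from below at \<open>z\<close>. Since \<open>F\<close> is odd, the violated
      inequality makes it a strict classical subsolution.\<close>
    define Q where "Q w = \<kappa> - N z - J w" for w
    have contQ: "continuous_on S Q" for S
      unfolding Q_def J_def by (intro continuous_intros continuous_on_jet)
    have Q_W: "Q w < W w" if "dist w z < r" for w
    proof -
      have "N z = M z + 4 * \<eta>" by (simp add: \<eta>_def field_simps)
      then show ?thesis using r(2)[OF that] \<kappa>(2) \<eta> unfolding Q_def by linarith
    qed
    have Q_u: "Q w < u w" if w: "dist w z < r" "r / 2 \<le> dist w z" for w
    proof -
      have "(r / 2)\<^sup>2 \<le> (dist w z)\<^sup>2" using w r(1) by (intro power_mono) auto
      then have "\<sigma> * (r / 2)\<^sup>2 \<le> \<sigma> * (dist w z)\<^sup>2" using \<sigma>(2) by (intro mult_left_mono) auto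
      then have "2 * \<kappa> \<le> \<sigma> * (dist w z)\<^sup>2" using \<kappa>(3) by (simp add: power_divide)
      moreover have "w \<in> cyl0 b" "N w \<le> N z + jet z a q Y C w" using r(2)[OF w(1)] cyl_subset by auto
      ultimately show ?thesis using N(2)[of w] \<kappa>(1) unfolding Q_def J by linarith
    qed
    define v where "v w = (if dist w z < r then max (u w) (Q w) else u w)" for w
    have v_le: "v w \<le> max (u w) (Q w)" "u w \<le> v w" for w by (auto simp: v_def)
    have v_u: "v w = u w" if "r / 2 \<le> dist w z" for w
      using Q_u[of w] that by (auto simp: v_def)
    have far: "\<forall>\<^sub>F y in nhds w. v y = u y" if "r \<le> dist w z" for w
    proof -
      have "\<forall>\<^sub>F y in nhds w. y \<in> - cball z (r / 2)"
        using that r(1) by (intro eventually_nhds_in_open) (auto simp: dist_commute)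
      then show ?thesis by eventually_elim (auto intro: v_u simp: dist_commute)
    qed
    have "usc_on (cyl0 b) v"
      unfolding usc_on_def
    proof (intro ballI allI impI)
      fix w A assume w: "w \<in> cyl0 b" and A: "v w < A"
      have ev_u: "\<forall>\<^sub>F y in at w within cyl0 b. u y < A"
        using usc_u w A v_le(2)[of w] by (force simp: usc_on_def)
      show "\<forall>\<^sub>F y in at w within cyl0 b. v y < A"
      proof (cases "dist w z < r")
        case True
        then have "Q w < A" using A by (auto simp: v_def)
        then have "\<forall>\<^sub>F y in at w within cyl0 b. Q y < A"
          using usc_on_continuous[OF contQ] w by (auto simp: usc_on_def)
        with ev_u show ?thesis by eventually_elim (auto intro: le_less_trans[OF v_le(1)])
      next
        case False
        then have "\<forall>\<^sub>F y in at w within cyl0 b. v y = u y"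
          using far[of w] by (auto simp: eventually_at_filter elim: eventually_mono)
        with ev_u show ?thesis by eventually_elim auto
      qed
    qed
    moreover have "vsub v"
      unfolding vsub_def
    proof (intro ballI allI impI)
      fix \<zeta> a' q' Y' C' assume \<zeta>: "\<zeta> \<in> cyl b" and touch': "touches v \<zeta> a' q' Y' C'"
      show "a' + F q' Y' \<le> 0"
      proof (cases "v \<zeta> = u \<zeta>")
        case True
        have "touches u \<zeta> a' q' Y' C'"
          using touch' unfolding touches_def True
          by eventually_elim (use v_le(2) in \<open>auto intro: order_trans\<close>)
        then show ?thesis using vsub_u \<zeta> by (intro vsubD)
      next
        case False
        then have near: "dist \<zeta> z < r" "v \<zeta> = Q \<zeta>" by (auto simp: v_def max_def split: if_splits)
        have "\<forall>\<^sub>F y in nhds \<zeta>. y \<in> ball z r" using near by (intro eventually_nhds_in_open) (auto simp: dist_commute)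
        then have touchQ: "touches Q \<zeta> a' q' Y' C'"
          using touch' unfolding touches_def near(2)
          by eventually_elim (auto simp: v_def dist_commute)
        obtain x t where xt: "\<zeta> = (x, t)" by force
        have Q: "Q (y, s) = \<kappa> - N z - (a * (s - snd z) + q * (y - fst z) + (Y + 2 * \<sigma>) / 2 * (y - fst z)\<^sup>2 + (C + \<sigma>) * (s - snd z)\<^sup>2)" for y s
          by (simp add: Q_def J_def jet_def)
        have D1: "((\<lambda>s. Q (x, s)) has_real_derivative - aQ \<zeta>) (at t)"
          unfolding Q by (auto intro!: derivative_eq_intros simp: aQ_def xt algebra_simps)
        have D2: "\<forall>\<^sub>F y in nhds x. ((\<lambda>y. Q (y, t)) has_real_derivative - qQ (y, t)) (at y)"
          unfolding Q qQ_def by (intro always_eventually allI) (auto intro!: derivative_eq_intros)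
        have D3: "((\<lambda>y. - qQ (y, t)) has_real_derivative - (Y + 2 * \<sigma>)) (at x)"
          unfolding qQ_def by (auto intro!: derivative_eq_intros)
        note d = touches_derivs[OF touchQ[unfolded xt] D1 D2 D3, folded xt]
        have "F q' Y' \<le> F (- qQ \<zeta>) (- (Y + 2 * \<sigma>))"
          using d(2,3) by (simp add: F_antimono)
        also have "\<dots> = - F (qQ \<zeta>) (Y + 2 * \<sigma>)" by (rule F_op_minus)
        finally show ?thesis using d(1) r(2)[OF near(1)] by linarith
      qed
    qed
    moreover have "\<forall>w\<in>cyl0 b. v w \<le> W w"
      using fin(2) Q_W by (auto simp: v_def less_imp_le)
    ultimately have v_max: "v w \<le> u w" if "w \<in> cyl0 b" for w using max that by blast
    \<comment> \<open>Maximality forces Q \<le> u near \<open>z\<close>, which lifts the lower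
      envelope of \<open>u\<close> at \<open>z\<close> by \<kappa>/2 above its own value.\<close>
    have "\<forall>\<^sub>F w in nhds z. J w < \<kappa> / 2 \<and> dist w z < r"
    proof (intro eventually_conj order_tendstoD(2)[OF limJ])
      have "\<forall>\<^sub>F w in nhds z. w \<in> ball z r" using r(1) by (intro eventually_nhds_in_open) auto
      then show "\<forall>\<^sub>F w in nhds z. dist w z < r" by eventually_elim (simp add: dist_commute)
    qed (use \<kappa> in auto)
    then obtain r2 where r2: "r2 > 0" "\<And>w. dist w z < r2 \<Longrightarrow> J w < \<kappa> / 2 \<and> dist w z < r"
      unfolding eventually_nhds_metric by blast
    have "upper_env b (\<lambda>w. - u w) z \<le> ereal (N z - \<kappa> / 2)"
    proof (rule upper_env_leI[OF r2(1)])
      fix w assume w: "w \<in> cyl0 b" "dist z w < r2"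
      then have "J w < \<kappa> / 2" "dist w z < r" using r2(2)[of w] by (auto simp: dist_commute)
      then have "Q w \<le> u w" using v_max[OF w(1)] by (auto simp: v_def)
      then show "ereal (- u w) \<le> ereal (N z - \<kappa> / 2)" using \<open>J w < \<kappa> / 2\<close> by (simp add: Q_def)
    qed
    then show False using N(1)[OF z0] \<kappa>(1) unfolding N_def by (cases "upper_env b (\<lambda>w. - u w) z") auto
  qed
  then show ?thesis
    using usc_u vsub_u fin(2) max unfolding N_def[abs_def] by (intro exI[of _ u]) blast
qed

end

section \<open>Barriers and existence\<close>

lemma continuous_abs_bound:
  fixes h :: "real \<Rightarrow> real"
  assumes "continuous_on {l..r} h"
  shows "\<exists>B\<ge>0. \<forall>x\<in>{l..r}. \<bar>h x\<bar> \<le> B"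
proof -
  have "bounded (h ` {l..r})"
    using assms by (intro compact_imp_bounded compact_continuous_image) auto
  then obtain B where "\<forall>x\<in>{l..r}. \<bar>h x\<bar> \<le> B" unfolding bounded_iff by auto
  then show ?thesis by (intro exI[of _ "max B 0"]) auto
qed

text \<open>For t \<le> 1 the power is at most \<open>t\<close> because q \<ge> 1; for larger
  \<open>t\<close> one term of the exponential series of degree at least \<open>q\<close> suffices.
  It compares the time growth of the upper and the lateral lower barriers.\<close>

lemma power_le_exp:
  fixes q :: real
  assumes "q \<ge> 1"
  shows "\<exists>c>0. \<forall>t\<ge>0. c * t powr q \<le> exp t - 1"
proof -
  define n where "n = nat \<lceil>q\<rceil>"
  have n: "n > 0" "q \<le> n" using assms real_nat_ceiling_ge[of q] by (auto simp: n_def)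
  have "1 / fact n * t powr q \<le> exp t - 1" if "t \<ge> 0" for t :: real
  proof (cases "t \<le> 1")
    case True
    have "t powr q \<le> t"
    proof (cases "t = 0")
      case False
      then have "t powr q \<le> t powr 1" using True that assms by (intro powr_mono') auto
      then show ?thesis using that by simp
    qed simp
    also have "t \<le> exp t - 1" using exp_ge_add_one_self[of t] by linarith
    finally have "t powr q \<le> exp t - 1" .
    moreover have "1 / fact n * t powr q \<le> 1 * t powr q"
      by (intro mult_right_mono) (auto simp: fact_ge_1)
    ultimately show ?thesis by simp
  next
    case False
    then have "t powr q \<le> t powr n" using n by (intro powr_mono) auto
    then have "t powr q \<le> t ^ n" using False by (simp add: powr_realpow)
    then have "1 / fact n * t powr q \<le> t ^ n / fact n" by (simp add: divide_right_mono)
    also have "\<dots> \<le> exp t - 1"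
    proof -
      have "(\<Sum>k\<in>{0, n}. t ^ k /\<^sub>R fact k) \<le> (\<Sum>k. t ^ k /\<^sub>R fact k)"
        using that by (intro sum_le_suminf summable_exp_generic) auto
      then show ?thesis using n by (simp add: exp_def field_simps)
    qed
    finally show ?thesis .
  qed
  then show ?thesis by (intro exI[of _ "1 / fact n"]) auto
qed

section \<open>Spatial profiles that blow up at both ends\<close>

context equation begin

text \<open>A smooth substitute, up to constants, for the inverse distance to the nearer
  endpoint.\<close>

definition wt :: "real \<Rightarrow> real" where
  "wt x = inverse (b\<^sup>2 - x\<^sup>2)"

lemma wt_arg_pos:
  assumes "x \<in> {-b<..<b}"
  shows "b\<^sup>2 - x\<^sup>2 > 0"
proof -
  have "b\<^sup>2 - x\<^sup>2 = (b - x) * (b + x)" by (simp add: power2_eq_square algebra_simps)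
  then show ?thesis using assms by auto
qed

lemma wt_pos: "x \<in> {-b<..<b} \<Longrightarrow> wt x > 0"
  using wt_arg_pos by (simp add: wt_def)

lemma wt_ge: "x \<in> {-b<..<b} \<Longrightarrow> inverse (b\<^sup>2) \<le> wt x"
  using wt_arg_pos[of x] unfolding wt_def by (intro le_imp_inverse_le) auto

lemma wt_powr_mono:
  assumes "x \<in> {-b<..<b}" "s \<le> s'"
  shows "wt x powr s \<le> inverse (b\<^sup>2) powr (s - s') * wt x powr s'"
proof -
  have "wt x powr s = wt x powr (s - s') * wt x powr s'" by (simp flip: powr_add)
  also have "\<dots> \<le> inverse (b\<^sup>2) powr (s - s') * wt x powr s'"
    using assms wt_ge[OF assms(1)] b_pos by (intro mult_right_mono powr_mono2') auto
  finally show ?thesis .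
qed

lemma wt_power: "x \<in> {-b<..<b} \<Longrightarrow> wt x ^ n = wt x powr real n"
  using wt_pos by (simp add: powr_realpow)

lemma DERIV_wt_power:
  assumes "x \<in> {-b<..<b}"
  shows "((\<lambda>x. wt x ^ n) has_real_derivative 2 * real n * x * wt x ^ (n + 1)) (at x)"
proof -
  have "(wt has_real_derivative 2 * x * (wt x)\<^sup>2) (at x)"
    unfolding wt_def[abs_def] using wt_arg_pos[OF assms]
    by (auto intro!: derivative_eq_intros simp: power2_eq_square)
  from DERIV_power[OF this, of n] show ?thesis
    by (cases n) (auto simp: algebra_simps power2_eq_square)
qed

text \<open>Profile of the upper barrier centred at \<open>y\<close>: minimum 1 at \<open>y\<close>,
  where the barrier must nearly meet the datum, and growth of order wt^m at both ends.
  \<open>G1\<close> and \<open>G2\<close> are its space derivatives.\<close>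

definition G0 :: "nat \<Rightarrow> real \<Rightarrow> real \<Rightarrow> real" where
  "G0 m y x = 1 + (x - y)\<^sup>2 * wt x ^ m"

definition G1 :: "nat \<Rightarrow> real \<Rightarrow> real \<Rightarrow> real" where
  "G1 m y x = 2 * (x - y) * wt x ^ m + (x - y)\<^sup>2 * (2 * real m * x * wt x ^ (m + 1))"

definition G2 :: "nat \<Rightarrow> real \<Rightarrow> real \<Rightarrow> real" where
  "G2 m y x = 2 * wt x ^ m + 2 * (x - y) * (2 * real m * x * wt x ^ (m + 1))
     + (2 * (x - y) * (2 * real m * x * wt x ^ (m + 1))
        + (x - y)\<^sup>2 * (2 * real m * wt x ^ (m + 1) + 2 * real m * x * (2 * (real m + 1) * x * wt x ^ (m + 2))))"

lemma DERIV_G0: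
  assumes "x \<in> {-b<..<b}"
  shows "(G0 m y has_real_derivative G1 m y x) (at x)"
proof -
  have 1: "((\<lambda>x. (x - y)\<^sup>2) has_real_derivative 2 * (x - y)) (at x)"
    by (auto intro!: derivative_eq_intros)
  show ?thesis
    unfolding G0_def[abs_def] G1_def
    using DERIV_add[OF DERIV_const[of 1] DERIV_mult[OF 1 DERIV_wt_power[OF assms]]]
    by (simp add: mult_ac)
qed

lemma DERIV_G1:
  assumes "x \<in> {-b<..<b}"
  shows "(G1 m y has_real_derivative G2 m y x) (at x)"
proof -
  have 1: "((\<lambda>x. 2 * (x - y)) has_real_derivative 2) (at x)"
    by (auto intro!: derivative_eq_intros)
  have 2: "((\<lambda>x. (x - y)\<^sup>2) has_real_derivative 2 * (x - y)) (at x)"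
    by (auto intro!: derivative_eq_intros)
  have 3: "((\<lambda>x. 2 * real m * x) has_real_derivative 2 * real m) (at x)"
    by (auto intro!: derivative_eq_intros)
  have 4: "((\<lambda>x. 2 * real m * x * wt x ^ (m + 1)) has_real_derivative
      2 * real m * wt x ^ (m + 1) + 2 * (real m + 1) * x * wt x ^ (m + 2) * (2 * real m * x)) (at x)"
    using DERIV_mult[OF 3 DERIV_wt_power[OF assms, of "m + 1"]] by (simp add: add.commute)
  show ?thesis
    unfolding G1_def[abs_def] G2_def
    using DERIV_add[OF DERIV_mult[OF 1 DERIV_wt_power[OF assms, of m]] DERIV_mult[OF 2 4]]
    by (rule DERIV_cong) (simp add: algebra_simps)
qed

text \<open>Once the leading power of \<open>wt\<close> is split off, the other factor is a
  polynomial, hence bounded on the closed interval; this gives the orders m, m + 1 and m +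
  2.\<close>

lemma G_factor:
  assumes x: "x \<in> {-b<..<b}"
  shows "G0 m y x = wt x ^ m * ((b\<^sup>2 - x\<^sup>2) ^ m + (x - y)\<^sup>2)"
    "G1 m y x = wt x ^ (m + 1) * (2 * (x - y) * (b\<^sup>2 - x\<^sup>2) + (x - y)\<^sup>2 * (2 * real m * x))"
    "G2 m y x = wt x ^ (m + 2) * (2 * (b\<^sup>2 - x\<^sup>2)\<^sup>2 + 2 * (x - y) * (2 * real m * x * (b\<^sup>2 - x\<^sup>2))
      + (2 * (x - y) * (2 * real m * x * (b\<^sup>2 - x\<^sup>2))
        + (x - y)\<^sup>2 * (2 * real m * (b\<^sup>2 - x\<^sup>2) + 2 * real m * x * (2 * (real m + 1) * x))))"
proof -
  define w where "w = wt x"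
  define D where "D = b\<^sup>2 - x\<^sup>2"
  have wD: "w * D = 1" using wt_arg_pos[OF x] by (simp add: w_def D_def wt_def)
  then have 1: "w ^ m * D ^ m = 1" by (simp flip: power_mult_distrib)
  have "w ^ (m + 1) * D = w ^ m * (w * D)" "w ^ (m + 2) * D = w ^ (m + 1) * (w * D)"
      "w ^ (m + 2) * D\<^sup>2 = w ^ m * (w * D) * (w * D)"
    by (simp_all add: power2_eq_square)
  then have 2: "w ^ (m + 1) * D = w ^ m" "w ^ (m + 2) * D = w ^ (m + 1)" "w ^ (m + 2) * D\<^sup>2 = w ^ m"
    unfolding wD by simp_all
  show "G0 m y x = wt x ^ m * ((b\<^sup>2 - x\<^sup>2) ^ m + (x - y)\<^sup>2)"
    unfolding G0_def w_def[symmetric] D_def[symmetric] using 1 by (simp add: distrib_left mult.commute)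
  show "G1 m y x = wt x ^ (m + 1) * (2 * (x - y) * (b\<^sup>2 - x\<^sup>2) + (x - y)\<^sup>2 * (2 * real m * x))"
    unfolding G1_def w_def[symmetric] D_def[symmetric] 2(1)[symmetric] by (simp only: distrib_left mult_ac)
  show "G2 m y x = wt x ^ (m + 2) * (2 * (b\<^sup>2 - x\<^sup>2)\<^sup>2 + 2 * (x - y) * (2 * real m * x * (b\<^sup>2 - x\<^sup>2))
      + (2 * (x - y) * (2 * real m * x * (b\<^sup>2 - x\<^sup>2))
        + (x - y)\<^sup>2 * (2 * real m * (b\<^sup>2 - x\<^sup>2) + 2 * real m * x * (2 * (real m + 1) * x))))"
    unfolding G2_def w_def[symmetric] D_def[symmetric] 2(2)[symmetric] 2(3)[symmetric]
    by (simp only: distrib_left mult_ac)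
qed

text \<open>The polynomial factor is positive on the closed interval: inside by its first term, at
  the ends because \<open>y\<close> is interior. Compactness gives \<open>c\<close>.\<close>

lemma G0_lower:
  assumes y: "y \<in> {-b<..<b}"
  shows "\<exists>c>0. \<forall>x\<in>{-b<..<b}. c * wt x ^ m \<le> G0 m y x"
proof -
  let ?h = "\<lambda>x::real. (b\<^sup>2 - x\<^sup>2) ^ m + (x - y)\<^sup>2"
  have "continuous_on {-b..b} ?h" by (intro continuous_intros)
  then obtain x0 where x0: "x0 \<in> {-b..b}" "\<And>x. x \<in> {-b..b} \<Longrightarrow> ?h x0 \<le> ?h x"
    using continuous_attains_inf[of "{-b..b}" ?h] b_pos by auto
  have "?h x0 > 0"
  proof (cases "x0 \<in> {-b<..<b}")
    case True
    then have "(b\<^sup>2 - x0\<^sup>2) ^ m > 0" using wt_arg_pos by simp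
    then show ?thesis by (simp add: add_pos_nonneg)
  next
    case False
    then have "x0 = b \<or> x0 = - b" using x0(1) by auto
    then have "b\<^sup>2 - x0\<^sup>2 = 0" "x0 - y \<noteq> 0" using y by auto
    then have "(b\<^sup>2 - x0\<^sup>2) ^ m \<ge> 0" "(x0 - y)\<^sup>2 > 0" by auto
    then show ?thesis by linarith
  qed
  moreover have "?h x0 * wt x ^ m \<le> G0 m y x" if "x \<in> {-b<..<b}" for x
  proof -
    have "wt x ^ m * ?h x0 \<le> wt x ^ m * ?h x"
      using that wt_pos[OF that] by (intro mult_left_mono x0(2)) auto
    then show ?thesis unfolding G_factor(1)[OF that] by (simp add: mult.commute)
  qed
  ultimately show ?thesis by blast
qed

text \<open>Slope of order wt^(m+1) and curvature of order wt^(m+2) give the speed wt^(\<beta>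
  ((m+1)(p-1)+1)); the condition on \<open>m\<close> says that this is no more singular than
  \<open>G0\<close>. The factor a^(\<beta> (p-1)) is at most \<open>a\<close>, so \<open>L\<close>
  is uniform in the amplitude.\<close>

lemma G_growth:
  assumes y: "y \<in> {-b<..<b}" and m: "\<beta> * ((real m + 1) * (p - 1) + 1) \<le> m" and \<theta>: "\<beta> * (p - 1) \<le> 1"
  shows "\<exists>L\<ge>1. \<forall>x\<in>{-b<..<b}. \<forall>a\<ge>1. f (g (a * G1 m y x) * (a * G2 m y x)) \<le> L * a * G0 m y x"
proof -
  obtain c where c: "c > 0" "\<And>x. x \<in> {-b<..<b} \<Longrightarrow> c * wt x ^ m \<le> G0 m y x"
    using G0_lower[OF y] by blast
  let ?h1 = "\<lambda>x::real. 2 * (x - y) * (b\<^sup>2 - x\<^sup>2) + (x - y)\<^sup>2 * (2 * real m * x)"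
  let ?h2 = "\<lambda>x::real. 2 * (b\<^sup>2 - x\<^sup>2)\<^sup>2 + 2 * (x - y) * (2 * real m * x * (b\<^sup>2 - x\<^sup>2))
      + (2 * (x - y) * (2 * real m * x * (b\<^sup>2 - x\<^sup>2))
        + (x - y)\<^sup>2 * (2 * real m * (b\<^sup>2 - x\<^sup>2) + 2 * real m * x * (2 * (real m + 1) * x)))"
  have "continuous_on {-b..b} ?h1" by (intro continuous_intros)
  from continuous_abs_bound[OF this]
  obtain B1 where B1: "B1 \<ge> 0" "\<forall>x\<in>{-b..b}. \<bar>?h1 x\<bar> \<le> B1" by blast
  have "continuous_on {-b..b} ?h2" by (intro continuous_intros)
  from continuous_abs_bound[OF this]
  obtain B2 where B2: "B2 \<ge> 0" "\<forall>x\<in>{-b..b}. \<bar>?h2 x\<bar> \<le> B2" by blast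
  \<comment> \<open>The last entry, together with wt \<ge> b^(-2), makes the slope bound at least 1,
    as required by \<open>g_upper\<close>.\<close>
  define C where "C = max (max B1 B2) ((b\<^sup>2) ^ (m + 1))"
  have C: "C > 0" "B1 \<le> C" "B2 \<le> C" "(b\<^sup>2) ^ (m + 1) \<le> C"
    using b_pos by (auto simp: C_def less_max_iff_disj)
  define A where "A = (p - 1 + \<epsilon>) * C powr (p - 1)"
  have A: "A > 0" using C p_ge \<epsilon>_pos by (simp add: A_def)
  define s where "s = \<beta> * ((real m + 1) * (p - 1) + 1)"
  define L0 where "L0 = A powr \<beta> * inverse (b\<^sup>2) powr (s - m) / c"
  have "f (g (a * G1 m y x) * (a * G2 m y x)) \<le> max 1 L0 * a * G0 m y x"
    if x: "x \<in> {-b<..<b}" and a: "a \<ge> 1" for x a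
  proof -
    have x': "x \<in> {-b..b}" using x by auto
    define w where "w = wt x"
    have w: "w > 0" using wt_pos[OF x] by (simp add: w_def)
    have g1: "\<bar>a * G1 m y x\<bar> \<le> a * C * w ^ (m + 1)"
    proof -
      have "\<bar>?h1 x\<bar> \<le> C" using bspec[OF B1(2) x'] C(2) by linarith
      then have "\<bar>w ^ (m + 1) * ?h1 x\<bar> \<le> w ^ (m + 1) * C"
        using w unfolding abs_mult by (intro mult_mono) auto
      then have "a * \<bar>w ^ (m + 1) * ?h1 x\<bar> \<le> a * (w ^ (m + 1) * C)" using a by (intro mult_left_mono) auto
      then show ?thesis unfolding G_factor(2)[OF x] w_def[symmetric] using a by (simp add: abs_mult mult_ac)
    qed
    have g2: "a * G2 m y x \<le> a * C * w ^ (m + 2)"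
    proof -
      have "?h2 x \<le> C" using bspec[OF B2(2) x'] C(3) by linarith
      then have "w ^ (m + 2) * ?h2 x \<le> w ^ (m + 2) * C" using w by (intro mult_left_mono) auto
      then have "a * (w ^ (m + 2) * ?h2 x) \<le> a * (w ^ (m + 2) * C)"
        by (rule mult_left_mono) (use a in simp)
      then show ?thesis unfolding G_factor(3)[OF x] w_def[symmetric] by (simp only: mult_ac)
    qed
    define r where "r = a * C * w ^ (m + 1)"
    have r1: "r \<ge> 1"
    proof -
      have "inverse (b\<^sup>2) ^ (m + 1) \<le> w ^ (m + 1)"
        unfolding w_def using wt_ge[OF x] b_pos by (intro power_mono) auto
      then have "(b\<^sup>2) ^ (m + 1) * inverse (b\<^sup>2) ^ (m + 1) \<le> C * w ^ (m + 1)"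
        using C b_pos by (intro mult_mono) auto
      moreover have "(b\<^sup>2) ^ (m + 1) * inverse (b\<^sup>2) ^ (m + 1) = 1"
        unfolding power_mult_distrib[symmetric] using b_pos by simp
      ultimately have Cw: "1 \<le> C * w ^ (m + 1)" by simp
      then have "1 * 1 \<le> a * (C * w ^ (m + 1))" using a by (intro mult_mono) auto
      then show ?thesis by (simp add: r_def mult.assoc)
    qed
    have "g (a * G1 m y x) \<le> (p - 1 + \<epsilon>) * r powr (p - 2)"
      using g1 r1 unfolding r_def by (intro g_upper)
    then have "g (a * G1 m y x) * (a * C * w ^ (m + 2)) \<le> (p - 1 + \<epsilon>) * r powr (p - 2) * (a * C * w ^ (m + 2))"
      using a C w by (intro mult_right_mono) auto
    moreover have "g (a * G1 m y x) * (a * G2 m y x) \<le> g (a * G1 m y x) * (a * C * w ^ (m + 2))"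
      using g2 g_pos[of "a * G1 m y x"] by (intro mult_left_mono) auto
    moreover have "(p - 1 + \<epsilon>) * r powr (p - 2) * (a * C * w ^ (m + 2)) = (p - 1 + \<epsilon>) * (r powr (p - 1) * w)"
    proof -
      have "a * C * w ^ (m + 2) = r * w" by (simp add: r_def)
      moreover have "r powr (p - 1) = r powr (p - 2) * r" using r1 powr_add[of r "p - 2" 1] by simp
      ultimately show ?thesis by (simp only: mult.assoc)
    qed
    ultimately have "g (a * G1 m y x) * (a * G2 m y x) \<le> (p - 1 + \<epsilon>) * (r powr (p - 1) * w)"
      by linarith
    also have "r powr (p - 1) * w = C powr (p - 1) * (a powr (p - 1) * w powr ((real m + 1) * (p - 1) + 1))"
    proof -
      have "w ^ (m + 1) = w powr (real m + 1)" using w powr_realpow[of w "m + 1"] by (simp add: add.commute)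
      then have "r = a * C * w powr (real m + 1)" unfolding r_def by (simp only:)
      then have "r powr (p - 1) = C powr (p - 1) * a powr (p - 1) * w powr ((real m + 1) * (p - 1))"
        using a C w by (simp add: powr_mult powr_powr)
      moreover have "w powr ((real m + 1) * (p - 1)) * w = w powr ((real m + 1) * (p - 1) + 1)"
        using w by (simp add: powr_add)
      ultimately show ?thesis by (metis (no_types, lifting) mult.assoc)
    qed
    finally have "g (a * G1 m y x) * (a * G2 m y x) \<le> A * (a powr (p - 1) * w powr ((real m + 1) * (p - 1) + 1))"
      by (simp add: A_def mult.assoc)
    then have "f (g (a * G1 m y x) * (a * G2 m y x)) \<le> f (A * (a powr (p - 1) * w powr ((real m + 1) * (p - 1) + 1)))"
      by (intro f_pow_mono \<beta>_pos)
    also have "\<dots> = A powr \<beta> * (a powr (\<beta> * (p - 1)) * w powr s)"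
      using A by (simp add: f_pow_nonneg powr_mult powr_powr s_def mult.commute)
    also have "\<dots> \<le> A powr \<beta> * (a * (inverse (b\<^sup>2) powr (s - m) * w ^ m))"
    proof (intro mult_left_mono mult_mono)
      have "a powr (\<beta> * (p - 1)) \<le> a powr 1" using a \<theta> by (intro powr_mono) auto
      then show "a powr (\<beta> * (p - 1)) \<le> a" using a by simp
      show "w powr s \<le> inverse (b\<^sup>2) powr (s - m) * w ^ m"
        unfolding w_def wt_power[OF x] using x m by (intro wt_powr_mono) (auto simp: s_def)
    qed (use a w in auto)
    also have "\<dots> = L0 * a * (c * w ^ m)" using c by (simp add: L0_def)
    also have "\<dots> \<le> max 1 L0 * a * (c * w ^ m)" using a c w by (intro mult_right_mono) auto
    also have "\<dots> \<le> max 1 L0 * a * G0 m y x"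
      unfolding w_def using a by (intro mult_left_mono c(2) x) auto
    finally show ?thesis .
  qed
  then show ?thesis by (intro exI[of _ "max 1 L0"]) auto
qed

lemma continuous_on_space_time:
  assumes "continuous_on {-b<..<b} h"
  shows "continuous_on (cyl0 b) (\<lambda>z. h (fst z))"
  by (rule continuous_on_compose2[OF assms]) (auto simp: cyl0_def intro!: continuous_intros)

lemma near_value:
  fixes u0 :: "real \<Rightarrow> real"
  assumes "continuous_on {-b<..<b} u0" "y \<in> {-b<..<b}" "\<delta> > 0"
  shows "\<exists>d>0. \<forall>x\<in>{-b<..<b}. \<bar>x - y\<bar> < d \<longrightarrow> \<bar>u0 x - u0 y\<bar> < \<delta>"
proof -
  obtain d where "d > 0" "\<forall>x\<in>{-b<..<b}. dist x y < d \<longrightarrow> dist (u0 x) (u0 y) < \<delta>"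
    using assms(1)[unfolded continuous_on_iff] assms(2,3) by meson
  then show ?thesis by (intro exI[of _ d]) (auto simp: dist_real_def)
qed

text \<open>The barrier is u0 y + \<delta> + K (exp(L t) G0 - 1). As \<open>L\<close> is independent
  of the amplitude, \<open>K\<close> remains free to dominate the datum away from \<open>y\<close>
  and to enforce the growth in time.\<close>

lemma upper_barrier:
  assumes u0: "continuous_on {-b<..<b} u0" "Cu \<ge> 0" "\<And>x. x \<in> {-b<..<b} \<Longrightarrow> u0 x \<le> Cu * wt x ^ m"
    and m: "\<beta> * ((real m + 1) * (p - 1) + 1) \<le> m" "\<beta> * (p - 1) \<le> 1"
    and B: "B \<ge> 0" and q: "q \<ge> 1" and y: "y \<in> {-b<..<b}" and \<delta>: "\<delta> > 0"
  shows "\<exists>V. continuous_on (cyl0 b) V \<and> vsub (\<lambda>z. - V z) \<and> V (y, 0) = u0 y + \<delta>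
    \<and> (\<forall>x\<in>{-b<..<b}. u0 x \<le> V (x, 0))
    \<and> (\<forall>x\<in>{-b<..<b}. \<forall>t\<ge>0. V (x, 0) + B * t powr q * wt x ^ m \<le> V (x, t))"
proof -
  obtain c where c: "c > 0" "\<And>x. x \<in> {-b<..<b} \<Longrightarrow> c * wt x ^ m \<le> G0 m y x"
    using G0_lower[OF y] by blast
  obtain L where L: "L \<ge> 1" "\<And>x a. x \<in> {-b<..<b} \<Longrightarrow> a \<ge> 1 \<Longrightarrow> f (g (a * G1 m y x) * (a * G2 m y x)) \<le> L * a * G0 m y x"
    using G_growth[OF y m] by blast
  obtain ce where ce: "ce > 0" "\<And>t. t \<ge> 0 \<Longrightarrow> ce * t powr q \<le> exp t - 1"
    using power_le_exp[OF q] by blast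
  obtain d where d: "d > 0" "\<And>x. x \<in> {-b<..<b} \<Longrightarrow> \<bar>x - y\<bar> < d \<Longrightarrow> \<bar>u0 x - u0 y\<bar> < \<delta>"
    using near_value[OF u0(1) y \<delta>] by blast
  \<comment> \<open>In turn: amplitude at least 1 for \<open>G_growth\<close>; domination of the
    datum at distance at least \<open>d\<close> from \<open>y\<close>, where |u0 y| is absorbed by
    (b^2)^m wt^m \<ge> 1; growth at least B t^q wt^m.\<close>
  define K where "K = max 1 (max ((Cu + \<bar>u0 y\<bar> * (b\<^sup>2) ^ m) / d\<^sup>2) (B / (ce * c)))"
  have K: "K \<ge> 1" "Cu + \<bar>u0 y\<bar> * (b\<^sup>2) ^ m \<le> K * d\<^sup>2" "B \<le> K * ce * c"
  proof -
    show "K \<ge> 1" by (simp add: K_def)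
    have "(Cu + \<bar>u0 y\<bar> * (b\<^sup>2) ^ m) / d\<^sup>2 \<le> K" by (simp add: K_def)
    then show "Cu + \<bar>u0 y\<bar> * (b\<^sup>2) ^ m \<le> K * d\<^sup>2" using d(1) by (simp add: pos_divide_le_eq)
    have "B / (ce * c) \<le> K" by (simp add: K_def)
    then show "B \<le> K * ce * c" using ce(1) c(1) by (simp add: pos_divide_le_eq mult.assoc)
  qed
  define V where "V z = u0 y + \<delta> - K + K * exp (L * snd z) * G0 m y (fst z)" for z
  have "continuous_on {-b<..<b} (G0 m y)"
    using DERIV_G0 by (intro DERIV_continuous_on) (auto intro: has_field_derivative_at_within)
  then have "continuous_on (cyl0 b) V"
    unfolding V_def[abs_def] by (intro continuous_intros continuous_on_space_time)
  moreover have "vsub (\<lambda>z. - V z)"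
  proof (rule vsub_classical)
    fix x t assume "(x, t) \<in> cyl b"
    then have x: "x \<in> {-b<..<b}" and t: "t > 0" by (auto simp: cyl_def)
    show "((\<lambda>s. - V (x, s)) has_real_derivative - (K * (L * exp (L * t)) * G0 m y x)) (at t)"
      unfolding V_def by (auto intro!: derivative_eq_intros)
    show "((\<lambda>y. - V (y, t)) has_real_derivative - (K * exp (L * t) * G1 m y x)) (at x)"
      unfolding V_def by (auto intro!: derivative_eq_intros DERIV_G0 x)
    show "((\<lambda>x. - (K * exp (L * t) * G1 m y x)) has_real_derivative - (K * exp (L * t) * G2 m y x)) (at x)"
      by (auto intro!: derivative_eq_intros DERIV_G1 x)
    define a where "a = K * exp (L * t)"
    have "1 * 1 \<le> a" unfolding a_def using K L t by (intro mult_mono) auto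
    then have "f (g (a * G1 m y x) * (a * G2 m y x)) \<le> L * a * G0 m y x" using x by (intro L) auto
    then show "- (K * (L * exp (L * t)) * G0 m y x) + F (- (K * exp (L * t) * G1 m y x)) (- (K * exp (L * t) * G2 m y x)) \<le> 0"
      unfolding F_op_minus a_def[symmetric] by (simp add: F_op_def a_def mult_ac)
  qed
  moreover have "V (y, 0) = u0 y + \<delta>" by (simp add: V_def G0_def)
  moreover have "u0 x \<le> V (x, 0)" if x: "x \<in> {-b<..<b}" for x
  proof -
    have V0: "V (x, 0) = u0 y + \<delta> + K * (x - y)\<^sup>2 * wt x ^ m"
      by (simp add: V_def G0_def algebra_simps)
    have wtm: "wt x ^ m > 0" using wt_pos[OF x] by simp
    show ?thesis
    proof (cases "\<bar>x - y\<bar> < d")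
      case True
      have "0 \<le> K * (x - y)\<^sup>2 * wt x ^ m" using K wtm by simp
      then show ?thesis unfolding V0 using d(2)[OF x True] by linarith
    next
      case False
      have "d\<^sup>2 \<le> (x - y)\<^sup>2" using False d(1) by (intro iffD1[OF abs_le_square_iff]) auto
      then have "K * d\<^sup>2 \<le> K * (x - y)\<^sup>2" using K by (intro mult_left_mono) auto
      then have "(Cu + \<bar>u0 y\<bar> * (b\<^sup>2) ^ m) * wt x ^ m \<le> K * (x - y)\<^sup>2 * wt x ^ m"
        using K(2) wtm by (intro mult_right_mono) auto
      moreover have "\<bar>u0 y\<bar> * 1 \<le> \<bar>u0 y\<bar> * ((b\<^sup>2) ^ m * wt x ^ m)"
      proof (intro mult_left_mono)
        have "(b\<^sup>2) ^ m * inverse (b\<^sup>2) ^ m \<le> (b\<^sup>2) ^ m * wt x ^ m"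
          using wt_ge[OF x] b_pos by (intro mult_left_mono power_mono) auto
        moreover have "(b\<^sup>2) ^ m * inverse (b\<^sup>2) ^ m = 1"
          unfolding power_mult_distrib[symmetric] using b_pos by simp
        ultimately show "1 \<le> (b\<^sup>2) ^ m * wt x ^ m" by simp
      qed auto
      ultimately have "u0 x + \<bar>u0 y\<bar> \<le> K * (x - y)\<^sup>2 * wt x ^ m"
        using u0(3)[OF x] by (simp only: distrib_right mult.assoc)
      then show ?thesis unfolding V0 using \<delta> by linarith
    qed
  qed
  moreover have "V (x, 0) + B * t powr q * wt x ^ m \<le> V (x, t)" if x: "x \<in> {-b<..<b}" and t: "t \<ge> 0" for x t
  proof -
    have wtm: "wt x ^ m > 0" using wt_pos[OF x] by simp
    have "B * (t powr q * wt x ^ m) \<le> K * ce * c * (t powr q * wt x ^ m)"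
      using K(3) wtm by (intro mult_right_mono) auto
    also have "\<dots> = K * ((ce * t powr q) * (c * wt x ^ m))" by (simp only: mult_ac)
    also have "\<dots> \<le> K * ((exp (L * t) - 1) * G0 m y x)"
    proof (intro mult_left_mono mult_mono c(2) x)
      have "t * 1 \<le> t * L" using t L by (intro mult_left_mono) auto
      then have "exp t \<le> exp (L * t)" by (simp add: mult.commute)
      then show "ce * t powr q \<le> exp (L * t) - 1" using ce(2)[OF t] by linarith
      show "0 \<le> exp (L * t) - 1" using t L by simp
    qed (use K c wtm in auto)
    finally show ?thesis by (simp add: V_def algebra_simps)
  qed
  ultimately show ?thesis by blast
qed

lemma lower_barrier:
  assumes u0: "continuous_on {-b<..<b} u0" "\<And>x. x \<in> {-b<..<b} \<Longrightarrow> c0 \<le> u0 x"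
    and y: "y \<in> {-b<..<b}" and \<delta>: "\<delta> > 0"
  shows "\<exists>v. continuous_on (cyl0 b) v \<and> vsub v \<and> v (y, 0) = u0 y - \<delta>
    \<and> (\<forall>x\<in>{-b<..<b}. \<forall>t\<ge>0. v (x, t) \<le> u0 x)"
proof -
  obtain d where d: "d > 0" "\<And>x. x \<in> {-b<..<b} \<Longrightarrow> \<bar>x - y\<bar> < d \<Longrightarrow> \<bar>u0 x - u0 y\<bar> < \<delta>"
    using near_value[OF u0(1) y \<delta>] by blast
  \<comment> \<open>The parabola has dropped to c0 - \<delta> at distance \<open>d\<close>; closer
    to \<open>y\<close>, continuity of the datum suffices.\<close>
  define K where "K = (u0 y - c0) / d\<^sup>2"
  have K: "K \<ge> 0" "K * d\<^sup>2 = u0 y - c0" using u0(2)[OF y] d(1) by (auto simp: K_def)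
  \<comment> \<open>Slopes are at most 4 K b, because two points of the interval are less than 2 b
    apart.\<close>
  define L where "L = \<bar>f (g (4 * K * b) * (2 * K))\<bar>"
  define v where "v z = u0 y - \<delta> - K * (fst z - y)\<^sup>2 - L * snd z" for z
  have "continuous_on (cyl0 b) v" unfolding v_def[abs_def] by (intro continuous_intros)
  moreover have "vsub v"
  proof (rule vsub_classical)
    fix x t assume "(x, t) \<in> cyl b"
    then have x: "x \<in> {-b<..<b}" by (auto simp: cyl_def)
    show "((\<lambda>s. v (x, s)) has_real_derivative - L) (at t)"
      unfolding v_def by (auto intro!: derivative_eq_intros)
    show "((\<lambda>y. v (y, t)) has_real_derivative - (2 * K * (x - y))) (at x)"
      unfolding v_def by (auto intro!: derivative_eq_intros)
    show "((\<lambda>x. - (2 * K * (x - y))) has_real_derivative - (2 * K)) (at x)"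
      by (auto intro!: derivative_eq_intros)
    have "\<bar>2 * K * (x - y)\<bar> \<le> \<bar>4 * K * b\<bar>"
    proof -
      have "\<bar>2 * K * (x - y)\<bar> = 2 * K * \<bar>x - y\<bar>" using K by (simp add: abs_mult)
      also have "\<dots> \<le> 2 * K * (2 * b)" using K x y by (intro mult_left_mono) auto
      finally show ?thesis by simp
    qed
    then have "g (2 * K * (x - y)) * (2 * K) \<le> g (4 * K * b) * (2 * K)"
      using K by (intro mult_right_mono g_mono) auto
    then have "f (g (2 * K * (x - y)) * (2 * K)) \<le> L"
      unfolding L_def using f_pow_mono[OF \<beta>_pos] by (smt (verit))
    then show "- L + F (- (2 * K * (x - y))) (- (2 * K)) \<le> 0"
      unfolding F_op_minus by (simp add: F_op_def)
  qed
  moreover have "v (y, 0) = u0 y - \<delta>" by (simp add: v_def)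
  moreover have "v (x, t) \<le> u0 x" if x: "x \<in> {-b<..<b}" and t: "t \<ge> 0" for x t
  proof -
    have Lt: "0 \<le> L * t" using t by (simp add: L_def)
    show ?thesis
    proof (cases "\<bar>x - y\<bar> < d")
      case True
      have "0 \<le> K * (x - y)\<^sup>2" using K by simp
      then show ?thesis using d(2)[OF x True] Lt by (simp add: v_def)
    next
      case False
      have "d\<^sup>2 \<le> (x - y)\<^sup>2" using False d(1) by (intro iffD1[OF abs_le_square_iff]) auto
      then have "K * d\<^sup>2 \<le> K * (x - y)\<^sup>2" using K by (intro mult_left_mono) auto
      then show ?thesis using K(2) u0(2)[OF x] Lt \<delta> by (simp add: v_def)
    qed
  qed
  ultimately show ?thesis by blast
qed

text \<open>Both exponents come from matching powers of \<open>t\<close> and of the distance to the boundary in the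
  equation for \<open>\<kappa> t\<^bsup>q\<^esup> (b - x)\<^bsup>-m\<^esup>\<close>.\<close>

lemma blowup_barrier:
  assumes \<theta>: "\<beta> * (p - 1) < 1"
  defines "m \<equiv> \<beta> * p / (1 - \<beta> * (p - 1))" and "q \<equiv> 1 / (1 - \<beta> * (p - 1))"
  shows "\<exists>\<kappa>>0. \<forall>\<sigma>\<in>{1, -1}. \<forall>c. vsub (\<lambda>z. c + \<kappa> * snd z powr q * (b - \<sigma> * fst z) powr - m)"
proof -
  define \<theta> where "\<theta> = \<beta> * (p - 1)"
  have \<theta>1: "\<theta> < 1" "\<theta> > 0" using assms(1) \<beta>_pos p_ge by (auto simp: \<theta>_def)
  have m: "m > 0" "m * (1 - \<theta>) = \<beta> * p" using \<theta>1 \<beta>_pos p_ge by (auto simp: m_def \<theta>_def)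
  have q: "q > 0" "q * (1 - \<theta>) = 1" using \<theta>1 by (auto simp: q_def \<theta>_def)
  \<comment> \<open>The constant left when the p-Laplacian part of \<open>g\<close> meets slope and
    curvature of the power: (p - 1) (m + 1) m^(p - 1).\<close>
  define B where "B = (p - 1) * (m + 1) * m powr (p - 1)"
  have B: "B > 0" using m p_ge by (simp add: B_def)
  \<comment> \<open>The solution of \<kappa> q = B^\<beta> \<kappa>^\<theta>: it balances the time
    derivative with the contribution of the p-Laplacian part of \<open>g\<close>, and the
    \<open>\<epsilon>\<close> part has the favourable sign.\<close>
  define \<kappa> where "\<kappa> = (B powr \<beta> / q) powr q"
  have \<kappa>: "\<kappa> > 0" using B q by (simp add: \<kappa>_def)
  have "\<kappa> powr (1 - \<theta>) = B powr \<beta> / q" using B q by (simp add: \<kappa>_def powr_powr)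
  moreover have "\<kappa> powr \<theta> * \<kappa> powr (1 - \<theta>) = \<kappa>" using \<kappa> by (simp flip: powr_add)
  ultimately have "\<kappa> powr \<theta> * (B powr \<beta> / q) = \<kappa>" by simp
  then have \<kappa>q: "\<kappa> * q = B powr \<beta> * \<kappa> powr \<theta>" using q(1) by (simp add: field_simps)
  have "vsub (\<lambda>z. c + \<kappa> * snd z powr q * (b - \<sigma> * fst z) powr - m)" if \<sigma>: "\<sigma> \<in> {1, -1}" for \<sigma> c
  proof (rule vsub_classical)
    fix x t assume "(x, t) \<in> cyl b"
    then have x: "x \<in> {-b<..<b}" and t: "t > 0" by (auto simp: cyl_def)
    define d where "d = b - \<sigma> * x"
    have d: "d > 0" using x \<sigma> by (auto simp: d_def)
    have D: "((\<lambda>y. (b - \<sigma> * y) powr r) has_real_derivative - \<sigma> * r * d powr (r - 1)) (at x)" for r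
    proof -
      have "((\<lambda>y. b - \<sigma> * y) has_real_derivative - \<sigma>) (at x)" by (auto intro!: derivative_eq_intros)
      from DERIV_chain2[OF has_real_derivative_powr[of "b - \<sigma> * x" r] this]
      show ?thesis using d by (simp add: d_def mult_ac)
    qed
    show "((\<lambda>s. c + \<kappa> * snd (x, s) powr q * (b - \<sigma> * fst (x, s)) powr - m) has_real_derivative
        \<kappa> * (q * t powr (q - 1)) * (b - \<sigma> * x) powr - m) (at t)"
      using t by (auto intro!: derivative_eq_intros has_real_derivative_powr)
    show "((\<lambda>y. c + \<kappa> * snd (y, t) powr q * (b - \<sigma> * fst (y, t)) powr - m) has_real_derivative
        \<kappa> * t powr q * (\<sigma> * m * (b - \<sigma> * x) powr (- m - 1))) (at x)"
      using DERIV_add[OF DERIV_const[of c] DERIV_cmult[OF D[of "- m"], of "\<kappa> * t powr q"]]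
      by (simp add: d_def)
    show "((\<lambda>x. \<kappa> * t powr q * (\<sigma> * m * (b - \<sigma> * x) powr (- m - 1))) has_real_derivative
        \<kappa> * t powr q * (m * (m + 1) * d powr (- m - 2))) (at x)"
      using DERIV_cmult[OF D[of "- m - 1"], of "\<kappa> * t powr q * (\<sigma> * m)"] \<sigma>
      by (auto simp: mult_ac algebra_simps)
    define P where "P = \<kappa> * t powr q"
    have P: "P > 0" using \<kappa> t by (simp add: P_def)
    define Q where "Q = P * m * d powr (- m - 1)"
    have Q: "Q > 0" using P m d by (simp add: Q_def)
    define hx where "hx = P * (\<sigma> * m * d powr (- m - 1))"
    have hx: "\<bar>hx\<bar> = Q" "hx \<noteq> 0" using \<sigma> P m d by (auto simp: hx_def Q_def abs_mult)
    have "(p - 1) * Q powr (p - 2) \<le> g hx" using g_lower[OF hx(2)] hx(1) by simp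
    then have le: "(p - 1) * Q powr (p - 2) * (Q * ((m + 1) * d powr - 1)) \<le> g hx * (Q * ((m + 1) * d powr - 1))"
      using Q m by (intro mult_right_mono) auto
    have eqB: "(p - 1) * Q powr (p - 2) * (Q * ((m + 1) * d powr - 1)) = B * (P powr (p - 1) * d powr (- ((m + 1) * (p - 1) + 1)))"
    proof -
      have e1: "Q powr (p - 2) * Q = Q powr (p - 1)" using Q powr_add[of Q "p - 2" 1] by simp
      have e2: "Q powr (p - 1) = P powr (p - 1) * m powr (p - 1) * d powr ((- m - 1) * (p - 1))"
        using P m d by (simp add: Q_def powr_mult powr_powr)
      have "(- m - 1) * (p - 1) + - 1 = - ((m + 1) * (p - 1) + 1)" by (simp add: algebra_simps)
      then have e3: "d powr ((- m - 1) * (p - 1)) * d powr - 1 = d powr (- ((m + 1) * (p - 1) + 1))"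
        by (simp only: powr_add[symmetric])
      have "(p - 1) * Q powr (p - 2) * (Q * ((m + 1) * d powr - 1))
          = (p - 1) * (m + 1) * (Q powr (p - 2) * Q * d powr - 1)"
        by (simp only: mult_ac)
      also have "\<dots> = (p - 1) * (m + 1) * m powr (p - 1)
          * (P powr (p - 1) * (d powr ((- m - 1) * (p - 1)) * d powr - 1))"
        unfolding e1 e2 by (simp only: mult_ac)
      also have "\<dots> = B * (P powr (p - 1) * d powr (- ((m + 1) * (p - 1) + 1)))"
        unfolding e3 B_def ..
      finally show ?thesis .
    qed
    have eqQ: "Q * ((m + 1) * d powr - 1) = P * (m * (m + 1) * d powr (- m - 2))"
    proof -
      have "d powr (- m - 1) * d powr - 1 = d powr (- m - 1 + - 1)" by (simp only: powr_add)
      then have "d powr (- m - 1) * d powr - 1 = d powr (- m - 2)" by (simp only: diff_diff_eq diff_conv_add_uminus[symmetric] one_add_one)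
      moreover have "Q * ((m + 1) * d powr - 1) = P * (m * (m + 1) * (d powr (- m - 1) * d powr - 1))"
        by (simp only: Q_def mult_ac)
      ultimately show ?thesis by (simp only:)
    qed
    have "f (B * (P powr (p - 1) * d powr (- ((m + 1) * (p - 1) + 1)))) \<le> f (g hx * (P * (m * (m + 1) * d powr (- m - 2))))"
      by (intro f_pow_mono \<beta>_pos le[unfolded eqB, unfolded eqQ])
    moreover have "f (B * (P powr (p - 1) * d powr (- ((m + 1) * (p - 1) + 1)))) = B powr \<beta> * (P powr \<theta> * d powr - m)"
    proof -
      have "- ((m + 1) * (p - 1) + 1) * \<beta> = - m"
        using m(2) by (simp add: \<theta>_def algebra_simps)
      then show ?thesis using B by (simp add: f_pow_nonneg powr_mult powr_powr \<theta>_def mult.commute)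
    qed
    moreover have "P powr \<theta> = \<kappa> powr \<theta> * t powr (q - 1)"
    proof -
      have "q * \<theta> = q - 1" using q(2) by (simp add: algebra_simps)
      then show ?thesis using \<kappa> by (simp add: P_def powr_mult powr_powr)
    qed
    ultimately have "\<kappa> * q * (t powr (q - 1) * d powr - m) \<le> f (g hx * (P * (m * (m + 1) * d powr (- m - 2))))"
      unfolding \<kappa>q by (simp add: mult_ac)
    then show "\<kappa> * (q * t powr (q - 1)) * (b - \<sigma> * x) powr - m
      + F (\<kappa> * t powr q * (\<sigma> * m * (b - \<sigma> * x) powr (- m - 1))) (\<kappa> * t powr q * (m * (m + 1) * d powr (- m - 2))) \<le> 0"
      unfolding d_def[symmetric] P_def[symmetric] hx_def[symmetric] F_op_def by (simp add: mult_ac)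
  qed
  with \<kappa> show ?thesis by blast
qed

lemma vsub_cong:
  assumes "vsub v" "\<And>z. z \<in> cyl b \<Longrightarrow> v z = w z"
  shows "vsub w"
  unfolding vsub_def
proof (intro ballI allI impI)
  fix z a q Y C assume z: "z \<in> cyl b" and touch: "touches w z a q Y C"
  have "\<forall>\<^sub>F y in nhds z. y \<in> cyl b" using z open_cyl by (intro eventually_nhds_in_open)
  then have "touches v z a q Y C"
    using touch unfolding touches_def by eventually_elim (simp add: assms(2) z)
  then show "a + F q Y \<le> 0" using assms(1) z by (intro vsubD)
qed

lemma blowup_at_top:
  assumes "k > 0" "m > 0"
  shows "filterlim (\<lambda>x. c + k * (b - x) powr - m) at_top (at_left b)"
    and "filterlim (\<lambda>x. c + k * (b + x) powr - m) at_top (at_right (- b))"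
proof -
  have "\<exists>r>0. \<forall>d. 0 < d \<longrightarrow> d < r \<longrightarrow> M \<le> c + k * d powr - m" for M
  proof -
    define N where "N = max 1 ((M - c) / k)"
    have N: "N > 0" "(M - c) / k \<le> N" by (auto simp: N_def)
    have "M \<le> c + k * d powr - m" if d: "0 < d" "d < N powr - (1 / m)" for d
    proof -
      have "N = (N powr - (1 / m)) powr - m" using N assms by (simp add: powr_powr)
      also have "\<dots> \<le> d powr - m" using d assms by (intro powr_mono2') auto
      finally have "(M - c) / k \<le> d powr - m" using N by linarith
      then show ?thesis using assms by (simp add: field_simps)
    qed
    then show ?thesis using N by (intro exI[of _ "N powr - (1 / m)"]) auto
  qed
  note * = this
  show "filterlim (\<lambda>x. c + k * (b - x) powr - m) at_top (at_left b)"
    unfolding filterlim_at_top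
  proof
    fix M obtain r where r: "r > 0" "\<And>d. 0 < d \<Longrightarrow> d < r \<Longrightarrow> M \<le> c + k * d powr - m" using * by blast
    then show "\<forall>\<^sub>F x in at_left b. M \<le> c + k * (b - x) powr - m"
      unfolding eventually_at_left_field by (intro exI[of _ "b - r"]) auto
  qed
  show "filterlim (\<lambda>x. c + k * (b + x) powr - m) at_top (at_right (- b))"
    unfolding filterlim_at_top
  proof
    fix M obtain r where r: "r > 0" "\<And>d. 0 < d \<Longrightarrow> d < r \<Longrightarrow> M \<le> c + k * d powr - m" using * by blast
    then show "\<forall>\<^sub>F x in at_right (- b). M \<le> c + k * (b + x) powr - m"
      unfolding eventually_at_right_field by (intro exI[of _ "r - b"]) auto
  qed
qed

lemma distance_powr_le_wt:
  assumes "\<gamma> \<ge> 0" "\<sigma> \<in> {1, -1}" "x \<in> {-b<..<b}"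
  shows "(b - \<sigma> * x) powr - \<gamma> \<le> (2 * b) powr \<gamma> * wt x powr \<gamma>"
proof -
  have pos: "0 < b - \<sigma> * x" "0 < b + \<sigma> * x" "b + \<sigma> * x \<le> 2 * b" using assms by auto
  have "b\<^sup>2 - x\<^sup>2 = (b - \<sigma> * x) * (b + \<sigma> * x)" using assms by (auto simp: power2_eq_square algebra_simps)
  also have "\<dots> \<le> (b - \<sigma> * x) * (2 * b)" using pos by (intro mult_left_mono) auto
  finally have "inverse (b - \<sigma> * x) \<le> 2 * b * wt x"
    using pos wt_arg_pos[OF assms(3)] by (simp add: wt_def field_simps)
  then have "inverse (b - \<sigma> * x) powr \<gamma> \<le> (2 * b * wt x) powr \<gamma>"
    using pos assms by (intro powr_mono2) auto
  then show ?thesis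
    using pos by (simp add: powr_minus inverse_powr powr_mult)
qed

text \<open>Perron's method below \<open>W\<close>, the infimum of all upper barriers. Each of these
  exceeds u0 + B t^q wt^m, hence both lateral barriers and all initial lower barriers; so every
  required subsolution competes and lies below the maximal one.\<close>

theorem existence:
  assumes \<theta>: "\<beta> * (p - 1) < 1"
    and u0: "continuous_on {-b<..<b} u0" "\<And>x. x \<in> {-b<..<b} \<Longrightarrow> c0 \<le> u0 x"
    and growth: "Cu \<ge> 0" "\<And>x. x \<in> {-b<..<b} \<Longrightarrow> u0 x \<le> Cu * wt x powr \<gamma>"
  shows "\<exists>u. viscosity_solution b p \<beta> \<epsilon> u0 u"
proof -
  define m0 where "m0 = \<beta> * p / (1 - \<beta> * (p - 1))"
  define q where "q = 1 / (1 - \<beta> * (p - 1))"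
  have m0: "m0 > 0" using \<theta> \<beta>_pos p_ge by (simp add: m0_def)
  have q: "q \<ge> 1" using \<theta> \<beta>_pos p_ge by (simp add: q_def)
  obtain \<kappa> where \<kappa>: "\<kappa> > 0"
    "\<And>\<sigma> c. \<sigma> \<in> {1, -1} \<Longrightarrow> vsub (\<lambda>z. c + \<kappa> * snd z powr q * (b - \<sigma> * fst z) powr - m0)"
    using blowup_barrier[OF \<theta>] unfolding m0_def q_def by blast
  \<comment> \<open>An integer at least \<open>\<gamma>\<close>, to dominate the data, and at least
    \<open>m0\<close>, which is equivalent to the condition in \<open>G_growth\<close>.\<close>
  define m where "m = nat \<lceil>max \<gamma> m0\<rceil>"
  have m: "\<gamma> \<le> m" "m0 \<le> m" using real_nat_ceiling_ge[of "max \<gamma> m0"] by (auto simp: m_def)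
  have "\<beta> * p \<le> m * (1 - \<beta> * (p - 1))" using m(2) \<theta> by (simp add: m0_def pos_divide_le_eq)
  then have m': "\<beta> * ((real m + 1) * (p - 1) + 1) \<le> m" by (simp add: algebra_simps)
  define Cm where "Cm = Cu * inverse (b\<^sup>2) powr (\<gamma> - m)"
  have Cm: "Cm \<ge> 0" "u0 x \<le> Cm * wt x ^ m" if "x \<in> {-b<..<b}" for x
  proof -
    show "Cm \<ge> 0" using growth(1) by (simp add: Cm_def)
    have "Cu * wt x powr \<gamma> \<le> Cu * (inverse (b\<^sup>2) powr (\<gamma> - m) * wt x powr m)"
      using growth(1) wt_powr_mono[OF that m(1)] by (intro mult_left_mono)
    then show "u0 x \<le> Cm * wt x ^ m"
      unfolding wt_power[OF that] Cm_def using growth(2)[OF that] by (simp add: mult.assoc)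
  qed
  have Cm0: "Cm \<ge> 0" using growth(1) by (simp add: Cm_def)
  \<comment> \<open>Converts the lateral barrier, a power of the distance to one end, into a bound
    by wt^m.\<close>
  define B where "B = \<kappa> * (2 * b) powr m0 * inverse (b\<^sup>2) powr (m0 - m)"
  have B: "B \<ge> 0" using \<kappa> b_pos by (simp add: B_def)
  \<comment> \<open>The sign \<open>\<sigma>\<close> selects the end:
    \<open>b - \<sigma> * x\<close> is the distance to \<open>b\<close> for 1 and to
    \<open>- b\<close> for -1. Since \<open>0 powr q\<close> is 0, the barrier starts from the
    constant \<open>c0\<close>.\<close>
  define w where "w \<sigma> z = c0 + \<kappa> * snd z powr q * (b - \<sigma> * fst z) powr - m0" for \<sigma> and z :: "real \<times> real"
  have w_B: "w \<sigma> (x, t) \<le> c0 + B * t powr q * wt x ^ m"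
    if \<sigma>: "\<sigma> \<in> {1, -1}" and x: "x \<in> {-b<..<b}" for \<sigma> x t
  proof -
    have "(b - \<sigma> * x) powr - m0 \<le> (2 * b) powr m0 * wt x powr m0"
      using distance_powr_le_wt[OF _ \<sigma> x] m0 by simp
    moreover have "(2 * b) powr m0 * wt x powr m0 \<le> (2 * b) powr m0 * (inverse (b\<^sup>2) powr (m0 - m) * wt x powr m)"
      using wt_powr_mono[OF x m(2)] by (intro mult_left_mono) auto
    ultimately have "(b - \<sigma> * x) powr - m0 \<le> (2 * b) powr m0 * (inverse (b\<^sup>2) powr (m0 - m) * wt x ^ m)"
      unfolding wt_power[OF x] by linarith
    then have "\<kappa> * t powr q * (b - \<sigma> * x) powr - m0 \<le> \<kappa> * t powr q * ((2 * b) powr m0 * (inverse (b\<^sup>2) powr (m0 - m) * wt x ^ m))"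
      using \<kappa>(1) by (intro mult_left_mono) auto
    then show ?thesis by (simp add: w_def B_def mult_ac)
  qed
  define I where "I = {-b<..<b} \<times> {0::real<..}"
  have "\<forall>i\<in>I. \<exists>V. continuous_on (cyl0 b) V \<and> vsub (\<lambda>z. - V z) \<and> V (fst i, 0) = u0 (fst i) + snd i
    \<and> (\<forall>x\<in>{-b<..<b}. u0 x \<le> V (x, 0))
    \<and> (\<forall>x\<in>{-b<..<b}. \<forall>t\<ge>0. V (x, 0) + B * t powr q * wt x ^ m \<le> V (x, t))"
    using upper_barrier[OF u0(1) Cm0 Cm(2) m' less_imp_le[OF \<theta>] B q] by (auto simp: I_def)
  from bchoice[OF this] obtain V where V: "\<And>i. i \<in> I \<Longrightarrow> continuous_on (cyl0 b) (V i)"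
    "\<And>i. i \<in> I \<Longrightarrow> vsub (\<lambda>z. - V i z)" "\<And>i. i \<in> I \<Longrightarrow> V i (fst i, 0) = u0 (fst i) + snd i"
    "\<And>i x. i \<in> I \<Longrightarrow> x \<in> {-b<..<b} \<Longrightarrow> u0 x \<le> V i (x, 0)"
    "\<And>i x t. i \<in> I \<Longrightarrow> x \<in> {-b<..<b} \<Longrightarrow> t \<ge> 0 \<Longrightarrow> V i (x, 0) + B * t powr q * wt x ^ m \<le> V i (x, t)"
    by blast
  have I_ne: "I \<noteq> {}" using b_pos by (auto simp: I_def)
  have V_u0: "u0 x + B * t powr q * wt x ^ m \<le> V i (x, t)" if "i \<in> I" "(x, t) \<in> cyl0 b" for i x t
    using V(4)[OF that(1), of x] V(5)[OF that(1), of x t] that(2) by (auto simp: cyl0_def)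
  have Bt: "0 \<le> B * t powr q * wt x ^ m" if "x \<in> {-b<..<b}" for x t
    using B wt_pos[OF that] by simp
  have V_c0: "c0 \<le> V i z" if "i \<in> I" "z \<in> cyl0 b" for i z
  proof -
    obtain x t where z: "z = (x, t)" by force
    then have "x \<in> {-b<..<b}" using that by (auto simp: cyl0_def)
    then show ?thesis using V_u0[of i x t] Bt[of x t] u0(2)[of x] that by (auto simp: z)
  qed
  \<comment> \<open>The index runs over all centres and all gaps \<delta> > 0, so \<open>W\<close>
    is at most \<open>u0\<close> at time 0; as an infimum of continuous functions it is upper
    semicontinuous.\<close>
  define W where "W z = (INF i\<in>I. V i z)" for z
  have W_le: "W z \<le> V i z" if "i \<in> I" "z \<in> cyl0 b" for i z
    unfolding W_def by (rule cINF_lower[OF bdd_belowI2[of I c0] that(1)]) (rule V_c0[OF _ that(2)])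
  have W_ge: "a \<le> W z" if "\<And>i. i \<in> I \<Longrightarrow> a \<le> V i z" for a z
    unfolding W_def using that I_ne by (intro cINF_greatest)
  have W_less: "\<exists>i\<in>I. V i z < a" if "W z < a" for z a
    using that W_ge[of a z] by (meson not_le)
  have usc_W: "usc_on (cyl0 b) W"
    unfolding usc_on_def
  proof (intro ballI allI impI)
    fix z a assume z: "z \<in> cyl0 b" and "W z < a"
    then obtain i where i: "i \<in> I" "V i z < a" using W_less by blast
    then have "\<forall>\<^sub>F y in at z within cyl0 b. V i y < a"
      using usc_on_continuous[OF V(1)] z by (auto simp: usc_on_def)
    moreover have "\<forall>\<^sub>F y in at z within cyl0 b. y \<in> cyl0 b" by (auto simp: eventually_at_filter)
    ultimately show "\<forall>\<^sub>F y in at z within cyl0 b. W y < a"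
    proof eventually_elim
      case (elim y)
      then show ?case using W_le[OF i(1), of y] by linarith
    qed
  qed
  have w_W: "w \<sigma> z \<le> W z" if \<sigma>: "\<sigma> \<in> {1, -1}" and z: "z \<in> cyl0 b" for \<sigma> z
  proof (rule W_ge)
    fix i assume i: "i \<in> I"
    obtain x t where xt: "z = (x, t)" by force
    then have x: "x \<in> {-b<..<b}" using z by (auto simp: cyl0_def)
    show "w \<sigma> z \<le> V i z"
      using w_B[OF \<sigma> x, of t] V_u0[OF i, of x t] u0(2)[OF x] z by (simp add: xt)
  qed
  have low_W: "v z \<le> W z" if "\<And>x t. x \<in> {-b<..<b} \<Longrightarrow> t \<ge> 0 \<Longrightarrow> v (x, t) \<le> u0 x" "z \<in> cyl0 b" for v z
  proof (rule W_ge)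
    fix i assume i: "i \<in> I"
    obtain x t where xt: "z = (x, t)" by force
    then have x: "x \<in> {-b<..<b}" "t \<ge> 0" using that(2) by (auto simp: cyl0_def)
    show "v z \<le> V i z"
      using V_u0[OF i, of x t] Bt[OF x(1), of t] that(1)[OF x] that(2) by (simp add: xt)
  qed
  have fin_W: "- W z \<le> neg_env W z" "\<bar>upper_env b (\<lambda>w. - W w) z\<bar> \<noteq> \<infinity>"
    if "z \<in> cyl0 b" for z
  proof -
    have c: "usc_on (cyl0 b) (\<lambda>z. - c0)" by (intro usc_on_continuous continuous_intros)
    have le: "- W y \<le> - c0" if "y \<in> cyl0 b" for y using W_ge[of c0 y] V_c0 that by auto
    show "- W z \<le> neg_env W z"
      by (rule upper_env_finite(3)[OF that c le])
    show "\<bar>upper_env b (\<lambda>w. - W w) z\<bar> \<noteq> \<infinity>"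
      by (rule upper_env_finite(1)[OF that c le])
  qed
  \<comment> \<open>With signs changed, the infimum of supersolutions is a supremum of
    subsolutions.\<close>
  have NW: "vsub (neg_env W)"
  proof (rule vsub_sup[of "(\<lambda>i z. - V i z) ` I"])
    fix v assume "v \<in> (\<lambda>i z. - V i z) ` I"
    then obtain i where i: "i \<in> I" "v = (\<lambda>z. - V i z)" by auto
    have "continuous_on (cyl b) (V i)" by (rule continuous_on_subset[OF V(1)[OF i(1)] cyl_subset])
    then show "usc_on (cyl b) v \<and> vsub v"
      unfolding i(2) using V(2)[OF i(1)] by (auto intro!: usc_on_continuous continuous_on_minus)
  next
    fix v z assume "v \<in> (\<lambda>i z. - V i z) ` I" and z: "z \<in> cyl b"
    then obtain i where i: "i \<in> I" "v = (\<lambda>z. - V i z)" by auto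
    have z0: "z \<in> cyl0 b" using z cyl_subset by blast
    show "v z \<le> neg_env W z"
      using W_le[OF i(1) z0] fin_W(1)[OF z0] by (simp add: i(2))
  next
    fix z and \<eta> :: real assume z: "z \<in> cyl b" and \<eta>: "\<eta> > 0"
    have z0: "z \<in> cyl0 b" using z cyl_subset by blast
    obtain r where r: "r > 0" "ball z r \<subseteq> cyl b" using open_cyl z open_contains_ball by blast
    have "ereal (neg_env W z - \<eta>) < upper_env b (\<lambda>w. - W w) z"
      using fin_W(2)[OF z0] \<eta> by (cases "upper_env b (\<lambda>w. - W w) z") auto
    from less_upper_envD[OF this, of "min \<eta> r"]
    obtain y where y: "y \<in> cyl0 b" "dist z y < min \<eta> r" "neg_env W z - \<eta> < - W y"
      using \<eta> r(1) by auto
    then obtain i where i: "i \<in> I" "V i y < - (neg_env W z - \<eta>)"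
      using W_less[of y "- (neg_env W z - \<eta>)"] by auto
    have "y \<in> cyl b" using r(2) y(2) by auto
    with i y show "\<exists>y\<in>cyl b. dist z y < \<eta> \<and> (\<exists>v\<in>(\<lambda>i z. - V i z) ` I. neg_env W z - \<eta> < v y)"
      by (intro bexI[of _ y]) (auto intro!: bexI[of _ i])
  qed
  have cont_w: "continuous_on (cyl0 b) (w \<sigma>)" if "\<sigma> \<in> {1, -1}" for \<sigma>
    unfolding w_def[abs_def] using that q
    by (intro continuous_intros continuous_on_powr') (auto simp: cyl0_def)
  have vsub_w: "vsub (w \<sigma>)" if "\<sigma> \<in> {1, -1}" for \<sigma>
    unfolding w_def[abs_def] using that by (rule \<kappa>(2))
  obtain u where u: "usc_on (cyl0 b) u" "vsub u" "\<And>z. z \<in> cyl0 b \<Longrightarrow> u z \<le> W z"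
    and u_max: "\<And>v z. usc_on (cyl0 b) v \<Longrightarrow> vsub v \<Longrightarrow> (\<forall>z\<in>cyl0 b. v z \<le> W z) \<Longrightarrow> z \<in> cyl0 b \<Longrightarrow> v z \<le> u z"
    and Nu: "vsub (neg_env u)"
    using perron[OF usc_W cont_w[of 1] vsub_w[of 1] w_W NW] by auto
  have w_u: "w \<sigma> z \<le> u z" if "\<sigma> \<in> {1, -1}" "z \<in> cyl0 b" for \<sigma> z
    using u_max[OF usc_on_continuous[OF cont_w[OF that(1)]] vsub_w[OF that(1)]] w_W that by blast
  have upper_u: "upper_env b u z = ereal (u z)" if "z \<in> cyl0 b" for z
    using upper_env_usc[OF u(1) that] .
  have env: "\<bar>upper_env b (\<lambda>w. - u w) z\<bar> \<noteq> \<infinity>" "neg_env u z \<le> - v z"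
    if z: "z \<in> cyl0 b" and v: "continuous_on (cyl0 b) v" "\<And>z. z \<in> cyl0 b \<Longrightarrow> v z \<le> u z" for z v
  proof -
    have "usc_on (cyl0 b) (\<lambda>z. - v z)" using v(1) by (intro usc_on_continuous continuous_intros)
    then show "\<bar>upper_env b (\<lambda>w. - u w) z\<bar> \<noteq> \<infinity>" "neg_env u z \<le> - v z"
      using upper_env_finite[OF z, of "\<lambda>z. - v z" "\<lambda>w. - u w"] v(2) by auto
  qed
  have fin_u: "\<bar>upper_env b (\<lambda>w. - u w) z\<bar> \<noteq> \<infinity>" if "z \<in> cyl0 b" for z
    by (rule env(1)[OF that cont_w[of 1] w_u[of 1]]) auto
  have lower_u: "real_of_ereal (lower_env b u z) = - neg_env u z" for z
    by (simp add: lower_env_uminus)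
  have lower_ge: "v z \<le> real_of_ereal (lower_env b u z)"
    if "z \<in> cyl0 b" "continuous_on (cyl0 b) v" "\<And>z. z \<in> cyl0 b \<Longrightarrow> v z \<le> u z" for z v
    using env(2)[OF that] unfolding lower_u by simp
  have lower_fin: "\<bar>lower_env b u z\<bar> \<noteq> \<infinity>" if "z \<in> cyl0 b" for z
    using fin_u[OF that] by (simp add: lower_env_uminus)
  have "sub_solution b p \<beta> \<epsilon> (\<lambda>z. real_of_ereal (upper_env b u z))"
  proof (rule sub_solutionI)
    show "usc_on (cyl0 b) (\<lambda>z. real_of_ereal (upper_env b u z))"
      by (rule usc_upper_env) (simp add: upper_u)
    show "vsub (\<lambda>z. real_of_ereal (upper_env b u z))"
      using u(2) by (rule vsub_cong) (use upper_u cyl_subset in force)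
  qed
  moreover have "super_solution b p \<beta> \<epsilon> (\<lambda>z. real_of_ereal (lower_env b u z))"
  proof (rule super_solutionI)
    show "lsc_on (cyl0 b) (\<lambda>z. real_of_ereal (lower_env b u z))"
      unfolding lower_u by (intro lsc_on_uminus usc_upper_env fin_u)
    show "vsub (\<lambda>z. - real_of_ereal (lower_env b u z))"
      unfolding lower_u using Nu by simp
  next
    fix t :: real assume t: "t > 0"
    \<comment> \<open>A continuous function below \<open>u\<close> is also below its lower envelope,
      so the blow-up of the lateral barrier is inherited.\<close>
    show "filterlim (\<lambda>x. real_of_ereal (lower_env b u (x, t))) at_top (at_left b)"
    proof (rule filterlim_at_top_mono[OF blowup_at_top(1)[of "\<kappa> * t powr q" m0 c0]])
      have "\<forall>\<^sub>F x in at_left b. x \<in> {-b<..<b}"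
        unfolding eventually_at_left_field using b_pos by (intro exI[of _ "-b"]) auto
      then show "\<forall>\<^sub>F x in at_left b. c0 + \<kappa> * t powr q * (b - x) powr - m0 \<le> real_of_ereal (lower_env b u (x, t))"
      proof eventually_elim
        case (elim x)
        then show ?case using lower_ge[OF _ cont_w[of 1] w_u, of "(x, t)"] t by (simp add: w_def cyl0_def)
      qed
    qed (use \<kappa> t m0 in auto)
    show "filterlim (\<lambda>x. real_of_ereal (lower_env b u (x, t))) at_top (at_right (- b))"
    proof (rule filterlim_at_top_mono[OF blowup_at_top(2)[of "\<kappa> * t powr q" m0 c0]])
      have "\<forall>\<^sub>F x in at_right (-b). x \<in> {-b<..<b}"
        unfolding eventually_at_right_field using b_pos by (intro exI[of _ b]) auto
      then show "\<forall>\<^sub>F x in at_right (-b). c0 + \<kappa> * t powr q * (b + x) powr - m0 \<le> real_of_ereal (lower_env b u (x, t))"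
      proof eventually_elim
        case (elim x)
        then show ?case using lower_ge[OF _ cont_w[of "-1"] w_u, of "(x, t)"] t by (simp add: w_def cyl0_def)
      qed
    qed (use \<kappa> t m0 in auto)
  qed
  moreover have "upper_env b u (y, 0) = ereal (u0 y) \<and> lower_env b u (y, 0) = ereal (u0 y)"
    if y: "y \<in> {-b<..<b}" for y
  proof -
    have y0: "(y, 0) \<in> cyl0 b" using y by (auto simp: cyl0_def)
    have "u (y, 0) \<le> u0 y + \<delta>" if "\<delta> > 0" for \<delta>
    proof -
      have i: "(y, \<delta>) \<in> I" using y that by (auto simp: I_def)
      show ?thesis using u(3)[OF y0] W_le[OF i y0] V(3)[OF i] by simp
    qed
    then have up: "u (y, 0) \<le> u0 y" by (rule field_le_epsilon)
    \<comment> \<open>The initial lower barrier at \<open>y\<close> is continuous and competes in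
      Perron's method, so it bounds the lower envelope as well; \<open>\<delta>\<close> then tends
      to 0.\<close>
    have "u0 y \<le> real_of_ereal (lower_env b u (y, 0)) + \<delta>" if \<delta>: "\<delta> > 0" for \<delta>
    proof -
      obtain v where v: "continuous_on (cyl0 b) v" "vsub v" "v (y, 0) = u0 y - \<delta>"
        "\<And>x t. x \<in> {-b<..<b} \<Longrightarrow> t \<ge> 0 \<Longrightarrow> v (x, t) \<le> u0 x"
        using lower_barrier[OF u0 y \<delta>] by blast
      have "v z \<le> u z" if "z \<in> cyl0 b" for z
        using u_max[OF usc_on_continuous[OF v(1)] v(2)] low_W[of v, OF v(4)] that by blast
      then show ?thesis using lower_ge[OF y0 v(1)] v(3) by simp
    qed
    then have lo: "u0 y \<le> real_of_ereal (lower_env b u (y, 0))" by (rule field_le_epsilon)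
    have "- u (y, 0) \<le> neg_env u (y, 0)"
      using upper_env_ge[OF y0, of "\<lambda>w. - u w"] fin_u[OF y0] by (cases "upper_env b (\<lambda>w. - u w) (y, 0)") auto
    then have "real_of_ereal (lower_env b u (y, 0)) \<le> u (y, 0)" unfolding lower_u by simp
    then have "real_of_ereal (lower_env b u (y, 0)) = u0 y" "u (y, 0) = u0 y" using up lo by auto
    then show ?thesis using lower_fin[OF y0] upper_u[OF y0] by (cases "lower_env b u (y, 0)") auto
  qed
  ultimately have "viscosity_solution b p \<beta> \<epsilon> u0 u"
    unfolding viscosity_solution_def using lower_fin upper_u by simp
  then show ?thesis by blast
qed

section \<open>From the assumptions on the datum to a floor and a power bound\<close>

lemma continuous_bounds:
  assumes "continuous_on {l..r} (h :: real \<Rightarrow> real)"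
  shows "\<exists>B\<ge>0. \<forall>x\<in>{l..r}. - B \<le> h x \<and> h x \<le> B"
  using continuous_abs_bound[OF assms] by (force simp: abs_le_iff)

text \<open>The exponent 0 puts bounded data into the form used for singular data;
  \<open>wt x powr 0\<close> is 1 because \<open>wt x\<close> is positive.\<close>

lemma continuous_data_bounds:
  assumes "continuous_on {-b..b} u0"
  shows "\<exists>c0 Cu. Cu \<ge> 0 \<and> (\<forall>x\<in>{-b<..<b}. c0 \<le> u0 x \<and> u0 x \<le> Cu * wt x powr 0)"
proof -
  obtain B where "B \<ge> 0" "\<forall>x\<in>{-b..b}. - B \<le> u0 x \<and> u0 x \<le> B"
    using continuous_bounds[OF assms] by blast
  moreover from this have "- B \<le> u0 x \<and> u0 x \<le> B * wt x powr 0" if "x \<in> {-b<..<b}" for x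
    using that wt_pos[OF that] by simp
  ultimately show ?thesis by blast
qed

text \<open>Near each end, divergence to infinity supplies the floor and the finite upper limit the
  power bound. Compactness handles the middle, where \<open>wt\<close> is bounded below, and the
  three constants are added.\<close>

lemma singular_data_bounds:
  assumes cont: "continuous_on {-b<..<b} u0"
    and top: "filterlim u0 at_top (at_left b)" "filterlim u0 at_top (at_right (- b))"
    and \<gamma>: "\<gamma> > 0"
    and sup: "Limsup (at_left b) (\<lambda>x. ereal (u0 x * (b - x) powr \<gamma>)) < \<infinity>"
      "Limsup (at_right (- b)) (\<lambda>x. ereal (u0 x * (b + x) powr \<gamma>)) < \<infinity>"
  shows "\<exists>c0 Cu. Cu \<ge> 0 \<and> (\<forall>x\<in>{-b<..<b}. c0 \<le> u0 x \<and> u0 x \<le> Cu * wt x powr \<gamma>)"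
proof -
  have end_bound: "u0 x \<le> max M 0 * (2 * b) powr \<gamma> * wt x powr \<gamma>"
    if "u0 x * (b - \<sigma> * x) powr \<gamma> < M" and \<sigma>: "\<sigma> \<in> {1, -1}" and x: "x \<in> {-b<..<b}" for x \<sigma> M
  proof -
    have pos: "0 < b - \<sigma> * x" using \<sigma> x by auto
    have "u0 x = u0 x * (b - \<sigma> * x) powr \<gamma> * (b - \<sigma> * x) powr - \<gamma>"
      using pos by (simp add: mult.assoc flip: powr_add)
    also have "\<dots> \<le> max M 0 * (b - \<sigma> * x) powr - \<gamma>"
      using that(1) by (intro mult_right_mono) auto
    also have "\<dots> \<le> max M 0 * ((2 * b) powr \<gamma> * wt x powr \<gamma>)"
      using distance_powr_le_wt[OF less_imp_le[OF \<gamma>] \<sigma> x] by (intro mult_left_mono) auto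
    finally show ?thesis by (simp add: mult.assoc)
  qed
  obtain M1 where "Limsup (at_left b) (\<lambda>x. ereal (u0 x * (b - x) powr \<gamma>)) < ereal M1"
    using sup(1) by (auto simp: less_PInf_Ex_of_nat)
  then have "\<forall>\<^sub>F x in at_left b. ereal (u0 x * (b - x) powr \<gamma>) < ereal M1" by (rule Limsup_lessD)
  moreover have "\<forall>\<^sub>F x in at_left b. 0 \<le> u0 x" using top(1) by (simp add: filterlim_at_top)
  ultimately have "\<forall>\<^sub>F x in at_left b. u0 x * (b - x) powr \<gamma> < M1 \<and> 0 \<le> u0 x" by eventually_elim auto
  then obtain r where r: "r < b" "\<And>x. r < x \<Longrightarrow> x < b \<Longrightarrow> u0 x * (b - x) powr \<gamma> < M1 \<and> 0 \<le> u0 x"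
    unfolding eventually_at_left_field by blast
  obtain M2 where "Limsup (at_right (- b)) (\<lambda>x. ereal (u0 x * (b + x) powr \<gamma>)) < ereal M2"
    using sup(2) by (auto simp: less_PInf_Ex_of_nat)
  then have "\<forall>\<^sub>F x in at_right (- b). ereal (u0 x * (b + x) powr \<gamma>) < ereal M2" by (rule Limsup_lessD)
  moreover have "\<forall>\<^sub>F x in at_right (- b). 0 \<le> u0 x" using top(2) by (simp add: filterlim_at_top)
  ultimately have "\<forall>\<^sub>F x in at_right (- b). u0 x * (b + x) powr \<gamma> < M2 \<and> 0 \<le> u0 x" by eventually_elim auto
  then obtain l where l: "- b < l" "\<And>x. - b < x \<Longrightarrow> x < l \<Longrightarrow> u0 x * (b + x) powr \<gamma> < M2 \<and> 0 \<le> u0 x"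
    unfolding eventually_at_right_field by blast
  have "continuous_on {l..r} u0"
    by (rule continuous_on_subset[OF cont]) (use l r in auto)
  then obtain B where B: "B \<ge> 0" "\<And>x. x \<in> {l..r} \<Longrightarrow> - B \<le> u0 x \<and> u0 x \<le> B"
    using continuous_bounds by blast
  define C1 where "C1 = max M1 0 * (2 * b) powr \<gamma>"
  define C2 where "C2 = max M2 0 * (2 * b) powr \<gamma>"
  define C3 where "C3 = B * inverse (b\<^sup>2) powr (0 - \<gamma>)"
  have C: "C1 \<ge> 0" "C2 \<ge> 0" "C3 \<ge> 0" using B by (auto simp: C1_def C2_def C3_def)
  have "- B \<le> u0 x \<and> u0 x \<le> (C1 + C2 + C3) * wt x powr \<gamma>" if x: "x \<in> {-b<..<b}" for x
  proof -
    have nn: "0 \<le> C1 * wt x powr \<gamma>" "0 \<le> C2 * wt x powr \<gamma>" "0 \<le> C3 * wt x powr \<gamma>" using C by auto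
    consider "x < l" | "x > r" | "x \<in> {l..r}" by force
    then show ?thesis
    proof cases
      case 1
      then have "u0 x \<le> C2 * wt x powr \<gamma>" "0 \<le> u0 x"
        unfolding C2_def using l(2)[of x] end_bound[of x "-1" M2] x by auto
      then show ?thesis using nn B(1) by (auto simp: distrib_right)
    next
      case 2
      then have "u0 x \<le> C1 * wt x powr \<gamma>" "0 \<le> u0 x"
        unfolding C1_def using r(2)[of x] end_bound[of x 1 M1] x by auto
      then show ?thesis using nn B(1) by (auto simp: distrib_right)
    next
      case 3
      have "B * wt x powr 0 \<le> B * (inverse (b\<^sup>2) powr (0 - \<gamma>) * wt x powr \<gamma>)"
        using wt_powr_mono[OF x, of 0 \<gamma>] \<gamma> B(1) by (intro mult_left_mono) auto
      then have "u0 x \<le> C3 * wt x powr \<gamma>"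
        using B(2)[OF 3] wt_pos[OF x] by (simp add: C3_def mult.assoc)
      then show ?thesis using nn B(2)[OF 3] by (auto simp: distrib_right)
    qed
  qed
  then show ?thesis using C by (intro exI[of _ "- B"] exI[of _ "C1 + C2 + C3"]) auto
qed

end

theorem corollary1p4:
  fixes b p \<beta>1 \<epsilon> :: real and u0 :: "real \<Rightarrow> real"
  assumes "b > 0" and "p \<ge> 2" and "\<beta>1 > 0" and "\<epsilon> > 0"
  shows
    "(\<beta>1 \<ge> 1 / (p - 1) \<and> continuous_on {-b<..<b} u0 \<and> (INF x\<in>{-b<..<b}. ereal (u0 x)) > -\<infinity>
        \<longrightarrow> \<not> (\<exists>u. viscosity_solution b p \<beta>1 \<epsilon> u0 u))
     \<and>
     (\<beta>1 < 1 / (p - 1) \<and>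
      (continuous_on {-b..b} u0 \<or>
       (continuous_on {-b<..<b} u0 \<and>
        filterlim u0 at_top (at_left b) \<and> filterlim u0 at_top (at_right (-b)) \<and>
        (\<exists>\<gamma>>0. Limsup (at_left b) (\<lambda>x. ereal (u0 x * (b - x) powr \<gamma>)) < \<infinity> \<and>
                Limsup (at_right (-b)) (\<lambda>x. ereal (u0 x * (b + x) powr \<gamma>)) < \<infinity>)))
        \<longrightarrow> (\<exists>u. viscosity_solution b p \<beta>1 \<epsilon> u0 u))"
proof -
  interpret equation b p \<beta>1 \<epsilon>
    using assms by unfold_locales
  have p1: "p - 1 > 0" using assms(2) by simp
  have no: "\<not> (\<exists>u. viscosity_solution b p \<beta>1 \<epsilon> u0 u)" if "\<beta>1 \<ge> 1 / (p - 1)"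
  proof
    assume "\<exists>u. viscosity_solution b p \<beta>1 \<epsilon> u0 u"
    then obtain u where "super_solution b p \<beta>1 \<epsilon> (\<lambda>z. real_of_ereal (lower_env b u z))"
      by (auto simp: viscosity_solution_def)
    then interpret supersolution b p \<beta>1 \<epsilon> "\<lambda>z. real_of_ereal (lower_env b u z)"
      by unfold_locales
    have "\<beta>1 * (p - 1) \<ge> 1" using that p1 by (simp add: pos_divide_le_eq)
    then show False by (rule no_supersolution)
  qed
  have ex: "\<exists>u. viscosity_solution b p \<beta>1 \<epsilon> u0 u"
    if \<beta>: "\<beta>1 < 1 / (p - 1)" and cont: "continuous_on {-b<..<b} u0"
      and bounds: "\<exists>c0 Cu. Cu \<ge> 0 \<and> (\<forall>x\<in>{-b<..<b}. c0 \<le> u0 x \<and> u0 x \<le> Cu * wt x powr \<gamma>)" for \<gamma>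
  proof -
    obtain c0 Cu where *: "Cu \<ge> 0" "\<And>x. x \<in> {-b<..<b} \<Longrightarrow> c0 \<le> u0 x"
      "\<And>x. x \<in> {-b<..<b} \<Longrightarrow> u0 x \<le> Cu * wt x powr \<gamma>"
      using bounds by blast
    have "\<beta>1 * (p - 1) < 1" using \<beta> p1 by (simp add: pos_less_divide_eq)
    from existence[OF this cont *(2,1,3)] show ?thesis .
  qed
  have sub: "continuous_on {-b<..<b} u0" if "continuous_on {-b..b} u0"
    by (rule continuous_on_subset[OF that]) auto
  show ?thesis
    using no ex[OF _ sub continuous_data_bounds] ex[OF _ _ singular_data_bounds] by blast
qed

end
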